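(* Any connected component of the tensor product $\mathbf B^{\otimes k}$ of $k$ copies of $\mathbf B$ is isomorphic, as a crystal, to $B(Y)$ for some $(m,n)$-hook Young diagram $Y$ with $k$ boxes. Moreover, for any skew Young diagrams $Y_1$ and $Y_2$, every connected component of the tensor product of crystals $B(Y_1)\otimes B(Y_2)$ is isomorphic to $B(Y)$ for some $(m,n)$-hook Young diagram $Y$.
   Context: Fix integers $m,n\ge1$. $I=\{\overline{m-1},\dots,\overline1,0,1,\dots,n-1\}$. $\mathbf B=\mathbf B_+\sqcup\mathbf B_-$, $\mathbf B_+=\{\overline m,\dots,\overline1\}$, $\mathbf B_-=\{1,\dots,n\}$, ordered by $\overline m<\overline{m-1}<\dots<\overline1<1<2<\dots<n$; $P=\bigoplus_{b\in\mathbf B}\mathbb Z\epsilon_b$. $\mathbf B$ is a crystal with $\mathrm{wt}(b)=\epsilon_b$ and $\tilde f_ib=b'$ (equivalently $\tilde e_ib'=b$) exactly for $(i,b,b')=(\overline k,\overline{k+1},\overline k)$ ($1\le k\le m-1$), $(0,\overline1,1)$, $(k,k,k+1)$ ($1\le k\le n-1$); all other values are $0$. For an element $b$ of a crystal put $\varepsilon_i(b)=\max\{r\ge0:\tilde e_i^rb\ne0\}$, $\varphi_i(b)=\max\{r\ge0:\tilde f_i^rb\ne0\}$. The tensor product of crystals has weights $\mathrm{wt}(b_1\otimes b_2)=\mathrm{wt}(b_1)+\mathrm{wt}(b_2)$ and operators (with $0\otimes b=b\otimes 0=0$): - $i=\overline k$: $\tilde e_i(b_1\otimes b_2)=\tilde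 e_ib_1\otimes b_2$ if $\varphi_i(b_1)\ge\varepsilon_i(b_2)$, else $b_1\otimes\tilde e_ib_2$; $\tilde f_i(b_1\otimes b_2)=\tilde f_ib_1\otimes b_2$ if $\varphi_i(b_1)>\varepsilon_i(b_2)$, else $b_1\otimes\tilde f_ib_2$. - $i\in\{1,\dots,n-1\}$: $\tilde e_i(b_1\otimes b_2)=b_1\otimes\tilde e_ib_2$ if $\varphi_i(b_2)\ge\varepsilon_i(b_1)$, else $\tilde e_ib_1\otimes b_2$; $\tilde f_i(b_1\otimes b_2)=b_1\otimes\tilde f_ib_2$ if $\varphi_i(b_2)>\varepsilon_i(b_1)$, else $\tilde f_ib_1\otimes b_2$. - $i=0$: with $\langle h_0,\sum_b\lambda_b\epsilon_b\rangle=\lambda_{\overline1}+\lambda_1$, the operators $\tilde e_0,\tilde f_0$ act on the first factor if $\langle h_0,\mathrm{wt}(b_1)\rangle>0$, and on the second factor if $\langle h_0,\mathrm{wt}(b_1)\rangle=0$. A skew Young diagram is obtained by removing a Young diagram from a larger Young diagram containing it. A Young diagram is an $(m,n)$-hook Young diagram if its $(m+1)$-st row has at most $n$ boxes. A semistandard tableau of (skew) shape $Y$ is a filling of the boxes of $Y$ with elements of $\mathbf B$ such that entries are weakly increasing along each row from left to right, with only elements of $\mathbf B_+$ allowed to repeat in a row, and weakly increasing down each column, with only elements of $\mathbf B_-$ allowed to repeat in a column. $B(Y)$ is the set of semistandard tableaux of shape $Y$, identified with a subset of $\mathbf B^{\otimes N}$ ($N$ = number of boxes) by sending a tableau to $b_1\otimes\dots\otimes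 b_N$, its entries read column by column from right to left, each column from top to bottom. This subset together with $0$ is stable under all $\tilde e_i,\tilde f_i$, which makes $B(Y)$ a crystal. Connected components are those of the graph with edges $b\xrightarrow{i}\tilde f_ib\ne0$, $i\in I$. A crystal isomorphism is a weight-preserving bijection commuting with all $\tilde e_i,\tilde f_i$ ($0\mapsto0$). *)

theory Defs
  imports Main
begin

text \<open>
  Letters and indices are encoded as integers: the barred symbol of \<open>k\<close> is \<open>- k\<close>, and the
  unbarred symbols are themselves. The order of the letters is then the order of \<open>int\<close>;
  \<open>0\<close> is an index but not a letter. The partial operators of a crystal take values in
  \<open>option\<close>, with \<open>None\<close> in the role of the extra element \<open>0\<close>. A weight
  is the family of its coefficients with respect to the \<open>\<epsilon>\<^sub>b\<close>.
\<close>

type_synonym weight = "int \<Rightarrow> int"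

definition Bplus :: "nat \<Rightarrow> int set" where
  "Bplus m = {- int m .. -1}"

definition Bminus :: "nat \<Rightarrow> int set" where
  "Bminus n = {1 .. int n}"

definition letters :: "nat \<Rightarrow> nat \<Rightarrow> int set" where
  "letters m n = Bplus m \<union> Bminus n"

definition indices :: "nat \<Rightarrow> nat \<Rightarrow> int set" where
  "indices m n = {1 - int m .. int n - 1}"

record 'a crystal =
  elts :: "'a set"
  wt :: "'a \<Rightarrow> weight"
  ee :: "int \<Rightarrow> 'a \<Rightarrow> 'a option"
  ff :: "int \<Rightarrow> 'a \<Rightarrow> 'a option"

definition iter :: "('a \<Rightarrow> 'a option) \<Rightarrow> nat \<Rightarrow> 'a \<Rightarrow> 'a option" where
  "iter g r b = ((\<lambda>x. Option.bind x g) ^^ r) (Some b)"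

definition eps :: "'a crystal \<Rightarrow> int \<Rightarrow> 'a \<Rightarrow> nat" where
  "eps C i b = Max {r. iter (ee C i) r b \<noteq> None}"

definition phi :: "'a crystal \<Rightarrow> int \<Rightarrow> 'a \<Rightarrow> nat" where
  "phi C i b = Max {r. iter (ff C i) r b \<noteq> None}"

definition h0 :: "weight \<Rightarrow> int" where
  "h0 l = l (-1) + l 1"


text \<open>
  The arrow with index \<open>i\<close> goes from \<open>arrow_src i\<close> to \<open>arrow_tgt i\<close>:
  from \<open>i - 1\<close> to \<open>i\<close> if \<open>i < 0\<close>, from \<open>-1\<close> to \<open>1\<close> if \<open>i = 0\<close>,
  and from \<open>i\<close> to \<open>i + 1\<close> if \<open>i > 0\<close>.
\<close>

definition arrow_src :: "int \<Rightarrow> int" where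
  "arrow_src i = (if i \<le> 0 then i - 1 else i)"

definition arrow_tgt :: "int \<Rightarrow> int" where
  "arrow_tgt i = (if i < 0 then i else i + 1)"

definition letter_crystal :: "nat \<Rightarrow> nat \<Rightarrow> int crystal" where
  "letter_crystal m n = \<lparr>
     elts = letters m n,
     wt = (\<lambda>b c. if c = b then 1 else 0),
     ee = (\<lambda>i b. if i \<in> indices m n \<and> b = arrow_tgt i then Some (arrow_src i) else None),
     ff = (\<lambda>i b. if i \<in> indices m n \<and> b = arrow_src i then Some (arrow_tgt i) else None)\<rparr>"


text \<open>
  In the case \<open>i = 0\<close> below, the value of \<open>h0\<close> is nonnegative on all weights that occur in
  the crystals considered here, so that ``not positive'' means ``zero''.
\<close>

definition tensor :: "'a crystal \<Rightarrow> 'b crystal \<Rightarrow> ('a \<times> 'b) crystal" where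
  "tensor A B = \<lparr>
     elts = elts A \<times> elts B,
     wt = (\<lambda>(a, b) c. wt A a c + wt B b c),
     ee = (\<lambda>i (a, b).
       let left = map_option (\<lambda>a'. (a', b)) (ee A i a);
           right = map_option (\<lambda>b'. (a, b')) (ee B i b)
       in if i < 0 then (if phi A i a \<ge> eps B i b then left else right)
          else if i > 0 then (if phi B i b \<ge> eps A i a then right else left)
          else (if h0 (wt A a) > 0 then left else right)),
     ff = (\<lambda>i (a, b).
       let left = map_option (\<lambda>a'. (a', b)) (ff A i a);
           right = map_option (\<lambda>b'. (a, b')) (ff B i b)
       in if i < 0 then (if phi A i a > eps B i b then left else right)
          else if i > 0 then (if phi B i b > eps A i a then right else left)
          else (if h0 (wt A a) > 0 then left else right))\<rparr>"

text \<open>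
  The \<open>k\<close>-fold tensor power of the letter crystal, with \<open>b\<^sub>1 \<otimes> \<dots> \<otimes> b\<^sub>k\<close> written as the list
  \<open>[b\<^sub>1, \<dots>, b\<^sub>k]\<close> and bracketed to the right (the tensor product is associative). The empty
  product is the trivial crystal.
\<close>

primrec tensor_power :: "nat \<Rightarrow> nat \<Rightarrow> nat \<Rightarrow> int list crystal" where
  "tensor_power m n 0 =
     \<lparr>elts = {[]}, wt = (\<lambda>_ _. 0), ee = (\<lambda>_ _. None), ff = (\<lambda>_ _. None)\<rparr>"
| "tensor_power m n (Suc k) =
     (let D = tensor (letter_crystal m n) (tensor_power m n k) in
      \<lparr>elts = (\<lambda>(b, w). b # w) ` elts D,
       wt = (\<lambda>w. wt D (hd w, tl w)),
       ee = (\<lambda>i w. map_option (\<lambda>(b, w). b # w) (ee D i (hd w, tl w))),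
       ff = (\<lambda>i w. map_option (\<lambda>(b, w). b # w) (ff D i (hd w, tl w)))\<rparr>)"


text \<open>Boxes are pairs (row, column), both counted from \<open>0\<close>, with rows going down.\<close>

definition young_diagram :: "(nat \<times> nat) set \<Rightarrow> bool" where
  "young_diagram Y \<longleftrightarrow> finite Y \<and>
     (\<forall>r c r' c'. (r, c) \<in> Y \<longrightarrow> r' \<le> r \<longrightarrow> c' \<le> c \<longrightarrow> (r', c') \<in> Y)"

definition skew_young_diagram :: "(nat \<times> nat) set \<Rightarrow> bool" where
  "skew_young_diagram Y \<longleftrightarrow>
     (\<exists>L M. young_diagram L \<and> young_diagram M \<and> M \<subseteq> L \<and> Y = L - M)"

definition hook_young_diagram :: "nat \<Rightarrow> nat \<Rightarrow> (nat \<times> nat) set \<Rightarrow> bool" where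
  "hook_young_diagram m n Y \<longleftrightarrow> young_diagram Y \<and> card {c. (m, c) \<in> Y} \<le> n"

definition semistandard ::
    "nat \<Rightarrow> nat \<Rightarrow> (nat \<times> nat) set \<Rightarrow> (nat \<times> nat \<Rightarrow> int) \<Rightarrow> bool" where
  "semistandard m n Y T \<longleftrightarrow>
     (\<forall>p\<in>Y. T p \<in> letters m n) \<and>
     (\<forall>r c c'. (r, c) \<in> Y \<longrightarrow> (r, c') \<in> Y \<longrightarrow> c < c' \<longrightarrow>
        T (r, c) \<le> T (r, c') \<and> (T (r, c) = T (r, c') \<longrightarrow> T (r, c) \<in> Bplus m)) \<and>
     (\<forall>r r' c. (r, c) \<in> Y \<longrightarrow> (r', c) \<in> Y \<longrightarrow> r < r' \<longrightarrow>
        T (r, c) \<le> T (r', c) \<and> (T (r, c) = T (r', c) \<longrightarrow> T (r, c) \<in> Bminus n))"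

definition reading_boxes :: "(nat \<times> nat) set \<Rightarrow> (nat \<times> nat) list" where
  "reading_boxes Y =
     concat (map (\<lambda>c. map (\<lambda>r. (r, c)) (sorted_list_of_set {r. (r, c) \<in> Y}))
       (rev (sorted_list_of_set (snd ` Y))))"

definition reading :: "(nat \<times> nat) set \<Rightarrow> (nat \<times> nat \<Rightarrow> int) \<Rightarrow> int list" where
  "reading Y T = map T (reading_boxes Y)"

text \<open>A tableau is identified with its reading word, from which it can be recovered.\<close>

definition tableau_crystal :: "nat \<Rightarrow> nat \<Rightarrow> (nat \<times> nat) set \<Rightarrow> int list crystal" where
  "tableau_crystal m n Y =
     (tensor_power m n (card Y))\<lparr>elts := {reading Y T | T. semistandard m n Y T}\<rparr>"


definition crystal_edges :: "nat \<Rightarrow> nat \<Rightarrow> 'a crystal \<Rightarrow> ('a \<times> 'a) set" where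
  "crystal_edges m n C =
     {(b, b'). b \<in> elts C \<and> b' \<in> elts C \<and> (\<exists>i\<in>indices m n. ff C i b = Some b')}"

definition connected_components :: "nat \<Rightarrow> nat \<Rightarrow> 'a crystal \<Rightarrow> 'a crystal set" where
  "connected_components m n C =
     (\<lambda>S. C\<lparr>elts := S\<rparr>) ` (elts C // (crystal_edges m n C \<union> (crystal_edges m n C)\<inverse>)\<^sup>*)"

definition crystal_iso ::
    "nat \<Rightarrow> nat \<Rightarrow> 'a crystal \<Rightarrow> 'b crystal \<Rightarrow> ('a \<Rightarrow> 'b) \<Rightarrow> bool" where
  "crystal_iso m n C D \<psi> \<longleftrightarrow>
     bij_betw \<psi> (elts C) (elts D) \<and>
     (\<forall>b\<in>elts C. wt D (\<psi> b) = wt C b \<and>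
        (\<forall>i\<in>indices m n. ee D i (\<psi> b) = map_option \<psi> (ee C i b) \<and>
                          ff D i (\<psi> b) = map_option \<psi> (ff C i b)))"

definition crystal_isomorphic :: "nat \<Rightarrow> nat \<Rightarrow> 'a crystal \<Rightarrow> 'b crystal \<Rightarrow> bool" where
  "crystal_isomorphic m n C D \<longleftrightarrow> (\<exists>\<psi>. crystal_iso m n C D \<psi>)"

end

theory Submission
  imports Defs "HOL-Library.Multiset"
begin

text \<open>
  All crystals of the theorem are stable subsets of crystals of words: a tensor product corresponds to
  the concatenation of words, and a tableau to its reading word. Two things have to be shown. Every
  component of words is carried isomorphically into the tableaux of some shape, and the tableaux of a
  given Young diagram form a single component.

  For the first, call two words equivalent if an isomorphism between stable sets of words maps one to
  the other. The tensor product rule sees the factors only through \<open>\<epsilon>\<^sub>i\<close> and \<open>\<phi>\<^sub>i\<close>, hence equivalence is a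
  congruence for concatenation (\<open>word_equiv_append\<close>). In the third tensor power of the letters, the words
  \<open>abc\<close> with a column \<open>ab\<close> but no column \<open>bc\<close> and those with a column \<open>bc\<close> but no column \<open>ab\<close> form
  isomorphic crystals, and the isomorphism is given by the elementary Knuth moves
  (\<open>transport_knuth_move\<close>). Column insertion is a sequence of such moves, so every word is equivalent to
  the reading word of a tableau (\<open>word_equiv_tableau_cols\<close>). A sequence of moves at fixed places is an
  injective map that commutes with the operators, on its whole domain. It carries the whole component
  into the tableaux of one shape because tableaux of convex shape are stable under the operators
  (\<open>sst_word_step\<close>).

  The second statement, \<open>tableaux_connected\<close>, is the harder one. In contrast to the crystals of
  \<open>gl(n)\<close>, a crystal of tableaux may contain several elements that are killed by all \<open>e\<^sub>i\<close>, so it is not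
  enough to climb. For \<open>n = 1\<close> climbing does work. For larger \<open>n\<close> one pushes the letter \<open>n\<close> into as
  many boxes as possible: by induction, the letters below \<open>n\<close> may be rearranged at will without changing
  the component, in particular such that \<open>n - 1\<close> stands at the end of every row of the diagram that they
  occupy. Then \<open>f\<^sub>n\<^sub>-\<^sub>1\<close> applies, unless the letters \<open>n\<close> already occupy the ends of all rows; and this set
  of boxes depends on the shape only.
\<close>

section \<open>Crystal operators on words\<close>

lemma arrow_neq [simp]: "arrow_src i \<noteq> arrow_tgt i" "arrow_tgt i \<noteq> arrow_src i"
  by (auto simp: arrow_src_def arrow_tgt_def)

text \<open>
  The values of \<open>\<epsilon>\<^sub>i\<close> and \<open>\<phi>\<^sub>i\<close> on a word, as the tensor product rule yields them when letters are
  put in front one at a time. For \<open>i \<noteq> 0\<close> this is the bracketing rule: for \<open>i < 0\<close> a source letter is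
  cancelled by a later target letter, for \<open>i > 0\<close> a target letter by a later source letter. For \<open>i = 0\<close>
  only the first letter among \<open>-1\<close> and \<open>1\<close> counts.
\<close>

fun eps_w :: "int \<Rightarrow> int list \<Rightarrow> nat" and phi_w :: "int \<Rightarrow> int list \<Rightarrow> nat" where
  "eps_w i [] = 0"
| "phi_w i [] = 0"
| "eps_w i (b # w) =
     (if i < 0 then of_bool (b = arrow_tgt i) + (eps_w i w - of_bool (b = arrow_src i))
      else if i > 0 then eps_w i w + (of_bool (b = arrow_tgt i) - phi_w i w)
      else if b = arrow_tgt i then 1 else if b = arrow_src i then 0 else eps_w i w)"
| "phi_w i (b # w) =
     (if i < 0 then phi_w i w + (of_bool (b = arrow_src i) - eps_w i w)
      else if i > 0 then of_bool (b = arrow_src i) + (phi_w i w - of_bool (b = arrow_tgt i))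
      else if b = arrow_tgt i then 0 else if b = arrow_src i then 1 else phi_w i w)"

text \<open>
  For \<open>i \<noteq> 0\<close> this is the multiplication of the bicyclic monoid, for \<open>i = 0\<close> that of a left-zero
  semigroup with a unit. Both are associative, which is why the bracketing of a tensor product is
  irrelevant.
\<close>

lemma eps_phi_append:
  "eps_w i (u @ v) =
     (if i < 0 then eps_w i u + (eps_w i v - phi_w i u)
      else if i > 0 then eps_w i v + (eps_w i u - phi_w i v)
      else if eps_w i u + phi_w i u > 0 then eps_w i u else eps_w i v) \<and>
   phi_w i (u @ v) =
     (if i < 0 then phi_w i v + (phi_w i u - eps_w i v)
      else if i > 0 then phi_w i u + (phi_w i v - eps_w i u)
      else if eps_w i u + phi_w i u > 0 then phi_w i u else phi_w i v)"
proof (induction u)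
  case (Cons b u)
  consider "b = arrow_tgt i" | "b = arrow_src i" | "b \<noteq> arrow_tgt i" "b \<noteq> arrow_src i" by blast
  then show ?case
  proof cases
    case 1
    with Cons.IH show ?thesis by (cases i "0::int" rule: linorder_cases) auto
  next
    case 2
    with Cons.IH show ?thesis by (cases i "0::int" rule: linorder_cases) auto
  next
    case 3
    with Cons.IH show ?thesis by (cases i "0::int" rule: linorder_cases) auto
  qed
qed simp

lemmas eps_w_append = eps_phi_append [THEN conjunct1]
lemmas phi_w_append = eps_phi_append [THEN conjunct2]

text \<open>
  What must hold to the left and to the right of the letter on which \<open>i\<close> acts: no uncancelled
  letter may compete with it. Neither condition mentions the letter itself, so \<open>f\<^sub>i\<close> and \<open>e\<^sub>i\<close> share
  them.
\<close>

definition okL :: "int \<Rightarrow> int list \<Rightarrow> bool" where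
  "okL i u \<longleftrightarrow> (i \<le> 0 \<longrightarrow> phi_w i u = 0) \<and> (i \<ge> 0 \<longrightarrow> eps_w i u = 0)"

definition okR :: "int \<Rightarrow> int list \<Rightarrow> bool" where
  "okR i v \<longleftrightarrow> (i < 0 \<longrightarrow> eps_w i v = 0) \<and> (i > 0 \<longrightarrow> phi_w i v = 0)"

text \<open>
  The graph of \<open>f\<^sub>i\<close> on words. Its converse is the graph of \<open>e\<^sub>i\<close>.
\<close>

definition word_step :: "int \<Rightarrow> int list \<Rightarrow> int list \<Rightarrow> bool" where
  "word_step i w w' \<longleftrightarrow> (\<exists>u v. w = u @ arrow_src i # v \<and> w' = u @ arrow_tgt i # v \<and>
     okL i u \<and> okR i v)"

lemma word_step_length: "word_step i w w' \<Longrightarrow> length w' = length w"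
  by (auto simp: word_step_def)

lemma word_step_eps_phi:
  assumes "word_step i w w'"
  shows "phi_w i w = Suc (phi_w i w')" "eps_w i w' = Suc (eps_w i w)"
  using assms unfolding word_step_def okL_def okR_def
  by (cases i "0::int" rule: linorder_cases; auto simp: eps_w_append phi_w_append)+

text \<open>
  The letter that is acted on is found from the left: it is the first one, or it is the one found in
  the rest of the word. In the second case the first letter does no harm, since a first letter that
  spoils \<open>okL\<close> would have been cancelled by, or taken the place of, the letter found.
\<close>

lemma word_step_phi_exists: "phi_w i w > 0 \<Longrightarrow> \<exists>w'. word_step i w w'"
proof -
  have "\<exists>u v. w = u @ arrow_src i # v \<and> okL i u \<and> okR i v" if "phi_w i w > 0"
    using that
  proof (induction w)
    case (Cons b w)
    show ?case
    proof (cases "b = arrow_src i \<and> okR i w")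
      case True
      then show ?thesis by (intro exI[of _ "[]"] exI[of _ w]) (auto simp: okL_def)
    next
      case False
      with Cons.prems have "phi_w i w > 0"
        by (cases "b = arrow_src i"; cases "b = arrow_tgt i") (auto simp: okR_def split: if_splits)
      then obtain u v where uv: "w = u @ arrow_src i # v" "okL i u" "okR i v"
        using Cons.IH by auto
      have "okL i (b # u)"
        using False uv Cons.prems
        by (auto simp: okL_def okR_def eps_w_append phi_w_append split: if_splits)
      then show ?thesis using uv by (intro exI[of _ "b # u"] exI[of _ v]) auto
    qed
  qed simp
  then show "phi_w i w > 0 \<Longrightarrow> \<exists>w'. word_step i w w'" unfolding word_step_def by blast
qed

lemma word_step_eps_exists: "eps_w i w > 0 \<Longrightarrow> \<exists>w'. word_step i w' w"
proof -
  have "\<exists>u v. w = u @ arrow_tgt i # v \<and> okL i u \<and> okR i v" if "eps_w i w > 0"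
    using that
  proof (induction w)
    case (Cons b w)
    show ?case
    proof (cases "b = arrow_tgt i \<and> okR i w")
      case True
      then show ?thesis by (intro exI[of _ "[]"] exI[of _ w]) (auto simp: okL_def)
    next
      case False
      with Cons.prems have "eps_w i w > 0"
        by (cases "b = arrow_src i"; cases "b = arrow_tgt i"; cases i "0::int" rule: linorder_cases)
          (simp_all add: okR_def)
      then obtain u v where uv: "w = u @ arrow_tgt i # v" "okL i u" "okR i v"
        using Cons.IH by auto
      have "okL i (b # u)"
        using False uv Cons.prems
        by (cases "b = arrow_src i"; cases "b = arrow_tgt i"; cases i "0::int" rule: linorder_cases)
          (simp_all add: okL_def okR_def eps_w_append phi_w_append)
      then show ?thesis using uv by (intro exI[of _ "b # u"] exI[of _ v]) auto
    qed
  qed simp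
  then show "eps_w i w > 0 \<Longrightarrow> \<exists>w'. word_step i w' w" unfolding word_step_def by blast
qed

text \<open>
  The alternatives of the tensor product rule: does \<open>f\<^sub>i\<close>, respectively \<open>e\<^sub>i\<close>, act on the left
  factor?
\<close>

definition left_f :: "int \<Rightarrow> int list \<Rightarrow> int list \<Rightarrow> bool" where
  "left_f i u v \<longleftrightarrow> (if i < 0 then phi_w i u > eps_w i v
     else if i > 0 then phi_w i v \<le> eps_w i u else eps_w i u + phi_w i u > 0)"

definition left_e :: "int \<Rightarrow> int list \<Rightarrow> int list \<Rightarrow> bool" where
  "left_e i u v \<longleftrightarrow> (if i < 0 then phi_w i u \<ge> eps_w i v
     else if i > 0 then phi_w i v < eps_w i u else eps_w i u + phi_w i u > 0)"

lemma append_eq_append_Cons: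
  "u @ v = a @ x # b \<longleftrightarrow> (\<exists>b'. u = a @ x # b' \<and> b = b' @ v) \<or> (\<exists>a'. a = u @ a' \<and> v = a' @ x # b)"
  by (auto simp: append_eq_append_conv2 append_eq_Cons_conv Cons_eq_append_conv)

text \<open>
  Rewriting one letter of a concatenation happens in exactly one of the two parts. Here \<open>C\<close>
  decides which part is the one where the side conditions \<open>L\<close> and \<open>R\<close> can be met.
\<close>

lemma rewrite_append:
  assumes R: "\<And>a b. u = a @ x # b \<Longrightarrow> L a \<Longrightarrow> R (b @ v) \<longleftrightarrow> R b \<and> C"
    and L: "\<And>a b. v = a @ x # b \<Longrightarrow> R b \<Longrightarrow> L (u @ a) \<longleftrightarrow> L a \<and> \<not> C"
  shows "(\<exists>a b. u @ v = a @ x # b \<and> z = a @ y # b \<and> L a \<and> R b) \<longleftrightarrow>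
    (if C then \<exists>u'. (\<exists>a b. u = a @ x # b \<and> u' = a @ y # b \<and> L a \<and> R b) \<and> z = u' @ v
     else \<exists>v'. (\<exists>a b. v = a @ x # b \<and> v' = a @ y # b \<and> L a \<and> R b) \<and> z = u @ v')"
    (is "?A \<longleftrightarrow> ?B")
proof
  assume ?A
  then obtain a b where ab: "u @ v = a @ x # b" "z = a @ y # b" "L a" "R b" by blast
  from ab(1) consider b' where "u = a @ x # b'" "b = b' @ v"
    | a' where "a = u @ a'" "v = a' @ x # b"
    unfolding append_eq_append_Cons by blast
  then show ?B
  proof cases
    case 1
    then have "C" "R b'" using R ab by auto
    then show ?thesis using 1 ab by auto
  next
    case 2
    then have "\<not> C" "L a'" using L ab by auto
    then show ?thesis using 2 ab by auto
  qed
next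
  assume B: ?B
  show ?A
  proof (cases C)
    case True
    with B obtain a b where ab: "u = a @ x # b" "z = a @ y # b @ v" "L a" "R b" by auto
    then show ?thesis using R True by (intro exI[of _ a] exI[of _ "b @ v"]) auto
  next
    case False
    with B obtain a b where ab: "v = a @ x # b" "z = u @ a @ y # b" "L a" "R b" by auto
    then show ?thesis using L False by (intro exI[of _ "u @ a"] exI[of _ b]) auto
  qed
qed

lemma word_step_append:
  "word_step i (u @ v) z \<longleftrightarrow>
     (if left_f i u v then \<exists>u'. word_step i u u' \<and> z = u' @ v
      else \<exists>v'. word_step i v v' \<and> z = u @ v')"
  unfolding word_step_def
  by (rule rewrite_append)
    (auto simp: okR_def okL_def left_f_def eps_w_append phi_w_append split: if_splits)

lemma word_step_append_rev:
  "word_step i z (u @ v) \<longleftrightarrow>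
     (if left_e i u v then \<exists>u'. word_step i u' u \<and> z = u' @ v
      else \<exists>v'. word_step i v' v \<and> z = u @ v')"
proof -
  have flip: "word_step i w' w \<longleftrightarrow>
    (\<exists>a b. w = a @ arrow_tgt i # b \<and> w' = a @ arrow_src i # b \<and> okL i a \<and> okR i b)" for w w'
    unfolding word_step_def by auto
  show ?thesis
    unfolding flip
    by (rule rewrite_append)
      (auto simp: okR_def okL_def left_e_def eps_w_append phi_w_append split: if_splits)
qed

section \<open>Crystals realized on words\<close>

lemma iter_Suc: "iter g (Suc r) a = Option.bind (g a) (iter g r)"
proof -
  have None: "((\<lambda>x. Option.bind x g) ^^ r) None = None" for r
    by (induction r) auto
  show ?thesis
    by (cases "g a") (simp_all add: iter_def funpow_swap1 None del: funpow.simps add: funpow_Suc_right)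
qed

text \<open>
  A function that drops by one along \<open>g\<close>, and is positive only where \<open>g\<close> is defined, counts how often
  \<open>g\<close> can be applied.
\<close>

lemma Max_iter:
  fixes N :: "'a \<Rightarrow> nat"
  assumes Some: "\<And>a a'. a \<in> D \<Longrightarrow> g a = Some a' \<Longrightarrow> a' \<in> D \<and> N a = Suc (N a')"
    and None: "\<And>a. a \<in> D \<Longrightarrow> N a > 0 \<Longrightarrow> g a \<noteq> None"
    and a: "a \<in> D"
  shows "Max {r. iter g r a \<noteq> None} = N a"
proof -
  have "iter g r a \<noteq> None \<longleftrightarrow> r \<le> N a" if "a \<in> D" for r a
    using that
  proof (induction r arbitrary: a)
    case 0
    then show ?case by (simp add: iter_def)
  next
    case (Suc r)
    show ?case
    proof (cases "g a")
      case None
      with assms(2)[OF Suc.prems] have "N a = 0" by auto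
      with None show ?thesis by (simp add: iter_Suc)
    next
      case (Some a')
      with assms(1)[OF Suc.prems] Suc.IH[of a'] show ?thesis by (simp add: iter_Suc)
    qed
  qed
  then have "{r. iter g r a \<noteq> None} = {.. N a}" using a by auto
  then show ?thesis by (simp add: Max_eq_iff)
qed

definition word_wt :: "int list \<Rightarrow> weight" where
  "word_wt w = (\<lambda>c. int (count_list w c))"

text \<open>
  \<open>h\<close> identifies \<open>C\<close> with the crystal of all words of length \<open>k\<close>. The set \<open>D\<close> takes the place of
  \<open>elts C\<close> because the operators are given by the same formulas on words with arbitrary integer
  entries; a stable subset can then be chosen later.
\<close>

definition realizes ::
    "nat \<Rightarrow> nat \<Rightarrow> 'a set \<Rightarrow> ('a \<Rightarrow> int list) \<Rightarrow> nat \<Rightarrow> 'a crystal \<Rightarrow> bool" where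
  "realizes m n D h k C \<longleftrightarrow> bij_betw h D {w. length w = k} \<and>
     (\<forall>a\<in>D. wt C a = word_wt (h a) \<and>
       (\<forall>i a'. ff C i a = Some a' \<longleftrightarrow> i \<in> indices m n \<and> a' \<in> D \<and> word_step i (h a) (h a')) \<and>
       (\<forall>i a'. ee C i a = Some a' \<longleftrightarrow> i \<in> indices m n \<and> a' \<in> D \<and> word_step i (h a') (h a)))"

lemma realizes_bij: "realizes m n D h k C \<Longrightarrow> bij_betw h D {w. length w = k}"
  and realizes_wt: "realizes m n D h k C \<Longrightarrow> a \<in> D \<Longrightarrow> wt C a = word_wt (h a)"
  and realizes_ff: "realizes m n D h k C \<Longrightarrow> a \<in> D \<Longrightarrow>
    ff C i a = Some a' \<longleftrightarrow> i \<in> indices m n \<and> a' \<in> D \<and> word_step i (h a) (h a')"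
  and realizes_ee: "realizes m n D h k C \<Longrightarrow> a \<in> D \<Longrightarrow>
    ee C i a = Some a' \<longleftrightarrow> i \<in> indices m n \<and> a' \<in> D \<and> word_step i (h a') (h a)"
  by (simp_all add: realizes_def)

lemma realizes_length: "realizes m n D h k C \<Longrightarrow> a \<in> D \<Longrightarrow> length (h a) = k"
  using realizes_bij bij_betwE by blast

lemma realizes_surj: "realizes m n D h k C \<Longrightarrow> length w = k \<Longrightarrow> \<exists>a\<in>D. h a = w"
  using realizes_bij unfolding bij_betw_def by (metis (mono_tags) imageE mem_Collect_eq)

lemma realizes_inj: "realizes m n D h k C \<Longrightarrow> a \<in> D \<Longrightarrow> a' \<in> D \<Longrightarrow> h a = h a' \<longleftrightarrow> a = a'"
  by (metis bij_betw_inv_into_left realizes_bij)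

lemma realizes_phi:
  assumes R: "realizes m n D h k C" and a: "a \<in> D" and i: "i \<in> indices m n"
  shows "phi C i a = phi_w i (h a)"
  unfolding phi_def
proof (rule Max_iter[where D = D and N = "\<lambda>a. phi_w i (h a)", OF _ _ a])
  show "a' \<in> D \<and> phi_w i (h a) = Suc (phi_w i (h a'))" if "a \<in> D" "ff C i a = Some a'" for a a'
    using that realizes_ff[OF R] word_step_eps_phi by auto
next
  fix a assume a: "a \<in> D" "0 < phi_w i (h a)"
  then obtain w where w: "word_step i (h a) w" using word_step_phi_exists by blast
  then obtain a' where "a' \<in> D" "h a' = w"
    using realizes_surj[OF R] realizes_length[OF R] a word_step_length by metis
  then have "ff C i a = Some a'" using a w i realizes_ff[OF R] by auto
  then show "ff C i a \<noteq> None" by simp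
qed

lemma realizes_eps:
  assumes R: "realizes m n D h k C" and a: "a \<in> D" and i: "i \<in> indices m n"
  shows "eps C i a = eps_w i (h a)"
  unfolding eps_def
proof (rule Max_iter[where D = D and N = "\<lambda>a. eps_w i (h a)", OF _ _ a])
  show "a' \<in> D \<and> eps_w i (h a) = Suc (eps_w i (h a'))" if "a \<in> D" "ee C i a = Some a'" for a a'
    using that realizes_ee[OF R] word_step_eps_phi by auto
next
  fix a assume a: "a \<in> D" "0 < eps_w i (h a)"
  then obtain w where w: "word_step i w (h a)" using word_step_eps_exists by blast
  then obtain a' where "a' \<in> D" "h a' = w"
    using realizes_surj[OF R] realizes_length[OF R] a word_step_length by metis
  then have "ee C i a = Some a'" using a w i realizes_ee[OF R] by auto
  then show "ee C i a \<noteq> None" by simp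
qed

lemma eps_phi_0_pos: "eps_w 0 w + phi_w 0 w > 0 \<longleftrightarrow> -1 \<in> set w \<or> 1 \<in> set w"
  by (induction w) (auto simp: arrow_src_def arrow_tgt_def)

text \<open>
  The test on weights in the rule for \<open>i = 0\<close> asks whether one of the letters \<open>-1\<close> and \<open>1\<close> occurs.
\<close>

lemma h0_word_wt: "h0 (word_wt w) > 0 \<longleftrightarrow> eps_w 0 w + phi_w 0 w > 0"
  unfolding eps_phi_0_pos h0_def word_wt_def
  using count_list_0_iff[of w 1] count_list_0_iff[of w "-1"]
  by (cases "1 \<in> set w"; cases "-1 \<in> set w") auto

lemma word_step_append_same_length:
  assumes "length u' = length u"
  shows "word_step i (u @ v) (u' @ v') \<longleftrightarrow>
      (if left_f i u v then word_step i u u' \<and> v' = v else word_step i v v' \<and> u' = u)"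
    and "word_step i (u' @ v') (u @ v) \<longleftrightarrow>
      (if left_e i u v then word_step i u' u \<and> v' = v else word_step i v' v \<and> u' = u)"
proof -
  show "word_step i (u @ v) (u' @ v') \<longleftrightarrow>
      (if left_f i u v then word_step i u u' \<and> v' = v else word_step i v v' \<and> u' = u)"
  proof (cases "left_f i u v")
    case True
    then show ?thesis
      unfolding word_step_append using word_step_length[of i u] assms
      by (auto simp del: append_eq_append_conv simp: append_eq_append_conv[OF disjI1])
  next
    case False
    then show ?thesis
      unfolding word_step_append using assms
      by (auto simp del: append_eq_append_conv simp: append_eq_append_conv[OF disjI1])
  qed
  show "word_step i (u' @ v') (u @ v) \<longleftrightarrow>
      (if left_e i u v then word_step i u' u \<and> v' = v else word_step i v' v \<and> u' = u)"
  proof (cases "left_e i u v")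
    case True
    then show ?thesis
      unfolding word_step_append_rev using word_step_length[of i _ u] assms
      by (auto simp del: append_eq_append_conv simp: append_eq_append_conv[OF disjI1])
  next
    case False
    then show ?thesis
      unfolding word_step_append_rev using assms
      by (auto simp del: append_eq_append_conv simp: append_eq_append_conv[OF disjI1])
  qed
qed

text \<open>
  Tensor products become concatenations, whatever the factors are. This yields the tensor powers by
  induction, and the tensor product of two tableau crystals directly.
\<close>

lemma realizes_tensor:
  assumes A: "realizes m n D h k A" and B: "realizes m n D' h' l B"
  shows "realizes m n (D \<times> D') (\<lambda>(a, b). h a @ h' b) (k + l) (tensor A B)"
proof -
  let ?h = "\<lambda>(a, b). h a @ h' b"
  have hD: "length (h a) = k" if "a \<in> D" for a using realizes_length[OF A that] .
  have hD': "length (h' b) = l" if "b \<in> D'" for b using realizes_length[OF B that] .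
  have bij: "bij_betw ?h (D \<times> D') {w. length w = k + l}"
  proof (rule bij_betwI')
    show "(?h x = ?h y) = (x = y)" if "x \<in> D \<times> D'" "y \<in> D \<times> D'" for x y
      using that hD hD' realizes_inj[OF A] realizes_inj[OF B] by (auto simp: append_eq_append_conv)
    show "?h x \<in> {w. length w = k + l}" if "x \<in> D \<times> D'" for x using that hD hD' by auto
    fix w :: "int list" assume w: "w \<in> {w. length w = k + l}"
    obtain a where "a \<in> D" "h a = take k w" using realizes_surj[OF A, of "take k w"] w by auto
    moreover obtain b where "b \<in> D'" "h' b = drop k w"
      using realizes_surj[OF B, of "drop k w"] w by auto
    ultimately show "\<exists>x\<in>D \<times> D'. w = ?h x" by (intro bexI[of _ "(a, b)"]) auto
  qed
  show ?thesis
    unfolding realizes_def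
  proof (intro conjI ballI allI bij)
    fix x assume "x \<in> D \<times> D'"
    then obtain a b where x: "x = (a, b)" and a: "a \<in> D" and b: "b \<in> D'" by auto
    show "wt (tensor A B) x = word_wt (?h x)"
      using realizes_wt[OF A a] realizes_wt[OF B b]
      by (auto simp: x tensor_def word_wt_def)
    fix i and y :: "'a \<times> 'b"
    obtain a' b' where y: "y = (a', b')" by force
    have len: "length (h a') = length (h a)" "length (h' b') = length (h' b)" if "y \<in> D \<times> D'"
      using that hD hD' a b y by auto
    have pe: "phi A i a = phi_w i (h a)" "eps A i a = eps_w i (h a)"
      "phi B i b = phi_w i (h' b)" "eps B i b = eps_w i (h' b)" if "i \<in> indices m n"
      using that realizes_phi[OF A a] realizes_phi[OF B b] realizes_eps[OF A a] realizes_eps[OF B b]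
      by auto
    have h0: "h0 (wt A a) > 0 \<longleftrightarrow> eps_w 0 (h a) + phi_w 0 (h a) > 0"
      using h0_word_wt realizes_wt[OF A a] by simp
    show "ff (tensor A B) i x = Some y \<longleftrightarrow>
      i \<in> indices m n \<and> y \<in> D \<times> D' \<and> word_step i (?h x) (?h y)"
    proof (cases "i \<in> indices m n")
      case True
      have f: "ff (tensor A B) i x = (if left_f i (h a) (h' b)
        then map_option (\<lambda>a'. (a', b)) (ff A i a) else map_option (\<lambda>b'. (a, b')) (ff B i b))"
        using h0 by (auto simp: x tensor_def left_f_def pe[OF True])
      show ?thesis
      proof (cases "left_f i (h a) (h' b)")
        case left: True
        have "word_step i (h a @ h' b) (h a' @ h' b') \<and> y \<in> D \<times> D' \<longleftrightarrow>
          word_step i (h a) (h a') \<and> h' b' = h' b \<and> y \<in> D \<times> D'"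
          using len left word_step_append_same_length(1)[where u' = "h a'" and u = "h a" and i = i and v = "h' b" and v' = "h' b'"]
          by (cases "y \<in> D \<times> D'") simp_all
        moreover have "h' b' = h' b \<and> y \<in> D \<times> D' \<longleftrightarrow> b' = b \<and> y \<in> D \<times> D'"
          using realizes_inj[OF B, of b' b] b y by blast
        moreover have "ff (tensor A B) i x = Some y \<longleftrightarrow> ff A i a = Some a' \<and> b' = b"
          using left by (cases "ff A i a") (auto simp: f y)
        ultimately show ?thesis
          using True realizes_ff[OF A a, of i "a'"] b unfolding x y prod.case mem_Times_iff fst_conv snd_conv by blast
      next
        case right: False
        have "word_step i (h a @ h' b) (h a' @ h' b') \<and> y \<in> D \<times> D' \<longleftrightarrow>
          word_step i (h' b) (h' b') \<and> h a' = h a \<and> y \<in> D \<times> D'"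
          using len right word_step_append_same_length(1)[where u' = "h a'" and u = "h a" and i = i and v = "h' b" and v' = "h' b'"]
          by (cases "y \<in> D \<times> D'") simp_all
        moreover have "h a' = h a \<and> y \<in> D \<times> D' \<longleftrightarrow> a' = a \<and> y \<in> D \<times> D'"
          using realizes_inj[OF A, of a' a] a y by blast
        moreover have "ff (tensor A B) i x = Some y \<longleftrightarrow> ff B i b = Some b' \<and> a' = a"
          using right by (cases "ff B i b") (auto simp: f y)
        ultimately show ?thesis
          using True realizes_ff[OF B b, of i "b'"] a unfolding x y prod.case mem_Times_iff fst_conv snd_conv by blast
      qed
    next
      case False
      have "ff A i a = None"
        using False realizes_ff[OF A a, of i] by (cases "ff A i a") auto
      moreover have "ff B i b = None"
        using False realizes_ff[OF B b, of i] by (cases "ff B i b") auto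
      ultimately show ?thesis using False by (cases "i = 0") (auto simp: x tensor_def Let_def)
    qed
    show "ee (tensor A B) i x = Some y \<longleftrightarrow>
      i \<in> indices m n \<and> y \<in> D \<times> D' \<and> word_step i (?h y) (?h x)"
    proof (cases "i \<in> indices m n")
      case True
      have f: "ee (tensor A B) i x = (if left_e i (h a) (h' b)
        then map_option (\<lambda>a'. (a', b)) (ee A i a) else map_option (\<lambda>b'. (a, b')) (ee B i b))"
        using h0 by (auto simp: x tensor_def left_e_def pe[OF True])
      show ?thesis
      proof (cases "left_e i (h a) (h' b)")
        case left: True
        have "word_step i (h a' @ h' b') (h a @ h' b) \<and> y \<in> D \<times> D' \<longleftrightarrow>
          word_step i (h a') (h a) \<and> h' b' = h' b \<and> y \<in> D \<times> D'"
          using len left word_step_append_same_length(2)[where u' = "h a'" and u = "h a" and i = i and v = "h' b" and v' = "h' b'"]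
          by (cases "y \<in> D \<times> D'") simp_all
        moreover have "h' b' = h' b \<and> y \<in> D \<times> D' \<longleftrightarrow> b' = b \<and> y \<in> D \<times> D'"
          using realizes_inj[OF B, of b' b] b y by blast
        moreover have "ee (tensor A B) i x = Some y \<longleftrightarrow> ee A i a = Some a' \<and> b' = b"
          using left by (cases "ee A i a") (auto simp: f y)
        ultimately show ?thesis
          using True realizes_ee[OF A a, of i "a'"] b unfolding x y prod.case mem_Times_iff fst_conv snd_conv by blast
      next
        case right: False
        have "word_step i (h a' @ h' b') (h a @ h' b) \<and> y \<in> D \<times> D' \<longleftrightarrow>
          word_step i (h' b') (h' b) \<and> h a' = h a \<and> y \<in> D \<times> D'"
          using len right word_step_append_same_length(2)[where u' = "h a'" and u = "h a" and i = i and v = "h' b" and v' = "h' b'"]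
          by (cases "y \<in> D \<times> D'") simp_all
        moreover have "h a' = h a \<and> y \<in> D \<times> D' \<longleftrightarrow> a' = a \<and> y \<in> D \<times> D'"
          using realizes_inj[OF A, of a' a] a y by blast
        moreover have "ee (tensor A B) i x = Some y \<longleftrightarrow> ee B i b = Some b' \<and> a' = a"
          using right by (cases "ee B i b") (auto simp: f y)
        ultimately show ?thesis
          using True realizes_ee[OF B b, of i "b'"] a unfolding x y prod.case mem_Times_iff fst_conv snd_conv by blast
      qed
    next
      case False
      have "ee A i a = None"
        using False realizes_ee[OF A a, of i] by (cases "ee A i a") auto
      moreover have "ee B i b = None"
        using False realizes_ee[OF B b, of i] by (cases "ee B i b") auto
      ultimately show ?thesis using False by (cases "i = 0") (auto simp: x tensor_def Let_def)
    qed
  qed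
qed

lemma realizes_letter_crystal:
  "realizes m n UNIV (\<lambda>b. [b]) 1 (letter_crystal m n)"
proof -
  have "word_step i [b] [b'] \<longleftrightarrow> b = arrow_src i \<and> b' = arrow_tgt i" for i b b'
    by (auto simp: word_step_def Cons_eq_append_conv okL_def okR_def)
  moreover have "bij_betw (\<lambda>b::int. [b]) UNIV {w. length w = 1}"
    by (rule bij_betwI') (auto simp: length_Suc_conv)
  ultimately show ?thesis
    unfolding realizes_def letter_crystal_def by (auto simp: word_wt_def)
qed

lemma realizes_tensor_power:
  "realizes m n {w. length w = k} (\<lambda>w. w) k (tensor_power m n k)"
proof (induction k)
  case 0
  have "bij_betw (\<lambda>w. w) {w::int list. length w = 0} {w. length w = 0}"
    using bij_betw_id by (simp add: id_def)
  then show ?case by (auto simp: realizes_def word_wt_def word_step_def)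
next
  case (Suc k)
  let ?D = "tensor (letter_crystal m n) (tensor_power m n k)"
  have T: "realizes m n (UNIV \<times> {w. length w = k}) (\<lambda>(b, w). b # w) (Suc k) ?D"
    using realizes_tensor[OF realizes_letter_crystal Suc.IH] by simp
  have bij: "bij_betw (\<lambda>w. w) {w::int list. length w = Suc k} {w. length w = Suc k}"
    using bij_betw_id by (simp add: id_def)
  have conv: "map_option (\<lambda>(b, w). b # w) p = Some w' \<longleftrightarrow>
    w' \<noteq> [] \<and> p = Some (hd w', tl w')" for p :: "(int \<times> int list) option" and w'
    by (cases p) (auto simp: neq_Nil_conv)
  show ?case
    unfolding realizes_def
  proof (intro conjI ballI allI bij)
    fix w :: "int list" assume w: "w \<in> {w. length w = Suc k}"
    have dom: "(hd w, tl w) \<in> UNIV \<times> {w. length w = k}" and cons: "hd w # tl w = w"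
      using w by (auto simp: length_Suc_conv)
    show "wt (tensor_power m n (Suc k)) w = word_wt w"
      using realizes_wt[OF T dom] cons by (simp add: Let_def)
    show "ff (tensor_power m n (Suc k)) i w = Some w' \<longleftrightarrow>
      i \<in> indices m n \<and> w' \<in> {w. length w = Suc k} \<and> word_step i w w'" for i w'
      using realizes_ff[OF T dom, of i "(hd w', tl w')"] cons
      by (cases w') (auto simp: Let_def conv)
    show "ee (tensor_power m n (Suc k)) i w = Some w' \<longleftrightarrow>
      i \<in> indices m n \<and> w' \<in> {w. length w = Suc k} \<and> word_step i w' w" for i w'
      using realizes_ee[OF T dom, of i "(hd w', tl w')"] cons
      by (cases w') (auto simp: Let_def conv)
  qed
qed

section \<open>Equivalence of words\<close>

text \<open>
  \<open>col_rel x y\<close> says that \<open>x\<close> may stand above \<open>y\<close> in a column.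
\<close>

definition col_rel :: "int \<Rightarrow> int \<Rightarrow> bool" where
  "col_rel x y \<longleftrightarrow> x < y \<or> (x = y \<and> 0 < x)"

text \<open>
  \<open>x\<close> may stand to the left of \<open>y\<close> in a row exactly if \<open>y\<close> may not stand above \<open>x\<close> in a column. So
  every pair of letters satisfies exactly one of \<open>col_rel y x\<close> and \<open>row_rel x y\<close>, and the parities of
  the letters need not be distinguished in the insertion algorithm.
\<close>

abbreviation row_rel :: "int \<Rightarrow> int \<Rightarrow> bool" where
  "row_rel x y \<equiv> \<not> col_rel y x"

text \<open>
  The map \<open>\<psi>\<close> respects all structure at the word \<open>u\<close>. The clause on \<open>\<epsilon>\<^sub>i\<close> and \<open>\<phi>\<^sub>i\<close> is what
  makes such maps compatible with concatenation, and it lets the existence of an arrow at \<open>\<psi> u\<close> be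
  read off at \<open>u\<close>.
\<close>

definition transports_at :: "int list set \<Rightarrow> (int list \<Rightarrow> int list) \<Rightarrow> int list \<Rightarrow> bool" where
  "transports_at U \<psi> u \<longleftrightarrow> 0 \<notin> set u \<and> mset (\<psi> u) = mset u \<and>
     (\<forall>i. eps_w i (\<psi> u) = eps_w i u \<and> phi_w i (\<psi> u) = phi_w i u) \<and>
     (\<forall>i u'. word_step i u u' \<longrightarrow> u' \<in> U \<and> word_step i (\<psi> u) (\<psi> u')) \<and>
     (\<forall>i u'. word_step i u' u \<longrightarrow> u' \<in> U \<and> word_step i (\<psi> u') (\<psi> u))"

text \<open>
  An isomorphism from the stable set \<open>U\<close> of words onto its image. The domain is part of the notion
  because an elementary Knuth move at a given position applies only to some of the words of a given
  length.
\<close>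

definition transport :: "int list set \<Rightarrow> (int list \<Rightarrow> int list) \<Rightarrow> bool" where
  "transport U \<psi> \<longleftrightarrow> inj_on \<psi> U \<and> (\<forall>u\<in>U. transports_at U \<psi> u)"

text \<open>
  Two words correspond to each other under an isomorphism of stable sets of words of fixed length, in
  particular under an isomorphism of their connected components.
\<close>

definition word_equiv :: "int list \<Rightarrow> int list \<Rightarrow> bool" where
  "word_equiv w w' \<longleftrightarrow> (\<exists>U \<psi>. transport U \<psi> \<and> w \<in> U \<and> \<psi> w = w' \<and> (\<forall>u\<in>U. length u = length w))"

lemma transportD:
  assumes "transport U \<psi>" "u \<in> U"
  shows "0 \<notin> set u" "mset (\<psi> u) = mset u" "length (\<psi> u) = length u"
    "eps_w i (\<psi> u) = eps_w i u" "phi_w i (\<psi> u) = phi_w i u"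
    "word_step i u u' \<Longrightarrow> u' \<in> U" "word_step i u u' \<Longrightarrow> word_step i (\<psi> u) (\<psi> u')"
    "word_step i u' u \<Longrightarrow> u' \<in> U" "word_step i u' u \<Longrightarrow> word_step i (\<psi> u') (\<psi> u)"
proof -
  have *: "transports_at U \<psi> u" using assms unfolding transport_def by blast
  then show "0 \<notin> set u" "mset (\<psi> u) = mset u" "length (\<psi> u) = length u"
    unfolding transports_at_def by (blast, blast, metis mset_eq_length)
  from * show "eps_w i (\<psi> u) = eps_w i u" "phi_w i (\<psi> u) = phi_w i u"
    "word_step i u u' \<Longrightarrow> u' \<in> U" "word_step i u u' \<Longrightarrow> word_step i (\<psi> u) (\<psi> u')"
    "word_step i u' u \<Longrightarrow> u' \<in> U" "word_step i u' u \<Longrightarrow> word_step i (\<psi> u') (\<psi> u)"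
    unfolding transports_at_def by blast+
qed

lemma word_step_nonzero:
  assumes "word_step i w w'"
  shows "0 \<in> set w' \<longleftrightarrow> 0 \<in> set w"
proof -
  have "arrow_src i \<noteq> 0" "arrow_tgt i \<noteq> 0" by (auto simp: arrow_src_def arrow_tgt_def)
  then show ?thesis using assms unfolding word_step_def by auto
qed

lemma word_equiv_refl:
  assumes "0 \<notin> set w"
  shows "word_equiv w w"
proof -
  let ?U = "{u. 0 \<notin> set u \<and> length u = length w}"
  have "transports_at ?U (\<lambda>u. u) u" if "u \<in> ?U" for u
    using that word_step_nonzero word_step_length unfolding transports_at_def by simp metis
  then have "transport ?U (\<lambda>u. u)" unfolding transport_def by simp
  then show ?thesis
    unfolding word_equiv_def using assms by (intro exI[of _ ?U] exI[of _ "\<lambda>u. u"]) simp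
qed

lemma word_equiv_trans:
  assumes "word_equiv u v" "word_equiv v w"
  shows "word_equiv u w"
proof -
  obtain U \<psi> where U: "transport U \<psi>" "u \<in> U" "\<psi> u = v" "\<forall>x\<in>U. length x = length u"
    using assms(1) unfolding word_equiv_def by blast
  obtain V \<chi> where V: "transport V \<chi>" "v \<in> V" "\<chi> v = w"
    using assms(2) unfolding word_equiv_def by blast
  let ?W = "{x \<in> U. \<psi> x \<in> V}"
  have "inj_on (\<chi> \<circ> \<psi>) ?W"
    using U(1) V(1) unfolding transport_def inj_on_def by auto
  moreover have "transports_at ?W (\<chi> \<circ> \<psi>) x" if x: "x \<in> ?W" for x
  proof -
    from x have xU: "x \<in> U" and xV: "\<psi> x \<in> V" by auto
    note X = transportD[OF U(1) xU] and Y = transportD[OF V(1) xV]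
    show ?thesis
      unfolding transports_at_def comp_apply
      using X(1) X(2)[folded Y(2)] X(4,5)[folded Y(4,5)] X(6-9) Y(6-9) by blast
  qed
  ultimately have "transport ?W (\<chi> \<circ> \<psi>)"
    unfolding transport_def by blast
  moreover have "u \<in> ?W" "(\<chi> \<circ> \<psi>) u = w" using U(2,3) V(2,3) by simp_all
  moreover have "\<forall>x\<in>?W. length x = length u" using U(4) by blast
  ultimately show ?thesis unfolding word_equiv_def by (intro exI conjI)
qed

lemma left_f_cong:
  assumes "eps_w i u' = eps_w i u" "phi_w i u' = phi_w i u" "eps_w i v' = eps_w i v" "phi_w i v' = phi_w i v"
  shows "left_f i u' v' = left_f i u v" "left_e i u' v' = left_e i u v"
  unfolding left_f_def left_e_def by (simp_all only: assms)

text \<open>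
  Side by side, two isomorphisms form one on concatenations: the tensor product rule chooses the
  factor by looking only at the values of \<open>\<epsilon>\<^sub>i\<close> and \<open>\<phi>\<^sub>i\<close>, which are preserved. Fixed lengths make the
  decomposition of a word unique.
\<close>

lemma word_equiv_append:
  assumes "word_equiv a a'" "word_equiv b b'"
  shows "word_equiv (a @ b) (a' @ b')"
proof -
  obtain U \<psi> where U: "transport U \<psi>" "a \<in> U" "\<psi> a = a'" "\<And>x. x \<in> U \<Longrightarrow> length x = length a"
    using assms(1) unfolding word_equiv_def by blast
  obtain V \<chi> where V: "transport V \<chi>" "b \<in> V" "\<chi> b = b'" "\<And>x. x \<in> V \<Longrightarrow> length x = length b"
    using assms(2) unfolding word_equiv_def by blast
  define W where "W = {x @ y | x y. x \<in> U \<and> y \<in> V}"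
  define \<omega> where "\<omega> z = \<psi> (take (length a) z) @ \<chi> (drop (length a) z)" for z
  have \<omega>: "\<omega> (x @ y) = \<psi> x @ \<chi> y" if "x \<in> U" for x y
    using U(4)[OF that] by (simp add: \<omega>_def)
  have "inj_on \<omega> W"
  proof (rule inj_onI)
    fix p q assume "p \<in> W" "q \<in> W" and eq: "\<omega> p = \<omega> q"
    then obtain x y x' y' where xy: "p = x @ y" "q = x' @ y'" "x \<in> U" "y \<in> V" "x' \<in> U" "y' \<in> V"
      unfolding W_def by blast
    have "length (\<psi> x) = length (\<psi> x')"
      using transportD(3)[OF U(1)] U(4) xy by simp
    then have "\<psi> x = \<psi> x'" "\<chi> y = \<chi> y'" using eq xy \<omega> by auto
    then show "p = q" using U(1) V(1) xy unfolding transport_def by (auto dest: inj_onD)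
  qed
  moreover have "transports_at W \<omega> p" if pW: "p \<in> W" for p
  proof -
    obtain x y where p: "p = x @ y" and x: "x \<in> U" and y: "y \<in> V" using pW unfolding W_def by blast
    note X = transportD[OF U(1) x] and Y = transportD[OF V(1) y]
    have c: "left_f i (\<psi> x) (\<chi> y) = left_f i x y" "left_e i (\<psi> x) (\<chi> y) = left_e i x y" for i
      by (rule left_f_cong[OF X(4,5) Y(4,5)])+
    have "p' \<in> W \<and> word_step i (\<omega> p) (\<omega> p')" if s: "word_step i p p'" for i p'
    proof (cases "left_f i x y")
      case True
      then obtain x' where x': "word_step i x x'" "p' = x' @ y"
        using s unfolding p word_step_append by auto
      then have "x' \<in> U" "word_step i (\<psi> x) (\<psi> x')" using X(6,7) by blast+
      then show ?thesis
        using True x' x y unfolding W_def by (auto simp: p \<omega> word_step_append c)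
    next
      case False
      then obtain y' where y': "word_step i y y'" "p' = x @ y'"
        using s unfolding p word_step_append by auto
      then have "y' \<in> V" "word_step i (\<chi> y) (\<chi> y')" using Y(6,7) by blast+
      then show ?thesis
        using False y' x y unfolding W_def by (auto simp: p \<omega> word_step_append c)
    qed
    moreover have "p' \<in> W \<and> word_step i (\<omega> p') (\<omega> p)" if s: "word_step i p' p" for i p'
    proof (cases "left_e i x y")
      case True
      then obtain x' where x': "word_step i x' x" "p' = x' @ y"
        using s unfolding p word_step_append_rev by auto
      then have "x' \<in> U" "word_step i (\<psi> x') (\<psi> x)" using X(8,9) by blast+
      then show ?thesis
        using True x' x y unfolding W_def by (auto simp: p \<omega> word_step_append_rev c)
    next
      case False
      then obtain y' where y': "word_step i y' y" "p' = x @ y'"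
        using s unfolding p word_step_append_rev by auto
      then have "y' \<in> V" "word_step i (\<chi> y') (\<chi> y)" using Y(8,9) by blast+
      then show ?thesis
        using False y' x y unfolding W_def by (auto simp: p \<omega> word_step_append_rev c)
    qed
    moreover have "0 \<notin> set p" "mset (\<omega> p) = mset p"
      "eps_w i (\<omega> p) = eps_w i p" "phi_w i (\<omega> p) = phi_w i p" for i
      using X(1-5) Y(1-5) by (simp_all add: p \<omega> x eps_w_append phi_w_append)
    ultimately show ?thesis
      unfolding transports_at_def by blast
  qed
  ultimately have "transport W \<omega>" unfolding transport_def by blast
  moreover have "a @ b \<in> W" using U(2) V(2) unfolding W_def by blast
  moreover have "\<omega> (a @ b) = a' @ b'" using \<omega>[OF U(2)] U(3) V(3) by simp
  moreover have "\<forall>p\<in>W. length p = length (a @ b)"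
  proof
    fix p assume "p \<in> W"
    then obtain x y where "p = x @ y" "x \<in> U" "y \<in> V" unfolding W_def by blast
    then show "length p = length (a @ b)" using U(4)[of x] V(4)[of y] by simp
  qed
  ultimately show ?thesis unfolding word_equiv_def by (intro exI conjI)
qed

section \<open>Knuth moves\<close>

lemma ex_Cons_eq_append_Cons:
  "(\<exists>u v. a # w = u @ x # v \<and> P u v) \<longleftrightarrow> (a = x \<and> P [] w) \<or> (\<exists>u v. w = u @ x # v \<and> P (a # u) v)"
  (is "?A \<longleftrightarrow> ?B")
proof
  assume ?A
  then obtain u v where *: "a # w = u @ x # v" "P u v" by blast
  then show ?B by (cases u) auto
next
  assume ?B
  then show ?A by (metis append_Cons append_Nil)
qed

lemma ok_Nil [simp]: "okL i []" "okR i []"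
  by (simp_all add: okL_def okR_def)

lemma word_step_3:
  "word_step i [a, b, c] z \<longleftrightarrow>
    (a = arrow_src i \<and> z = [arrow_tgt i, b, c] \<and> okR i [b, c]) \<or>
    (b = arrow_src i \<and> z = [a, arrow_tgt i, c] \<and> okL i [a] \<and> okR i [c]) \<or>
    (c = arrow_src i \<and> z = [a, b, arrow_tgt i] \<and> okL i [a, b])"
  unfolding word_step_def ex_Cons_eq_append_Cons by simp

lemma word_step_3_rev:
  "word_step i z [a, b, c] \<longleftrightarrow>
    (a = arrow_tgt i \<and> z = [arrow_src i, b, c] \<and> okR i [b, c]) \<or>
    (b = arrow_tgt i \<and> z = [a, arrow_src i, c] \<and> okL i [a] \<and> okR i [c]) \<or>
    (c = arrow_tgt i \<and> z = [a, b, arrow_src i] \<and> okL i [a, b])"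
proof -
  have "word_step i z [a, b, c] \<longleftrightarrow>
    (\<exists>u v. [a, b, c] = u @ arrow_tgt i # v \<and> z = u @ arrow_src i # v \<and> okL i u \<and> okR i v)"
    unfolding word_step_def by (intro ex_cong1) (simp only: conj_left_commute)
  then show ?thesis unfolding ex_Cons_eq_append_Cons by simp
qed

lemma row_col_trans:
  "row_rel x y \<Longrightarrow> row_rel y z \<Longrightarrow> row_rel x z"
  "row_rel x y \<Longrightarrow> col_rel y z \<Longrightarrow> row_rel x z"
  "col_rel x y \<Longrightarrow> row_rel y z \<Longrightarrow> row_rel x z"
  unfolding col_rel_def by presburger+

text \<open>
  The elementary Knuth moves, in the version for two kinds of letters: \<open>yzx \<rightarrow> yxz\<close> if \<open>x\<close> may precede
  \<open>y\<close> in a row and \<open>y\<close> may precede \<open>z\<close> in a column, and \<open>ayx \<rightarrow> yax\<close> if \<open>a\<close> may precede \<open>x\<close> in a column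
  and \<open>x\<close> may precede \<open>y\<close> in a row. The comparison of the outer letters tells the two cases apart.
\<close>

definition knuth_move :: "int list \<Rightarrow> int list" where
  "knuth_move w = (if col_rel (w ! 0) (w ! 2) then [w ! 1, w ! 0, w ! 2] else [w ! 0, w ! 2, w ! 1])"

lemma knuth_move_3: "knuth_move [a, b, c] = (if col_rel a c then [b, a, c] else [a, c, b])"
  by (simp add: knuth_move_def numeral_2_eq_2)

lemma arrow_cases:
  obtains "i < 0" "arrow_src i = i - 1" "arrow_tgt i = i"
  | "i = 0" "arrow_src i = -1" "arrow_tgt i = 1"
  | "i > 0" "arrow_src i = i" "arrow_tgt i = i + 1"
  by (cases i "0::int" rule: linorder_cases) (auto simp: arrow_src_def arrow_tgt_def)

lemma col_rel_arrows [simp]: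
  "col_rel (arrow_src i) (arrow_tgt i)" "\<not> col_rel (arrow_tgt i) (arrow_src i)"
  "col_rel (arrow_src i) (arrow_src i) \<longleftrightarrow> 0 < i"
  "col_rel (arrow_tgt i) (arrow_tgt i) \<longleftrightarrow> 0 \<le> i"
  by (auto simp: col_rel_def arrow_src_def arrow_tgt_def)

text \<open>
  No letter lies strictly between the source and the target of an arrow, so a third letter compares
  in the same way with both of them.
\<close>

lemma col_rel_neutral:
  assumes "x \<noteq> 0" "x \<noteq> arrow_src i" "x \<noteq> arrow_tgt i"
  shows "col_rel x (arrow_src i) \<longleftrightarrow> col_rel x (arrow_tgt i)"
    "col_rel (arrow_src i) x \<longleftrightarrow> \<not> col_rel x (arrow_tgt i)"
    "col_rel (arrow_tgt i) x \<longleftrightarrow> \<not> col_rel x (arrow_tgt i)"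
  using assms by (cases i rule: arrow_cases; simp add: col_rel_def; linarith)+

lemma letter_cases:
  obtains (src) "x = arrow_src i" | (tgt) "x = arrow_tgt i" | (neutral) "x \<noteq> arrow_src i" "x \<noteq> arrow_tgt i"
  by blast

text \<open>
  The words \<open>abc\<close> in which \<open>ab\<close> is a column and \<open>bc\<close>, read backwards, is a row. They make up one of the
  two copies of the crystal of the hook with three boxes in the third tensor power of the letters; the
  Knuth moves identify it with the other copy.
\<close>

definition col_row_words :: "int list set" where
  "col_row_words = {[a, b, c] | a b c. a \<noteq> 0 \<and> b \<noteq> 0 \<and> c \<noteq> 0 \<and> col_rel a b \<and> \<not> col_rel b c}"

lemma col_row_words_iff: "[a, b, c] \<in> col_row_words \<longleftrightarrow> a \<noteq> 0 \<and> b \<noteq> 0 \<and> c \<noteq> 0 \<and> col_rel a b \<and> \<not> col_rel b c"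
  by (simp add: col_row_words_def)

lemma arrow_neq_0 [simp]: "arrow_src i \<noteq> 0" "arrow_tgt i \<noteq> 0"
  by (auto simp: arrow_src_def arrow_tgt_def)

text \<open>
  For a given arrow \<open>i\<close> a letter is its source, its target or neutral, and by the lemma on neutral
  letters the kinds of the three letters, together with comparisons of a neutral letter with the
  target of the arrow, decide everything. The following three proofs run through these cases. The
  bound on the splitting of disequations matters because every neutral letter brings some of them.
\<close>

lemma knuth_move_eps_phi:
  assumes "[a, b, c] \<in> col_row_words"
  shows "eps_w i (knuth_move [a, b, c]) = eps_w i [a, b, c] \<and> phi_w i (knuth_move [a, b, c]) = phi_w i [a, b, c]"
  supply [[linarith_neq_limit = 0]]
  by (cases i "0::int" rule: linorder_cases; cases a i rule: letter_cases; cases b i rule: letter_cases;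
      cases c i rule: letter_cases; use assms in \<open>auto simp add: knuth_move_3 col_row_words_iff col_rel_neutral\<close>)

lemma knuth_move_step:
  assumes "[a, b, c] \<in> col_row_words" "word_step i [a, b, c] z"
  shows "z \<in> col_row_words \<and> word_step i (knuth_move [a, b, c]) (knuth_move z)"
  supply [[linarith_neq_limit = 0]]
proof -
  have u: "a \<noteq> 0" "b \<noteq> 0" "c \<noteq> 0" "col_rel a b" "\<not> col_rel b c"
    using assms(1) unfolding col_row_words_iff by blast+
  show ?thesis using assms(2) unfolding word_step_3
  proof (elim disjE conjE)
  assume "a = arrow_src i" "z = [arrow_tgt i, b, c]" "okR i [b, c]"
  with u show ?thesis
    by (cases i "0::int" rule: linorder_cases; cases b i rule: letter_cases; cases c i rule: letter_cases;
      hypsubst; simp add: knuth_move_3 col_row_words_iff col_rel_neutral word_step_3 okR_def okL_def)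
next
  assume "b = arrow_src i" "z = [a, arrow_tgt i, c]" "okL i [a]" "okR i [c]"
  with u show ?thesis
    by (cases i "0::int" rule: linorder_cases; cases a i rule: letter_cases; cases c i rule: letter_cases;
      hypsubst; simp add: knuth_move_3 col_row_words_iff col_rel_neutral word_step_3 okR_def okL_def)
next
  assume "c = arrow_src i" "z = [a, b, arrow_tgt i]" "okL i [a, b]"
  with u show ?thesis
    by (cases i "0::int" rule: linorder_cases; cases a i rule: letter_cases; cases b i rule: letter_cases;
      hypsubst; simp add: knuth_move_3 col_row_words_iff col_rel_neutral word_step_3 okR_def okL_def)
  qed
qed

lemma knuth_move_step_rev:
  assumes "[a, b, c] \<in> col_row_words" "word_step i z [a, b, c]"
  shows "z \<in> col_row_words \<and> word_step i (knuth_move z) (knuth_move [a, b, c])"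
  supply [[linarith_neq_limit = 0]]
proof -
  have u: "a \<noteq> 0" "b \<noteq> 0" "c \<noteq> 0" "col_rel a b" "\<not> col_rel b c"
    using assms(1) unfolding col_row_words_iff by blast+
  show ?thesis using assms(2) unfolding word_step_3_rev
  proof (elim disjE conjE)
  assume "a = arrow_tgt i" "z = [arrow_src i, b, c]" "okR i [b, c]"
  with u show ?thesis
    by (cases i "0::int" rule: linorder_cases; cases b i rule: letter_cases; cases c i rule: letter_cases;
      hypsubst; simp add: knuth_move_3 col_row_words_iff col_rel_neutral word_step_3 okR_def okL_def)
next
  assume "b = arrow_tgt i" "z = [a, arrow_src i, c]" "okL i [a]" "okR i [c]"
  with u show ?thesis
    by (cases i "0::int" rule: linorder_cases; cases a i rule: letter_cases; cases c i rule: letter_cases;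
      hypsubst; simp add: knuth_move_3 col_row_words_iff col_rel_neutral word_step_3 okR_def okL_def)
next
  assume "c = arrow_tgt i" "z = [a, b, arrow_src i]" "okL i [a, b]"
  with u show ?thesis
    by (cases i "0::int" rule: linorder_cases; cases a i rule: letter_cases; cases b i rule: letter_cases;
      hypsubst; simp add: knuth_move_3 col_row_words_iff col_rel_neutral word_step_3 okR_def okL_def)
  qed
qed

section \<open>Column insertion\<close>

lemma transport_knuth_move: "transport col_row_words knuth_move"
proof -
  have "inj_on knuth_move col_row_words"
    by (rule inj_onI) (auto simp: col_row_words_def knuth_move_3 split: if_splits)
  moreover have "transports_at col_row_words knuth_move u" if uC: "u \<in> col_row_words" for u
  proof -
    obtain a b c where u: "u = [a, b, c]" "a \<noteq> 0" "b \<noteq> 0" "c \<noteq> 0"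
      using uC unfolding col_row_words_def by blast
    note m = uC[unfolded u(1)]
    have "0 \<notin> set u" "mset (knuth_move u) = mset u" using u by (simp_all add: knuth_move_3)
    moreover have "\<forall>i. eps_w i (knuth_move u) = eps_w i u \<and> phi_w i (knuth_move u) = phi_w i u"
      unfolding u(1) using knuth_move_eps_phi[OF m] by blast
    moreover have "\<forall>i u'. word_step i u u' \<longrightarrow> u' \<in> col_row_words \<and> word_step i (knuth_move u) (knuth_move u')"
      unfolding u(1) using knuth_move_step[OF m] by blast
    moreover have "\<forall>i u'. word_step i u' u \<longrightarrow> u' \<in> col_row_words \<and> word_step i (knuth_move u') (knuth_move u)"
      unfolding u(1) using knuth_move_step_rev[OF m] by blast
    ultimately show ?thesis unfolding transports_at_def by blast
  qed
  ultimately show ?thesis unfolding transport_def by blast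
qed

lemma word_equiv_knuth:
  assumes "[a, b, c] \<in> col_row_words"
  shows "word_equiv [a, b, c] (knuth_move [a, b, c])"
proof -
  have "\<forall>u\<in>col_row_words. length u = length [a, b, c]" by (auto simp: col_row_words_def)
  then show ?thesis using transport_knuth_move assms unfolding word_equiv_def by blast
qed

lemma row_col_less: "row_rel x y \<Longrightarrow> col_rel y z \<Longrightarrow> x < z" "col_rel x y \<Longrightarrow> row_rel y z \<Longrightarrow> x < z"
  unfolding col_rel_def by presburger+

lemma less_col_row: "x < y \<Longrightarrow> col_rel x y" "x < y \<Longrightarrow> row_rel x y"
  by (simp_all add: col_rel_def)

lemma word_equiv_knuth1:
  assumes "row_rel x y" "col_rel y z" "x \<noteq> 0" "y \<noteq> 0" "z \<noteq> 0"
  shows "word_equiv [y, z, x] [y, x, z]"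
proof -
  have "[y, z, x] \<in> col_row_words" unfolding col_row_words_iff using assms row_col_trans(2) by blast
  from word_equiv_knuth[OF this] show ?thesis using assms by (simp add: knuth_move_3)
qed

lemma word_equiv_knuth2:
  assumes "col_rel a x" "row_rel x y" "a \<noteq> 0" "x \<noteq> 0" "y \<noteq> 0"
  shows "word_equiv [a, y, x] [y, a, x]"
proof -
  have "[a, y, x] \<in> col_row_words"
    unfolding col_row_words_iff using assms row_col_less(2) less_col_row(1) by blast
  from word_equiv_knuth[OF this] show ?thesis using assms by (simp add: knuth_move_3)
qed

lemma word_equiv_append_left: "word_equiv w w' \<Longrightarrow> 0 \<notin> set u \<Longrightarrow> word_equiv (u @ w) (u @ w')"
  and word_equiv_append_right: "word_equiv w w' \<Longrightarrow> 0 \<notin> set u \<Longrightarrow> word_equiv (w @ u) (w' @ u)"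
  by (simp_all add: word_equiv_append word_equiv_refl)

text \<open>
  A letter \<open>x\<close> at the end of a column with head \<open>y\<close> that it is to bump moves to the left by moves of
  the first kind until it stands right behind \<open>y\<close>.
\<close>

lemma word_equiv_slide_left:
  assumes "row_rel x y" "sorted_wrt col_rel (y # b)" "0 \<notin> set (x # y # b)"
  shows "word_equiv (y # b @ [x]) (y # x # b)"
  using assms(2,3)
proof (induction b rule: rev_induct)
  case Nil
  then show ?case by (simp add: word_equiv_refl)
next
  case (snoc z b)
  obtain q p where qp: "y # b = q @ [p]" by (metis append_butlast_last_id list.distinct(1))
  have srt: "sorted_wrt col_rel ((y # b) @ [z])" using snoc.prems(1) by simp
  have pz: "col_rel p z" and srt': "sorted_wrt col_rel (q @ [p])"
    using srt unfolding qp by (simp_all add: sorted_wrt_append)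
  have "row_rel x p"
  proof (cases "q = []")
    case True
    with qp assms(1) show ?thesis by simp
  next
    case False
    then have "y \<in> set q" using qp by (metis hd_append2 list.sel(1) list.set_sel(1))
    then have "col_rel y p" using srt' by (simp add: sorted_wrt_append)
    then show ?thesis using row_col_trans(2) assms(1) by blast
  qed
  moreover have nz: "z \<noteq> 0" "x \<noteq> 0" "0 \<notin> set (y # b)" using snoc.prems(2) by auto
  moreover have "0 \<notin> set q" "p \<noteq> 0" using nz(3) unfolding qp by auto
  ultimately have "word_equiv (q @ [p, z, x]) (q @ [p, x, z])"
    using pz by (intro word_equiv_append_left word_equiv_knuth1)
  moreover have "word_equiv ((y # b @ [x]) @ [z]) ((y # x # b) @ [z])"
    using snoc.IH nz srt by (intro word_equiv_append_right) (simp_all add: sorted_wrt_append)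
  moreover have "q @ [p, z, x] = y # (b @ [z]) @ [x]" "q @ [p, x, z] = (y # b @ [x]) @ [z]"
    using qp by (metis append_Cons append_Nil append_assoc)+
  ultimately show ?case using word_equiv_trans by simp
qed

text \<open>
  Then the bumped letter \<open>y\<close> moves to the left past the entries above it, by moves of the second kind.
  After the first of them the letter behind \<open>y\<close> is not \<open>x\<close> but the entry just passed, which is why \<open>x\<close>
  is generalized.
\<close>

lemma word_equiv_slide_up:
  assumes "\<forall>p\<in>set a. col_rel p x" "row_rel x y" "sorted_wrt col_rel a" "0 \<notin> set (x # y # a)"
  shows "word_equiv (a @ [y, x]) (y # a @ [x])"
  using assms
proof (induction a arbitrary: x rule: rev_induct)
  case Nil
  then show ?case by (simp add: word_equiv_refl)
next
  case (snoc p a)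
  have px: "col_rel p x" and nz: "0 \<notin> set a" "p \<noteq> 0" "x \<noteq> 0" "y \<noteq> 0"
    using snoc.prems by auto
  have "word_equiv (a @ [p, y, x]) (a @ [y, p, x])"
    using px snoc.prems(2) nz by (intro word_equiv_append_left word_equiv_knuth2)
  moreover have "row_rel p y" using row_col_trans(3) px snoc.prems(2) by blast
  then have "word_equiv (a @ [y, p]) (y # a @ [p])"
    using snoc.prems nz by (intro snoc.IH) (auto simp: sorted_wrt_append)
  then have "word_equiv ((a @ [y, p]) @ [x]) ((y # a @ [p]) @ [x])"
    using nz by (intro word_equiv_append_right) auto
  ultimately show ?case using word_equiv_trans by simp
qed

lemma word_equiv_bump:
  assumes "sorted_wrt col_rel (a @ y # b)" "\<forall>p\<in>set a. col_rel p x" "row_rel x y"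
    "0 \<notin> set (a @ y # b)" "x \<noteq> 0"
  shows "word_equiv (a @ y # b @ [x]) (y # a @ x # b)"
proof -
  have "word_equiv (a @ y # b @ [x]) (a @ y # x # b)"
    using assms by (intro word_equiv_append_left word_equiv_slide_left) (auto simp: sorted_wrt_append)
  moreover have "word_equiv ((a @ [y, x]) @ b) ((y # a @ [x]) @ b)"
    using assms by (intro word_equiv_append_right word_equiv_slide_up) (auto simp: sorted_wrt_append)
  ultimately show ?thesis using word_equiv_trans by simp
qed

text \<open>
  \<open>x\<close> replaces the first entry that may not stand above it, or is put below the column if there is
  none. The entry that is replaced goes on to the next column.
\<close>

definition col_insert :: "int \<Rightarrow> int list \<Rightarrow> int list" where
  "col_insert x c = takeWhile (\<lambda>z. col_rel z x) c @ x # tl (dropWhile (\<lambda>z. col_rel z x) c)"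

fun insert_cols :: "int \<Rightarrow> int list list \<Rightarrow> int list list" where
  "insert_cols x [] = [[x]]"
| "insert_cols x (c # cs) = col_insert x c #
     (case dropWhile (\<lambda>z. col_rel z x) c of [] \<Rightarrow> cs | y # b \<Rightarrow> insert_cols y cs)"

text \<open>
  The column \<open>d\<close> may stand immediately to the right of \<open>c\<close> in a tableau of straight shape.
\<close>

definition row_adjacent :: "int list \<Rightarrow> int list \<Rightarrow> bool" where
  "row_adjacent c d \<longleftrightarrow> length d \<le> length c \<and> (\<forall>j<length d. row_rel (c ! j) (d ! j))"

fun tableau_cols :: "int list list \<Rightarrow> bool" where
  "tableau_cols [] \<longleftrightarrow> True"
| "tableau_cols (c # cs) \<longleftrightarrow> c \<noteq> [] \<and> sorted_wrt col_rel c \<and>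
     (cs \<noteq> [] \<longrightarrow> row_adjacent c (hd cs)) \<and> tableau_cols cs"

lemma col_insert_cases:
  obtains (append) "\<forall>p\<in>set c. col_rel p x" "dropWhile (\<lambda>z. col_rel z x) c = []" "col_insert x c = c @ [x]"
  | (bump) a y b where "c = a @ y # b" "\<forall>p\<in>set a. col_rel p x" "row_rel x y"
      "dropWhile (\<lambda>z. col_rel z x) c = y # b" "col_insert x c = a @ x # b"
proof (cases "dropWhile (\<lambda>z. col_rel z x) c")
  case Nil
  then have all: "\<forall>p\<in>set c. col_rel p x" by (simp add: dropWhile_eq_Nil_conv)
  then have "takeWhile (\<lambda>z. col_rel z x) c = c" by (simp add: takeWhile_eq_all_conv)
  then show ?thesis using append[OF all Nil] Nil by (simp add: col_insert_def)
next
  case (Cons y b)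
  have "c = takeWhile (\<lambda>z. col_rel z x) c @ y # b"
    using takeWhile_dropWhile_id[of "\<lambda>z. col_rel z x" c] Cons by simp
  moreover have "row_rel x y" using Cons hd_dropWhile[of "\<lambda>z. col_rel z x" c] by simp
  moreover have "\<forall>p\<in>set (takeWhile (\<lambda>z. col_rel z x) c). col_rel p x"
    by (blast dest: set_takeWhileD)
  ultimately show ?thesis using Cons by (intro bump) (auto simp: col_insert_def)
qed

lemma sorted_col_insert:
  assumes "sorted_wrt col_rel c"
  shows "sorted_wrt col_rel (col_insert x c)"
proof (cases rule: col_insert_cases[of c x])
  case append
  then show ?thesis using assms by (simp add: sorted_wrt_append)
next
  case (bump a y b)
  have "col_rel x z" if "z \<in> set b" for z
  proof -
    have "col_rel y z" using that assms bump(1) by (simp add: sorted_wrt_append)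
    then show ?thesis using row_col_less(1)[OF bump(3)] less_col_row(1) by blast
  qed
  then show ?thesis using assms bump by (auto simp: sorted_wrt_append)
qed

text \<open>
  The bumped entry \<open>y\<close> enters the next column in row \<open>l\<close>, not below the row \<open>length a\<close> that it
  leaves, because the entry to the right of its old place may not stand above it. So its new left
  neighbour is \<open>x\<close> itself or an entry above \<open>x\<close>.
\<close>

lemma row_adjacent_col_insert:
  assumes adj: "row_adjacent c d" and c: "c = a @ y # b"
    and a: "\<forall>p\<in>set a. col_rel p x" and xy: "row_rel x y"
  shows "row_adjacent (a @ x # b) (col_insert y d)"
proof -
  let ?k = "length a"
  define l where "l = length (takeWhile (\<lambda>z. col_rel z y) d)"
  have len: "length d \<le> length c" and row: "\<And>j. j < length d \<Longrightarrow> row_rel (c ! j) (d ! j)"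
    using adj by (auto simp: row_adjacent_def)
  have l_le: "l \<le> length d" by (simp add: l_def length_takeWhile_le)
  \<comment> \<open>the entry in row \<open>length a\<close> of \<open>d\<close>, if any, stops the search for the place of \<open>y\<close>\<close>
  have lk: "l \<le> ?k"
  proof (rule ccontr)
    assume "\<not> l \<le> ?k"
    then have "col_rel (d ! ?k) y" "?k < length d"
      using l_le nth_length_takeWhile takeWhile_nth[of ?k "\<lambda>z. col_rel z y" d]
        set_takeWhileD[of "d ! ?k" "\<lambda>z. col_rel z y" d] nth_mem[of ?k "takeWhile (\<lambda>z. col_rel z y) d"]
      unfolding l_def by auto
    moreover have "row_rel y (d ! ?k)" using row[of ?k] \<open>?k < length d\<close> c by simp
    ultimately show False by blast
  qed
  have ins: "col_insert y d = take l d @ y # drop (Suc l) d"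
    unfolding col_insert_def l_def by (metis drop_Suc dropWhile_eq_drop takeWhile_eq_take tl_drop)
  have "row_rel ((a @ x # b) ! j) (col_insert y d ! j)" if j: "j < length (col_insert y d)" for j
  proof (cases "j = l")
    case True
    then have d: "col_insert y d ! j = y" using l_le by (simp add: ins nth_append)
    show ?thesis
    proof (cases "l = ?k")
      case True
      then show ?thesis using d \<open>j = l\<close> xy by simp
    next
      case False
      then have "col_rel (a ! l) x" using lk a by simp
      then have "row_rel (a ! l) y" using row_col_trans(3) xy by blast
      then show ?thesis using d \<open>j = l\<close> False lk by (simp add: nth_append)
    qed
  next
    case False
    then have jd: "j < length d" and d: "col_insert y d ! j = d ! j"
      using j l_le by (auto simp: ins nth_append nth_Cons' min_def split: if_splits)
    show ?thesis
    proof (cases "j = ?k")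
      case True
      then have "row_rel y (d ! j)" using row[OF jd] c by simp
      with xy have "row_rel x (d ! j)" by (rule row_col_trans(1))
      then show ?thesis using True d by simp
    next
      case False
      then have "(a @ x # b) ! j = c ! j" by (auto simp: c nth_append nth_Cons')
      then show ?thesis using row[OF jd] d by simp
    qed
  qed
  moreover have "length (col_insert y d) \<le> length (a @ x # b)"
    using len lk l_le c by (simp add: ins)
  ultimately show ?thesis by (simp add: row_adjacent_def)
qed

text \<open>
  The reading word lists the columns from right to left, so appending \<open>x\<close> to the word means to insert
  it into the first column. The clause on the first column of the result provides the adjacency of the
  new first column in the induction.
\<close>

lemma insert_cols:
  assumes "tableau_cols cs" "0 \<notin> set (concat cs)" "x \<noteq> 0"
  shows "insert_cols x cs \<noteq> [] \<and> tableau_cols (insert_cols x cs) \<and>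
    hd (insert_cols x cs) = col_insert x (if cs = [] then [] else hd cs) \<and>
    word_equiv (concat (rev cs) @ [x]) (concat (rev (insert_cols x cs)))"
  using assms
proof (induction cs arbitrary: x)
  case Nil
  then show ?case by (simp add: col_insert_def word_equiv_refl)
next
  case (Cons c cs)
  have c: "c \<noteq> []" "sorted_wrt col_rel c" "cs \<noteq> [] \<Longrightarrow> row_adjacent c (hd cs)" "tableau_cols cs"
    and nz: "0 \<notin> set c" "0 \<notin> set (concat cs)" "x \<noteq> 0"
    using Cons.prems by auto
  show ?case
  proof (cases rule: col_insert_cases[of c x])
    case append
    have "row_adjacent (c @ [x]) (hd cs)" if "cs \<noteq> []"
      using c(3)[OF that] by (auto simp: row_adjacent_def nth_append)
    moreover have "insert_cols x (c # cs) = (c @ [x]) # cs"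
      by (simp only: insert_cols.simps append(2,3) list.case)
    moreover have "word_equiv (concat (rev (c # cs)) @ [x]) (concat (rev ((c @ [x]) # cs)))"
      using nz by (auto intro!: word_equiv_refl)
    ultimately show ?thesis
      using append(3) c(4) sorted_col_insert[OF c(2), of x] by simp
  next
    case (bump a y b)
    have y: "y \<noteq> 0" using nz bump by auto
    note IH = Cons.IH[OF c(4) nz(2) y]
    have "row_adjacent c (if cs = [] then [] else hd cs)"
      using c(3) by (simp add: row_adjacent_def)
    from row_adjacent_col_insert[OF this bump(1-3)]
    have "row_adjacent (col_insert x c) (hd (insert_cols y cs))"
      using IH bump(5) by simp
    then have tab: "tableau_cols (insert_cols x (c # cs))"
      using IH bump(4,5) sorted_col_insert[OF c(2), of x] by simp
    have "word_equiv (concat (rev cs) @ (a @ y # b @ [x])) (concat (rev cs) @ (y # a @ x # b))"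
      using bump c nz by (intro word_equiv_append_left word_equiv_bump) auto
    moreover have "word_equiv ((concat (rev cs) @ [y]) @ (a @ x # b))
        (concat (rev (insert_cols y cs)) @ (a @ x # b))"
      using IH nz bump by (intro word_equiv_append_right) auto
    ultimately have "word_equiv (concat (rev (c # cs)) @ [x]) (concat (rev (insert_cols x (c # cs))))"
      using bump word_equiv_trans by simp
    then show ?thesis using tab by simp
  qed
qed

lemma word_equiv_tableau_cols:
  "0 \<notin> set w \<Longrightarrow> \<exists>cs. tableau_cols cs \<and> word_equiv w (concat (rev cs))"
proof (induction w rule: rev_induct)
  case Nil
  then show ?case by (intro exI[of _ "[]"]) (simp add: word_equiv_refl)
next
  case (snoc x w)
  then obtain cs where cs: "tableau_cols cs" "word_equiv w (concat (rev cs))" by auto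
  have "0 \<notin> set (concat (rev cs))"
  proof -
    have "mset (concat (rev cs)) = mset w"
      using cs(2) transportD(2) unfolding word_equiv_def by metis
    then show ?thesis using snoc.prems by (metis Un_iff set_append set_mset_mset)
  qed
  then have "word_equiv (concat (rev cs) @ [x]) (concat (rev (insert_cols x cs))) \<and>
      tableau_cols (insert_cols x cs)"
    using insert_cols[OF cs(1), of x] snoc.prems by auto
  moreover have "word_equiv (w @ [x]) (concat (rev cs) @ [x])"
    using cs(2) snoc.prems by (intro word_equiv_append_right) auto
  ultimately show ?case using word_equiv_trans by blast
qed

section \<open>The reading word of a filling\<close>

text \<open>
  The order in which the boxes of a diagram are read.
\<close>

definition before :: "nat \<times> nat \<Rightarrow> nat \<times> nat \<Rightarrow> bool" where
  "before p q \<longleftrightarrow> snd q < snd p \<or> (snd p = snd q \<and> fst p < fst q)"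

lemma before_irrefl [simp]: "\<not> before p p"
  and before_asym: "before p q \<Longrightarrow> \<not> before q p"
  by (auto simp: before_def)

lemma sorted_wrt_before_concat:
  assumes "sorted_wrt (>) cs" "\<And>c. c \<in> set cs \<Longrightarrow> sorted_wrt (<) (f c)"
  shows "sorted_wrt before (concat (map (\<lambda>c. map (\<lambda>r. (r, c)) (f c)) cs))"
  using assms
proof (induction cs)
  case (Cons c cs)
  then have "sorted_wrt before (map (\<lambda>r. (r, c)) (f c))"
    by (simp add: sorted_wrt_map before_def)
  moreover have "\<forall>a\<in>set (map (\<lambda>r. (r, c)) (f c)).
      \<forall>b\<in>set (concat (map (\<lambda>c. map (\<lambda>r. (r, c)) (f c)) cs)). before a b"
    using Cons.prems(1) by (auto simp: before_def)
  ultimately show ?case using Cons by (simp add: sorted_wrt_append)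
qed simp

lemma finite_column: "finite Y \<Longrightarrow> finite {r. (r, c) \<in> Y}"
  by (rule finite_subset[of _ "fst ` Y"]) force+

lemma reading_boxes_sorted: "sorted_wrt before (reading_boxes Y)"
  unfolding reading_boxes_def
  by (rule sorted_wrt_before_concat) (simp_all add: sorted_wrt_rev)

lemma set_reading_boxes: "finite Y \<Longrightarrow> set (reading_boxes Y) = Y"
  unfolding reading_boxes_def by (force simp: finite_column)

text \<open>
  The list of boxes of a diagram is determined by its set, which allows the boxes of a subdiagram to be
  read by filtering.
\<close>

lemma sorted_wrt_before_unique:
  assumes "sorted_wrt before xs" "sorted_wrt before ys" "set xs = set ys"
  shows "xs = ys"
  using assms
proof (induction xs arbitrary: ys)
  case (Cons x xs)
  then obtain y ys' where ys: "ys = y # ys'" by (cases ys) auto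
  have "x = y"
  proof (rule ccontr)
    assume "x \<noteq> y"
    then have "x \<in> set ys'" "y \<in> set xs" using Cons.prems(3) ys by auto
    then have "before y x" "before x y" using Cons.prems ys by auto
    then show False using before_asym by blast
  qed
  have "x \<notin> set xs" "y \<notin> set ys'" using Cons.prems ys by auto
  then have "set xs = set ys'" using Cons.prems(3) ys \<open>x = y\<close> by auto
  then show ?case using Cons \<open>x = y\<close> ys by simp
qed simp

lemma sorted_wrt_before_distinct: "sorted_wrt before xs \<Longrightarrow> distinct xs"
  by (induction xs) auto

lemma length_reading: "finite Y \<Longrightarrow> length (reading Y T) = card Y"
  unfolding reading_def
  using distinct_card[OF sorted_wrt_before_distinct[OF reading_boxes_sorted[of Y]]]
  by (simp add: set_reading_boxes)

lemma set_reading: "finite Y \<Longrightarrow> set (reading Y T) = T ` Y"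
  by (simp add: reading_def set_reading_boxes)

lemma reading_cong: "finite Y \<Longrightarrow> (\<And>p. p \<in> Y \<Longrightarrow> T p = S p) \<Longrightarrow> reading Y T = reading Y S"
  by (simp add: reading_def set_reading_boxes)

lemma reading_boxes_split:
  assumes "finite Y" "reading_boxes Y = A @ p # B"
  shows "p \<in> Y" "set A = {q \<in> Y. before q p}" "set B = {q \<in> Y. before p q}"
    "reading Y (T(p := x)) = map T A @ x # map T B"
proof -
  have s: "sorted_wrt before (A @ p # B)" using reading_boxes_sorted[of Y] assms(2) by simp
  have Y: "Y = set A \<union> {p} \<union> set B" using set_reading_boxes[OF assms(1)] assms(2) by auto
  then show "p \<in> Y" by simp
  have A: "before q p" if "q \<in> set A" for q using s that by (simp add: sorted_wrt_append)
  have B: "before p q" if "q \<in> set B" for q using s that by (simp add: sorted_wrt_append)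
  show "set A = {q \<in> Y. before q p}" using A B Y before_asym before_irrefl by blast
  show "set B = {q \<in> Y. before p q}" using A B Y before_asym before_irrefl by blast
  have "p \<notin> set A" "p \<notin> set B" using A B by (meson before_irrefl)+
  then show "reading Y (T(p := x)) = map T A @ x # map T B"
    by (simp add: reading_def assms(2))
qed

lemma eps_phi_count:
  assumes "i \<noteq> 0"
  shows "phi_w i w + count_list w (arrow_tgt i) = eps_w i w + count_list w (arrow_src i)"
proof (induction w)
  case (Cons b w)
  consider "i < 0" | "i > 0" using assms by linarith
  then show ?case
    using Cons.IH
    by cases (cases "b = arrow_tgt i"; cases "b = arrow_src i"; simp)+
qed simp

text \<open>
  In the bracketing of a word, an opener is cancelled by a later closer.
\<close>

definition opener :: "int \<Rightarrow> int" where
  "opener i = (if i < 0 then arrow_src i else arrow_tgt i)"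

definition closer :: "int \<Rightarrow> int" where
  "closer i = (if i < 0 then arrow_tgt i else arrow_src i)"

lemma okL_count: "okL i (u @ v) \<Longrightarrow> i \<noteq> 0 \<Longrightarrow> count_list v (opener i) \<le> count_list v (closer i)"
  using eps_phi_count[of i v]
  by (auto simp: okL_def opener_def closer_def eps_w_append phi_w_append split: if_splits)

lemma okR_count: "okR i (u @ v) \<Longrightarrow> i \<noteq> 0 \<Longrightarrow> count_list u (closer i) \<le> count_list u (opener i)"
  using eps_phi_count[of i u]
  by (auto simp: okR_def opener_def closer_def eps_w_append phi_w_append split: if_splits)

lemma okL_0: "okL 0 u \<longleftrightarrow> -1 \<notin> set u \<and> 1 \<notin> set u"
  using eps_phi_0_pos[of u] by (auto simp: okL_def)

lemma count_list_map: "distinct B \<Longrightarrow> count_list (map T B) x = card {b \<in> set B. T b = x}"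
proof (induction B)
  case (Cons b B)
  have "{a \<in> set (b # B). T a = x} = (if T b = x then insert b {a \<in> set B. T a = x} else {a \<in> set B. T a = x})"
    by auto
  with Cons show ?case by simp
qed simp

text \<open>
  The boxes read from \<open>p\<close> to \<open>q\<close>, both included.
\<close>

definition span :: "(nat \<times> nat) set \<Rightarrow> nat \<times> nat \<Rightarrow> nat \<times> nat \<Rightarrow> (nat \<times> nat) set" where
  "span Y p q = {b \<in> Y. (b = p \<or> before p b) \<and> (b = q \<or> before b q)}"

text \<open>
  The conditions \<open>okL\<close> and \<open>okR\<close> for the letter in the box \<open>p\<close>, in terms of boxes: for \<open>i \<noteq> 0\<close>, every
  stretch that ends just before \<open>p\<close> has enough closers, and every stretch that starts just after \<open>p\<close>
  has enough openers.
\<close>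

definition balanced :: "int \<Rightarrow> (nat \<times> nat) set \<Rightarrow> (nat \<times> nat \<Rightarrow> int) \<Rightarrow> nat \<times> nat \<Rightarrow> bool" where
  "balanced i Y T p \<longleftrightarrow>
     (i \<noteq> 0 \<longrightarrow> (\<forall>q\<in>Y. before q p \<longrightarrow>
        card {b \<in> span Y q p - {p}. T b = opener i} \<le> card {b \<in> span Y q p - {p}. T b = closer i})) \<and>
     (i \<noteq> 0 \<longrightarrow> (\<forall>q\<in>Y. before p q \<longrightarrow>
        card {b \<in> span Y p q - {p}. T b = closer i} \<le> card {b \<in> span Y p q - {p}. T b = opener i})) \<and>
     (i = 0 \<longrightarrow> (\<forall>q\<in>Y. before q p \<longrightarrow> T q \<noteq> -1 \<and> T q \<noteq> 1))"

lemma balancedI: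
  assumes fin: "finite Y" and Y: "reading_boxes Y = A @ p # B"
    and ok: "okL i (map T A)" "okR i (map T B)"
  shows "balanced i Y T p"
proof -
  note split = reading_boxes_split(1-3)[OF fin Y]
  have s: "sorted_wrt before (A @ p # B)" using reading_boxes_sorted[of Y] Y by simp
  then have dist: "distinct A" "distinct B"
    using sorted_wrt_before_distinct by (auto simp: sorted_wrt_append)
  have "card {b \<in> span Y q p - {p}. T b = opener i} \<le> card {b \<in> span Y q p - {p}. T b = closer i}"
    if q: "q \<in> Y" "before q p" and i: "i \<noteq> 0" for q
  proof -
    obtain A1 A2 where A: "A = A1 @ q # A2" using q split(2) by (metis (mono_tags, lifting) mem_Collect_eq split_list)
    have "span Y q p - {p} = set (q # A2)"
    proof -
      have "before q b" if "b \<in> set A2" for b using s that by (simp add: A sorted_wrt_append)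
      moreover have "before b q" if "b \<in> set A1" for b using s that by (simp add: A sorted_wrt_append)
      ultimately show ?thesis
        using split(2) q before_asym before_irrefl
        unfolding span_def A set_append list.set by blast
    qed
    moreover have "count_list (map T (q # A2)) (opener i) \<le> count_list (map T (q # A2)) (closer i)"
      using okL_count[of i "map T A1" "map T (q # A2)"] ok(1) i by (simp add: A)
    ultimately show ?thesis
      using dist(1) count_list_map[of "q # A2" T] by (simp add: A del: list.map list.set)
  qed
  moreover have "card {b \<in> span Y p q - {p}. T b = closer i} \<le> card {b \<in> span Y p q - {p}. T b = opener i}"
    if q: "q \<in> Y" "before p q" and i: "i \<noteq> 0" for q
  proof -
    obtain B1 B2 where B: "B = (B1 @ [q]) @ B2"
      using q split(3) by (metis (mono_tags, lifting) append.assoc append_Cons append_Nil mem_Collect_eq split_list)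
    have "span Y p q - {p} = set (B1 @ [q])"
    proof -
      have "before q b" if "b \<in> set B2" for b using s that by (simp add: B sorted_wrt_append)
      moreover have "before b q" if "b \<in> set B1" for b using s that by (simp add: B sorted_wrt_append)
      ultimately show ?thesis
        using split(3) q before_asym before_irrefl
        unfolding span_def B set_append list.set by blast
    qed
    moreover have "count_list (map T (B1 @ [q])) (closer i) \<le> count_list (map T (B1 @ [q])) (opener i)"
      using okR_count[of i "map T (B1 @ [q])" "map T B2"] ok(2) i by (simp add: B)
    ultimately show ?thesis
      using dist(2) count_list_map[of "B1 @ [q]" T] by (simp add: B del: map_append set_append)
  qed
  moreover have "T q \<noteq> -1 \<and> T q \<noteq> 1" if "q \<in> Y" "before q p" "i = 0" for q
  proof -
    have "T q \<in> set (map T A)" using that split(2) by simp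
    then show ?thesis using ok(1) okL_0[of "map T A"] that(3) by metis
  qed
  ultimately show ?thesis unfolding balanced_def by blast
qed

lemma word_step_reading:
  assumes "finite Y" "word_step i (reading Y T) z"
  obtains p where "p \<in> Y" "T p = arrow_src i" "z = reading Y (T(p := arrow_tgt i))" "balanced i Y T p"
proof -
  obtain u v where w: "map T (reading_boxes Y) = u @ arrow_src i # v" "z = u @ arrow_tgt i # v"
    "okL i u" "okR i v"
    using assms(2) unfolding word_step_def reading_def by blast
  then obtain A p B where *: "reading_boxes Y = A @ p # B" "map T A = u" "T p = arrow_src i" "map T B = v"
    by (auto simp: map_eq_append_conv map_eq_Cons_conv)
  show ?thesis
    using that[of p] reading_boxes_split[OF assms(1) *(1)] balancedI[OF assms(1) *(1), of i T] * w
    by simp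
qed

lemma word_step_reading_rev:
  assumes "finite Y" "word_step i z (reading Y T)"
  obtains p where "p \<in> Y" "T p = arrow_tgt i" "z = reading Y (T(p := arrow_src i))" "balanced i Y T p"
proof -
  obtain u v where w: "map T (reading_boxes Y) = u @ arrow_tgt i # v" "z = u @ arrow_src i # v"
    "okL i u" "okR i v"
    using assms(2) unfolding word_step_def reading_def by blast
  then obtain A p B where *: "reading_boxes Y = A @ p # B" "map T A = u" "T p = arrow_tgt i" "map T B = v"
    by (auto simp: map_eq_append_conv map_eq_Cons_conv)
  show ?thesis
    using that[of p] reading_boxes_split[OF assms(1) *(1)] balancedI[OF assms(1) *(1), of i T] * w
    by simp
qed

section \<open>Stability of tableaux\<close>

text \<open>
  The property of skew diagrams on which the stability of tableaux rests: it provides the boxes that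
  complete a rectangle.
\<close>

definition convex :: "(nat \<times> nat) set \<Rightarrow> bool" where
  "convex Y \<longleftrightarrow> (\<forall>r c r' c' a b. (r, c) \<in> Y \<longrightarrow> (r', c') \<in> Y \<longrightarrow> r \<le> a \<longrightarrow> a \<le> r' \<longrightarrow>
     c \<le> b \<longrightarrow> b \<le> c' \<longrightarrow> (a, b) \<in> Y)"

lemma convexD: "convex Y \<Longrightarrow> (r, c) \<in> Y \<Longrightarrow> (r', c') \<in> Y \<Longrightarrow> r \<le> a \<Longrightarrow> a \<le> r' \<Longrightarrow>
     c \<le> b \<Longrightarrow> b \<le> c' \<Longrightarrow> (a, b) \<in> Y"
  unfolding convex_def by blast

lemma young_diagram_convex: "young_diagram Y \<Longrightarrow> convex Y"
  unfolding young_diagram_def convex_def by blast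

lemma skew_young_diagram_convex: "skew_young_diagram Y \<Longrightarrow> finite Y \<and> convex Y"
proof -
  assume "skew_young_diagram Y"
  then obtain L M where LM: "young_diagram L" "young_diagram M" "Y = L - M"
    unfolding skew_young_diagram_def by blast
  then show ?thesis
    unfolding young_diagram_def convex_def by (intro conjI) (blast, blast)
qed

text \<open>
  Semistandard with respect to the whole alphabet of nonzero integers. The bounds \<open>m\<close> and \<open>n\<close> are a
  condition on the letters alone and are preserved separately.
\<close>

definition sst :: "(nat \<times> nat) set \<Rightarrow> (nat \<times> nat \<Rightarrow> int) \<Rightarrow> bool" where
  "sst Y T \<longleftrightarrow> (\<forall>p\<in>Y. T p \<noteq> 0) \<and>
     (\<forall>r c c'. (r, c) \<in> Y \<longrightarrow> (r, c') \<in> Y \<longrightarrow> c < c' \<longrightarrow> row_rel (T (r, c)) (T (r, c'))) \<and>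
     (\<forall>r r' c. (r, c) \<in> Y \<longrightarrow> (r', c) \<in> Y \<longrightarrow> r < r' \<longrightarrow> col_rel (T (r, c)) (T (r', c)))"

lemma sst_nonzero: "sst Y T \<Longrightarrow> p \<in> Y \<Longrightarrow> T p \<noteq> 0"
  and sst_row: "sst Y T \<Longrightarrow> (r, c) \<in> Y \<Longrightarrow> (r, c') \<in> Y \<Longrightarrow> c < c' \<Longrightarrow> row_rel (T (r, c)) (T (r, c'))"
  and sst_col: "sst Y T \<Longrightarrow> (r, c) \<in> Y \<Longrightarrow> (r', c) \<in> Y \<Longrightarrow> r < r' \<Longrightarrow> col_rel (T (r, c)) (T (r', c))"
  unfolding sst_def by blast+

lemma semistandard_iff:
  "semistandard m n Y T \<longleftrightarrow> (\<forall>p\<in>Y. T p \<in> letters m n) \<and> sst Y T"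
proof (cases "\<forall>p\<in>Y. T p \<in> letters m n")
  case True
  have row: "(T p \<le> T q \<and> (T p = T q \<longrightarrow> T p \<in> Bplus m)) \<longleftrightarrow> row_rel (T p) (T q)"
    and col: "(T p \<le> T q \<and> (T p = T q \<longrightarrow> T p \<in> Bminus n)) \<longleftrightarrow> col_rel (T p) (T q)"
    and nz: "T p \<noteq> 0" if "p \<in> Y" for p q
    using bspec[OF True that]
    by (auto simp: letters_def Bplus_def Bminus_def col_rel_def)
  show ?thesis
    unfolding semistandard_def sst_def using True row col nz by blast
next
  case False
  then show ?thesis unfolding semistandard_def by blast
qed

lemma sst_update:
  assumes T: "sst Y T" and x: "x \<noteq> 0"
    and right: "\<And>c'. (r, c') \<in> Y \<Longrightarrow> c < c' \<Longrightarrow> row_rel x (T (r, c'))"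
    and left: "\<And>c'. (r, c') \<in> Y \<Longrightarrow> c' < c \<Longrightarrow> row_rel (T (r, c')) x"
    and below: "\<And>r'. (r', c) \<in> Y \<Longrightarrow> r < r' \<Longrightarrow> col_rel x (T (r', c))"
    and above: "\<And>r'. (r', c) \<in> Y \<Longrightarrow> r' < r \<Longrightarrow> col_rel (T (r', c)) x"
  shows "sst Y (T((r, c) := x))"
proof -
  let ?T = "T((r, c) := x)"
  have "row_rel (?T (a, b)) (?T (a, b'))" if "(a, b) \<in> Y" "(a, b') \<in> Y" "b < b'" for a b b'
    using that right[of b'] left[of b] sst_row[OF T that] by (cases "a = r"; cases "b = c"; cases "b' = c") simp_all
  moreover have "col_rel (?T (a, b)) (?T (a', b))" if "(a, b) \<in> Y" "(a', b) \<in> Y" "a < a'" for a a' b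
    using that below[of a'] above[of a] sst_col[OF T that] by (cases "b = c"; cases "a = r"; cases "a' = r") simp_all
  moreover have "?T p \<noteq> 0" if "p \<in> Y" for p using sst_nonzero[OF T that] x by simp
  ultimately show ?thesis unfolding sst_def by blast
qed

lemma rel_le: "row_rel x y \<Longrightarrow> x \<le> y" "col_rel x y \<Longrightarrow> x \<le> y"
  by (auto simp: col_rel_def)

lemma rel_strict:
  "row_rel x y \<Longrightarrow> 0 < x \<Longrightarrow> x < y" "col_rel x y \<Longrightarrow> x < 0 \<Longrightarrow> x < y"
  "row_rel x y \<Longrightarrow> 0 < y \<Longrightarrow> x < y" "col_rel x y \<Longrightarrow> y < 0 \<Longrightarrow> x < y"
  by (auto simp: col_rel_def)

lemma rel_weak:
  "x \<le> y \<Longrightarrow> x < 0 \<Longrightarrow> row_rel x y" "x \<le> y \<Longrightarrow> y < 0 \<Longrightarrow> row_rel x y"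
  "x \<le> y \<Longrightarrow> 0 < x \<Longrightarrow> col_rel x y" "x \<le> y \<Longrightarrow> 0 < y \<Longrightarrow> col_rel x y"
  by (auto simp: col_rel_def)

lemma sst_row_le: "sst Y T \<Longrightarrow> (r, c) \<in> Y \<Longrightarrow> (r, c') \<in> Y \<Longrightarrow> c < c' \<Longrightarrow> T (r, c) \<le> T (r, c')"
  and sst_col_le: "sst Y T \<Longrightarrow> (r, c) \<in> Y \<Longrightarrow> (r', c) \<in> Y \<Longrightarrow> r < r' \<Longrightarrow> T (r, c) \<le> T (r', c)"
  by (rule rel_le(1), rule sst_row; assumption) (rule rel_le(2), rule sst_col; assumption)

lemma sst_row_less:
  assumes "sst Y T" "(r, c) \<in> Y" "(r, c') \<in> Y" "c < c'" "0 < T (r, c) \<or> 0 < T (r, c')"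
  shows "T (r, c) < T (r, c')"
  using assms(5) rel_strict(1,3)[OF sst_row[OF assms(1-4)]] by blast

lemma sst_col_less:
  assumes "sst Y T" "(r, c) \<in> Y" "(r', c) \<in> Y" "r < r'" "T (r, c) < 0 \<or> T (r', c) < 0"
  shows "T (r, c) < T (r', c)"
  using assms(5) rel_strict(2,4)[OF sst_col[OF assms(1-4)]] by blast

lemma balanced_before:
  assumes "balanced i Y T p" "i \<noteq> 0" "q \<in> Y" "before q p"
  shows "card {b \<in> span Y q p - {p}. T b = opener i} \<le> card {b \<in> span Y q p - {p}. T b = closer i}"
  using assms unfolding balanced_def by blast

lemma balanced_after:
  assumes "balanced i Y T p" "i \<noteq> 0" "q \<in> Y" "before p q"
  shows "card {b \<in> span Y p q - {p}. T b = closer i} \<le> card {b \<in> span Y p q - {p}. T b = opener i}"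
  using assms unfolding balanced_def by blast

lemma finite_span: "finite Y \<Longrightarrow> finite {b \<in> span Y p q - {p'}. P b}"
  unfolding span_def by simp

lemma balanced_before_ex:
  assumes "balanced i Y T p" "i \<noteq> 0" "finite Y" and q: "q \<in> Y" "before q p" "T q = opener i"
  shows "\<exists>b \<in> span Y q p - {p}. T b = closer i"
proof (rule ccontr)
  assume "\<not> ?thesis"
  then have "{b \<in> span Y q p - {p}. T b = closer i} = {}" by blast
  with balanced_before[OF assms(1,2) q(1,2)] have "card {b \<in> span Y q p - {p}. T b = opener i} = 0"
    by (simp only: card.empty le_0_eq)
  then have "{b \<in> span Y q p - {p}. T b = opener i} = {}"
    by (simp only: card_0_eq[OF finite_span[OF assms(3)]])
  moreover have "q \<in> span Y q p" "q \<noteq> p" using q(1,2) by (auto simp: span_def)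
  ultimately show False using q(3) by blast
qed

lemma balanced_after_ex:
  assumes "balanced i Y T p" "i \<noteq> 0" "finite Y" and q: "q \<in> Y" "before p q" "T q = closer i"
  shows "\<exists>b \<in> span Y p q - {p}. T b = opener i"
proof (rule ccontr)
  assume "\<not> ?thesis"
  then have "{b \<in> span Y p q - {p}. T b = opener i} = {}" by blast
  with balanced_after[OF assms(1,2) q(1,2)] have "card {b \<in> span Y p q - {p}. T b = closer i} = 0"
    by (simp only: card.empty le_0_eq)
  then have "{b \<in> span Y p q - {p}. T b = closer i} = {}"
    by (simp only: card_0_eq[OF finite_span[OF assms(3)]])
  moreover have "q \<in> span Y p q" "q \<noteq> p" using q(1,2) by (auto simp: span_def)
  ultimately show False using q(3) by blast
qed

text \<open>
  The single box above \<open>p\<close>, and likewise the one below, is a stretch of its own.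
\<close>

lemma balanced_above:
  assumes bal: "balanced i Y T (r, c)" "i \<noteq> 0" "finite Y" and r: "(r', c) \<in> Y" "Suc r' = r"
  shows "T (r', c) \<noteq> opener i"
proof
  assume T: "T (r', c) = opener i"
  have "before (r', c) (r, c)" using r by (simp add: before_def)
  from balanced_before_ex[OF bal r(1) this T]
  obtain b where b: "b \<in> span Y (r', c) (r, c)" "b \<noteq> (r, c)" "T b = closer i" by blast
  then have "b = (r', c)" using r by (cases b) (auto simp: span_def before_def)
  then show False using b T by (simp add: opener_def closer_def split: if_splits)
qed

lemma balanced_below:
  assumes bal: "balanced i Y T (r, c)" "i \<noteq> 0" "finite Y" and r: "(r', c) \<in> Y" "r' = Suc r"
  shows "T (r', c) \<noteq> closer i"
proof
  assume T: "T (r', c) = closer i"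
  have "before (r, c) (r', c)" using r by (simp add: before_def)
  from balanced_after_ex[OF bal r(1) this T]
  obtain b where b: "b \<in> span Y (r, c) (r', c)" "b \<noteq> (r, c)" "T b = opener i" by blast
  then have "b = (r', c)" using r by (cases b) (auto simp: span_def before_def)
  then show False using b T by (simp add: opener_def closer_def split: if_splits)
qed

text \<open>
  Raising \<open>i - 1\<close> to \<open>i\<close> can only conflict with an entry \<open>i\<close> below or an entry \<open>i - 1\<close> to the right. The
  first would cancel the letter that is raised. As for the second, the right neighbour is an opener
  read earlier, hence some closer \<open>i\<close> is read between the two boxes; it must stand in the next column
  below, and the entry to its left is then \<open>i\<close> too and stands below the raised letter.
\<close>

lemma sst_word_step_neg:
  assumes fin: "finite Y" and conv: "convex Y" and T: "sst Y T" and i: "i < 0"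
    and p: "(r, c) \<in> Y" "T (r, c) = i - 1" and bal: "balanced i Y T (r, c)"
  shows "sst Y (T((r, c) := i))"
proof -
  have oc: "opener i = i - 1" "closer i = i"
    using i by (simp_all add: opener_def closer_def arrow_src_def arrow_tgt_def)
  have below: "i < T (r', c)" if r': "(r', c) \<in> Y" "r < r'" for r'
  proof -
    have Y: "(Suc r, c) \<in> Y" using convexD[OF conv p(1) r'(1), of "Suc r" c] r' by simp
    have "i - 1 < T (Suc r, c)" using sst_col_less[OF T p(1) Y] p(2) i by auto
    moreover have "T (Suc r, c) \<noteq> i" using balanced_below[OF bal _ fin Y] i oc by simp
    moreover have "T (Suc r, c) \<le> T (r', c)"
      using sst_col_le[OF T Y r'(1)] r'(2) by (cases "Suc r = r'") auto
    ultimately show ?thesis by linarith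
  qed
  have right: "i \<le> T (r, c')" if c': "(r, c') \<in> Y" "c < c'" for c'
  proof (rule ccontr)
    assume "\<not> i \<le> T (r, c')"
    moreover have Y: "(r, Suc c) \<in> Y" using convexD[OF conv p(1) c'(1), of r "Suc c"] c' by simp
    moreover have "i - 1 \<le> T (r, Suc c)" using sst_row_le[OF T p(1) Y] p(2) by auto
    moreover have "T (r, Suc c) \<le> T (r, c')"
      using sst_row_le[OF T Y c'(1)] c'(2) by (cases "Suc c = c'") auto
    ultimately have Tq: "T (r, Suc c) = i - 1" by linarith
    let ?S = "span Y (r, Suc c) (r, c) - {(r, c)}"
    have bq: "before (r, Suc c) (r, c)" by (simp add: before_def)
    obtain b where b0: "b \<in> ?S" "T b = i"
      using balanced_before_ex[OF bal _ fin Y bq] i Tq oc by auto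
    obtain ra ca where "b = (ra, ca)" by force
    with b0 have b: "(ra, ca) \<in> ?S" "T (ra, ca) = i" by simp_all
    then have bY: "(ra, ca) \<in> Y" by (simp add: span_def)
    consider "ca = c" "ra < r" | "ca = Suc c" "r < ra"
      using b Tq by (cases "ca = Suc c \<and> ra = r") (auto simp: span_def before_def)
    then show False
    proof cases
      case 1
      then have "T (ra, c) < i - 1" using sst_col_less[OF T, of ra c r] bY p i by auto
      then show False using b 1 by simp
    next
      case 2
      have Z: "(ra, c) \<in> Y" using convexD[OF conv p(1) bY, of ra c] 2 by simp
      have "T (ra, c) \<le> i" using sst_row_le[OF T Z, of "Suc c"] bY b 2 by auto
      then show False using below[OF Z 2(2)] by simp
    qed
  qed
  show ?thesis
  proof (rule sst_update[OF T])
    show "i \<noteq> 0" using i by simp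
    show "row_rel i (T (r, c'))" if "(r, c') \<in> Y" "c < c'" for c'
      using right[OF that] i rel_weak(1) by blast
    show "row_rel (T (r, c')) i" if "(r, c') \<in> Y" "c' < c" for c'
    proof -
      have "T (r, c') \<le> i - 1" using sst_row_le[OF T that(1) p(1) that(2)] p(2) by auto
      then show ?thesis using less_col_row(2)[of "T (r, c')" i] by linarith
    qed
    show "col_rel i (T (r', c))" if "(r', c) \<in> Y" "r < r'" for r'
      using below[OF that] less_col_row(1) by blast
    show "col_rel (T (r', c)) i" if "(r', c) \<in> Y" "r' < r" for r'
    proof -
      have "T (r', c) \<le> i - 1" using sst_col_le[OF T that(1) p(1) that(2)] p(2) by auto
      then show ?thesis using less_col_row(1)[of "T (r', c)" i] by linarith
    qed
  qed
qed

text \<open>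
  The argument for raising, rotated by a half turn.
\<close>

lemma sst_word_step_neg_rev:
  assumes fin: "finite Y" and conv: "convex Y" and T: "sst Y T" and i: "i < 0"
    and p: "(r, c) \<in> Y" "T (r, c) = i" and bal: "balanced i Y T (r, c)"
  shows "sst Y (T((r, c) := i - 1))"
proof -
  have oc: "opener i = i - 1" "closer i = i"
    using i by (simp_all add: opener_def closer_def arrow_src_def arrow_tgt_def)
  have above: "T (r', c) < i - 1" if r': "(r', c) \<in> Y" "r' < r" for r'
  proof -
    obtain k where k: "Suc k = r" using r'(2) by (cases r) auto
    have Y: "(k, c) \<in> Y" using convexD[OF conv r'(1) p(1), of k c] r' k by simp
    have "T (k, c) < i" using sst_col_less[OF T Y p(1)] p(2) i k by auto
    moreover have "T (k, c) \<noteq> i - 1" using balanced_above[OF bal _ fin Y k] i oc by simp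
    moreover have "T (r', c) \<le> T (k, c)"
      using sst_col_le[OF T r'(1) Y] r'(2) k by (cases "r' = k") auto
    ultimately show ?thesis by linarith
  qed
  have left: "T (r, c') \<le> i - 1" if c': "(r, c') \<in> Y" "c' < c" for c'
  proof (rule ccontr)
    assume "\<not> T (r, c') \<le> i - 1"
    moreover obtain k where k: "Suc k = c" using c'(2) by (cases c) auto
    moreover have Y: "(r, k) \<in> Y" using convexD[OF conv c'(1) p(1), of r k] c' k by simp
    moreover have "T (r, k) \<le> i" using sst_row_le[OF T Y p(1)] p(2) k by auto
    moreover have "T (r, c') \<le> T (r, k)"
      using sst_row_le[OF T c'(1) Y] c'(2) k by (cases "c' = k") auto
    ultimately have Tq: "T (r, k) = i" by linarith
    let ?S = "span Y (r, c) (r, k) - {(r, c)}"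
    have bq: "before (r, c) (r, k)" using k by (simp add: before_def)
    obtain b where b0: "b \<in> ?S" "T b = i - 1"
      using balanced_after_ex[OF bal _ fin Y bq] i Tq oc by auto
    obtain ra ca where "b = (ra, ca)" by force
    with b0 have b: "(ra, ca) \<in> ?S" "T (ra, ca) = i - 1" by simp_all
    then have bY: "(ra, ca) \<in> Y" by (simp add: span_def)
    consider "ca = c" "r < ra" | "ca = k" "ra < r"
      using b Tq k by (cases "ca = k \<and> ra = r") (auto simp: span_def before_def)
    then show False
    proof cases
      case 1
      then have "i < T (ra, c)" using sst_col_less[OF T p(1), of ra] bY p i by auto
      then show False using b 1 by simp
    next
      case 2
      have Z: "(ra, c) \<in> Y" using convexD[OF conv bY p(1), of ra c] 2 k by simp
      have "i - 1 \<le> T (ra, c)" using sst_row_le[OF T, of ra k c] Z bY b 2 k by auto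
      then show False using above[OF Z 2(2)] by simp
    qed
  qed
  show ?thesis
  proof (rule sst_update[OF T])
    show "i - 1 \<noteq> 0" using i by simp
    show "row_rel (i - 1) (T (r, c'))" if "(r, c') \<in> Y" "c < c'" for c'
    proof -
      have "i \<le> T (r, c')" using sst_row_le[OF T p(1) that] p(2) by auto
      then show ?thesis using less_col_row(2)[of "i - 1" "T (r, c')"] by linarith
    qed
    show "row_rel (T (r, c')) (i - 1)" if "(r, c') \<in> Y" "c' < c" for c'
      using left[OF that] i rel_weak(2)[of "T (r, c')" "i - 1"] by linarith
    show "col_rel (i - 1) (T (r', c))" if "(r', c) \<in> Y" "r < r'" for r'
    proof -
      have "i \<le> T (r', c)" using sst_col_le[OF T p(1) that] p(2) by auto
      then show ?thesis using less_col_row(1)[of "i - 1" "T (r', c)"] by linarith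
    qed
    show "col_rel (T (r', c)) (i - 1)" if "(r', c) \<in> Y" "r' < r" for r'
      using above[OF that] less_col_row(1) by blast
  qed
qed

text \<open>
  Here equal letters fill vertical runs, so single boxes no longer suffice. If the right neighbour were
  \<open>i + 1\<close>, then the run of letters \<open>i\<close> that ends in the box would have a run of letters \<open>i + 1\<close> along
  its right side. Of the boxes read from the top of the latter to the box, one more contains an \<open>i + 1\<close>
  than contains an \<open>i\<close>, since the box itself is left out.
\<close>

lemma sst_word_step_pos:
  assumes fin: "finite Y" and conv: "convex Y" and T: "sst Y T" and i: "i > 0"
    and p: "(r, c) \<in> Y" "T (r, c) = i" and bal: "balanced i Y T (r, c)"
  shows "sst Y (T((r, c) := i + 1))"
proof -
  have oc: "opener i = i + 1" "closer i = i"
    using i by (simp_all add: opener_def closer_def arrow_src_def arrow_tgt_def)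
  have below: "i + 1 \<le> T (r', c)" if r': "(r', c) \<in> Y" "r < r'" for r'
  proof -
    have Y: "(Suc r, c) \<in> Y" using convexD[OF conv p(1) r'(1), of "Suc r" c] r' by simp
    have "i \<le> T (Suc r, c)" using sst_col_le[OF T p(1) Y] p(2) by auto
    moreover have "T (Suc r, c) \<noteq> i" using balanced_below[OF bal _ fin Y] i oc by simp
    moreover have "T (Suc r, c) \<le> T (r', c)"
      using sst_col_le[OF T Y r'(1)] r'(2) by (cases "Suc r = r'") auto
    ultimately show ?thesis by linarith
  qed
  have right: "i + 1 < T (r, c')" if c': "(r, c') \<in> Y" "c < c'" for c'
  proof (rule ccontr)
    assume "\<not> i + 1 < T (r, c')"
    moreover have Y: "(r, Suc c) \<in> Y" using convexD[OF conv p(1) c'(1), of r "Suc c"] c' by simp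
    moreover have "i < T (r, Suc c)" using sst_row_less[OF T p(1) Y] p(2) i by auto
    moreover have "T (r, Suc c) \<le> T (r, c')"
      using sst_row_le[OF T Y c'(1)] c'(2) by (cases "Suc c = c'") auto
    ultimately have Tq: "T (r, Suc c) = i + 1" by linarith
    \<comment> \<open>the topmost letter \<open>i\<close> of the run that ends in the box\<close>
    define r0 where "r0 = (LEAST a. (a, c) \<in> Y \<and> T (a, c) = i)"
    have r0: "(r0, c) \<in> Y" "T (r0, c) = i" "r0 \<le> r"
      using LeastI[of "\<lambda>a. (a, c) \<in> Y \<and> T (a, c) = i" r]
        Least_le[of "\<lambda>a. (a, c) \<in> Y \<and> T (a, c) = i" r] p unfolding r0_def by auto
    have least: "r0 \<le> a" if "(a, c) \<in> Y" "T (a, c) = i" for a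
      using Least_le[of "\<lambda>a. (a, c) \<in> Y \<and> T (a, c) = i" a] that unfolding r0_def by auto
    have run: "(a, Suc c) \<in> Y \<and> T (a, Suc c) = i + 1" if a: "r0 \<le> a" "a \<le> r" for a
    proof -
      have Z: "(a, c) \<in> Y" "(a, Suc c) \<in> Y"
        using convexD[OF conv r0(1) Y, of a] a by auto
      have "i \<le> T (a, c)" using sst_col_le[OF T r0(1) Z(1)] r0 a by (cases "r0 = a") auto
      moreover have "T (a, c) < T (a, Suc c)"
        using sst_row_less[OF T Z] calculation i by auto
      moreover have "T (a, Suc c) \<le> i + 1"
        using sst_col_le[OF T Z(2) Y] Tq a by (cases "a = r") auto
      ultimately show ?thesis using Z by simp
    qed
    let ?S = "span Y (r0, Suc c) (r, c) - {(r, c)}"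
    have q: "(r0, Suc c) \<in> Y" using run r0 by simp
    have bq: "before (r0, Suc c) (r, c)" by (simp add: before_def)
    have "(\<lambda>a. (a, Suc c)) ` {r0..r} \<subseteq> {b \<in> ?S. T b = opener i}"
      using run oc by (auto simp: span_def before_def)
    then have "card ((\<lambda>a. (a, Suc c)) ` {r0..r}) \<le> card {b \<in> ?S. T b = opener i}"
      by (rule card_mono[OF finite_span[OF fin]])
    then have "Suc r - r0 \<le> card {b \<in> ?S. T b = opener i}"
      by (simp add: card_image inj_on_def)
    moreover have "{b \<in> ?S. T b = closer i} \<subseteq> (\<lambda>a. (a, c)) ` {r0..<r}"
    proof
      fix b assume b: "b \<in> {b \<in> ?S. T b = closer i}"
      obtain ra ca where b': "b = (ra, ca)" by force
      have bY: "(ra, ca) \<in> Y" and Tb: "T (ra, ca) = i" using b b' oc by (auto simp: span_def)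
      consider "ca = c" "ra < r" | "ca = Suc c" "r0 \<le> ra"
        using b b' by (auto simp: span_def before_def)
      then show "b \<in> (\<lambda>a. (a, c)) ` {r0..<r}"
      proof cases
        case 1
        then show ?thesis using least bY Tb b' by auto
      next
        case 2
        then have "i + 1 \<le> T (ra, ca)"
          using sst_col_le[OF T q, of ra] bY run[of r0] r0(3) by (cases "r0 = ra") auto
        then show ?thesis using Tb by simp
      qed
    qed
    then have "card {b \<in> ?S. T b = closer i} \<le> card ((\<lambda>a. (a, c)) ` {r0..<r})"
      by (rule card_mono[rotated]) simp
    then have "card {b \<in> ?S. T b = closer i} \<le> r - r0"
      by (simp add: card_image inj_on_def)
    ultimately show False
      using balanced_before[OF bal _ q bq] i r0(3) by simp
  qed
  show ?thesis
  proof (rule sst_update[OF T])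
    show "i + 1 \<noteq> 0" using i by simp
    show "row_rel (i + 1) (T (r, c'))" if "(r, c') \<in> Y" "c < c'" for c'
      using right[OF that] less_col_row(2) by blast
    show "row_rel (T (r, c')) (i + 1)" if "(r, c') \<in> Y" "c' < c" for c'
    proof -
      have "T (r, c') \<le> i" using sst_row_le[OF T that(1) p(1) that(2)] p(2) by auto
      then show ?thesis using less_col_row(2)[of "T (r, c')" "i + 1"] by linarith
    qed
    show "col_rel (i + 1) (T (r', c))" if "(r', c) \<in> Y" "r < r'" for r'
      using below[OF that] i rel_weak(3)[of "i + 1" "T (r', c)"] by linarith
    show "col_rel (T (r', c)) (i + 1)" if "(r', c) \<in> Y" "r' < r" for r'
    proof -
      have "T (r', c) \<le> i" using sst_col_le[OF T that(1) p(1) that(2)] p(2) by auto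
      then show ?thesis using less_col_row(1)[of "T (r', c)" "i + 1"] by linarith
    qed
  qed
qed

text \<open>
  The argument for raising, rotated by a half turn.
\<close>

lemma sst_word_step_pos_rev:
  assumes fin: "finite Y" and conv: "convex Y" and T: "sst Y T" and i: "i > 0"
    and p: "(r, c) \<in> Y" "T (r, c) = i + 1" and bal: "balanced i Y T (r, c)"
  shows "sst Y (T((r, c) := i))"
proof -
  have oc: "opener i = i + 1" "closer i = i"
    using i by (simp_all add: opener_def closer_def arrow_src_def arrow_tgt_def)
  have above: "T (r', c) \<le> i" if r': "(r', c) \<in> Y" "r' < r" for r'
  proof -
    obtain k where k: "Suc k = r" using r'(2) by (cases r) auto
    have Y: "(k, c) \<in> Y" using convexD[OF conv r'(1) p(1), of k c] r' k by simp
    have "T (k, c) \<le> i + 1" using sst_col_le[OF T Y p(1)] p(2) k by auto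
    moreover have "T (k, c) \<noteq> i + 1" using balanced_above[OF bal _ fin Y k] i oc by simp
    moreover have "T (r', c) \<le> T (k, c)"
      using sst_col_le[OF T r'(1) Y] r'(2) k by (cases "r' = k") auto
    ultimately show ?thesis by linarith
  qed
  have left: "T (r, c') < i" if c': "(r, c') \<in> Y" "c' < c" for c'
  proof (rule ccontr)
    assume "\<not> T (r, c') < i"
    moreover obtain k where k: "Suc k = c" using c'(2) by (cases c) auto
    moreover have Y: "(r, k) \<in> Y" using convexD[OF conv c'(1) p(1), of r k] c' k by simp
    moreover have "T (r, k) < i + 1" using sst_row_less[OF T Y p(1)] p(2) i k by auto
    moreover have "T (r, c') \<le> T (r, k)"
      using sst_row_le[OF T c'(1) Y] c'(2) k by (cases "c' = k") auto
    ultimately have Tq: "T (r, k) = i" by linarith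
    \<comment> \<open>the lowest letter \<open>i + 1\<close> of the run that starts in the box\<close>
    define M where "M = {a. (a, c) \<in> Y \<and> T (a, c) = i + 1}"
    have finM: "finite M" using finite_column[OF fin, of c] unfolding M_def by simp
    have rM: "r \<in> M" using p by (simp add: M_def)
    define r1 where "r1 = Max M"
    have r1: "(r1, c) \<in> Y" "T (r1, c) = i + 1" "r \<le> r1"
      using Max_in[OF finM] rM Max_ge[OF finM rM] unfolding r1_def M_def by auto
    have greatest: "a \<le> r1" if "(a, c) \<in> Y" "T (a, c) = i + 1" for a
      using Max_ge[OF finM, of a] that unfolding r1_def M_def by auto
    have run: "(a, k) \<in> Y \<and> T (a, k) = i" if a: "r \<le> a" "a \<le> r1" for a
    proof -
      have Z: "(a, k) \<in> Y" "(a, c) \<in> Y"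
        using convexD[OF conv Y r1(1), of a] a k by auto
      have "T (a, c) \<le> i + 1" using sst_col_le[OF T Z(2) r1(1)] r1 a by (cases "r1 = a") auto
      moreover have "i \<le> T (a, k)"
        using sst_col_le[OF T Y Z(1)] Tq a by (cases "a = r") auto
      moreover have "T (a, k) < T (a, c)"
        using sst_row_less[OF T Z] k calculation i by auto
      ultimately show ?thesis using Z by simp
    qed
    let ?S = "span Y (r, c) (r1, k) - {(r, c)}"
    have q: "(r1, k) \<in> Y" using run r1 by simp
    have bq: "before (r, c) (r1, k)" using k by (simp add: before_def)
    have "(\<lambda>a. (a, k)) ` {r..r1} \<subseteq> {b \<in> ?S. T b = closer i}"
      using run oc k by (auto simp: span_def before_def)
    then have "card ((\<lambda>a. (a, k)) ` {r..r1}) \<le> card {b \<in> ?S. T b = closer i}"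
      by (rule card_mono[OF finite_span[OF fin]])
    then have "Suc r1 - r \<le> card {b \<in> ?S. T b = closer i}"
      by (simp add: card_image inj_on_def)
    moreover have "{b \<in> ?S. T b = opener i} \<subseteq> (\<lambda>a. (a, c)) ` {r<..r1}"
    proof
      fix b assume b: "b \<in> {b \<in> ?S. T b = opener i}"
      obtain ra ca where b': "b = (ra, ca)" by force
      have bY: "(ra, ca) \<in> Y" and Tb: "T (ra, ca) = i + 1" using b b' oc by (auto simp: span_def)
      consider "ca = c" "r < ra" | "ca = k" "ra \<le> r1"
        using b b' k by (auto simp: span_def before_def)
      then show "b \<in> (\<lambda>a. (a, c)) ` {r<..r1}"
      proof cases
        case 1
        then show ?thesis using greatest bY Tb b' by auto
      next
        case 2
        then have "T (ra, ca) \<le> i"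
          using sst_col_le[OF T _ q, of ra] bY run[of r1] r1(3) by (cases "r1 = ra") auto
        then show ?thesis using Tb by simp
      qed
    qed
    then have "card {b \<in> ?S. T b = opener i} \<le> card ((\<lambda>a. (a, c)) ` {r<..r1})"
      by (rule card_mono[rotated]) simp
    then have "card {b \<in> ?S. T b = opener i} \<le> r1 - r"
      by (simp add: card_image inj_on_def)
    ultimately show False
      using balanced_after[OF bal _ q bq] i r1(3) by simp
  qed
  show ?thesis
  proof (rule sst_update[OF T])
    show "i \<noteq> 0" using i by simp
    show "row_rel i (T (r, c'))" if "(r, c') \<in> Y" "c < c'" for c'
    proof -
      have "i + 1 \<le> T (r, c')" using sst_row_le[OF T p(1) that] p(2) by auto
      then show ?thesis using less_col_row(2)[of i "T (r, c')"] by linarith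
    qed
    show "row_rel (T (r, c')) i" if "(r, c') \<in> Y" "c' < c" for c'
      using left[OF that] less_col_row(2) by blast
    show "col_rel i (T (r', c))" if "(r', c) \<in> Y" "r < r'" for r'
    proof -
      have "i + 1 \<le> T (r', c)" using sst_col_le[OF T p(1) that] p(2) by auto
      then show ?thesis using less_col_row(1)[of i "T (r', c)"] by linarith
    qed
    show "col_rel (T (r', c)) i" if "(r', c) \<in> Y" "r' < r" for r'
      using above[OF that] i rel_weak(4)[of "T (r', c)" i] by linarith
  qed
qed

text \<open>
  The box carries the first letter \<open>-1\<close> or \<open>1\<close> that is read. The boxes above it and to its right are read
  earlier and hence contain neither; the others cause no conflict, because \<open>-1\<close> and \<open>1\<close> obey opposite
  rules on repetition.
\<close>

lemma sst_word_step_zero: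
  assumes T: "sst Y T" and p: "(r, c) \<in> Y" "T (r, c) = -1" and bal: "balanced 0 Y T (r, c)"
  shows "sst Y (T((r, c) := 1))"
proof (rule sst_update[OF T])
  have pre: "T q \<noteq> -1 \<and> T q \<noteq> 1" if "q \<in> Y" "before q (r, c)" for q
    using bal that unfolding balanced_def by blast
  show "row_rel 1 (T (r, c'))" if "(r, c') \<in> Y" "c < c'" for c'
  proof -
    have "-1 \<le> T (r, c')" using sst_row_le[OF T p(1) that] p(2) by auto
    then have "1 < T (r, c')"
      using pre[OF that(1)] that sst_nonzero[OF T that(1)] by (auto simp: before_def)
    then show ?thesis using less_col_row(2) by blast
  qed
  show "row_rel (T (r, c')) 1" if "(r, c') \<in> Y" "c' < c" for c'
  proof -
    have "T (r, c') \<le> -1" using sst_row_le[OF T that(1) p(1) that(2)] p(2) by auto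
    then show ?thesis using less_col_row(2)[of "T (r, c')" 1] by linarith
  qed
  show "col_rel 1 (T (r', c))" if "(r', c) \<in> Y" "r < r'" for r'
  proof -
    have "-1 < T (r', c)" using sst_col_less[OF T p(1) that] p(2) by auto
    then have "1 \<le> T (r', c)" using sst_nonzero[OF T that(1)] by linarith
    then show ?thesis using rel_weak(3)[of 1 "T (r', c)"] by simp
  qed
  show "col_rel (T (r', c)) 1" if "(r', c) \<in> Y" "r' < r" for r'
  proof -
    have "T (r', c) \<le> -1" using sst_col_le[OF T that(1) p(1) that(2)] p(2) by auto
    then show ?thesis using less_col_row(1)[of "T (r', c)" 1] by linarith
  qed
qed simp

lemma sst_word_step_zero_rev:
  assumes T: "sst Y T" and p: "(r, c) \<in> Y" "T (r, c) = 1" and bal: "balanced 0 Y T (r, c)"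
  shows "sst Y (T((r, c) := -1))"
proof (rule sst_update[OF T])
  have pre: "T q \<noteq> -1 \<and> T q \<noteq> 1" if "q \<in> Y" "before q (r, c)" for q
    using bal that unfolding balanced_def by blast
  show "row_rel (-1) (T (r, c'))" if "(r, c') \<in> Y" "c < c'" for c'
  proof -
    have "1 \<le> T (r, c')" using sst_row_le[OF T p(1) that] p(2) by auto
    then show ?thesis using less_col_row(2)[of "-1" "T (r, c')"] by linarith
  qed
  show "row_rel (T (r, c')) (-1)" if "(r, c') \<in> Y" "c' < c" for c'
  proof -
    have "T (r, c') < 1" using sst_row_less[OF T that(1) p(1) that(2)] p(2) by auto
    then have "T (r, c') \<le> -1" using sst_nonzero[OF T that(1)] by linarith
    then show ?thesis using rel_weak(2)[of "T (r, c')" "-1"] by simp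
  qed
  show "col_rel (-1) (T (r', c))" if "(r', c) \<in> Y" "r < r'" for r'
  proof -
    have "1 \<le> T (r', c)" using sst_col_le[OF T p(1) that] p(2) by auto
    then show ?thesis using less_col_row(1)[of "-1" "T (r', c)"] by linarith
  qed
  show "col_rel (T (r', c)) (-1)" if "(r', c) \<in> Y" "r' < r" for r'
  proof -
    have "T (r', c) \<le> 1" using sst_col_le[OF T that(1) p(1) that(2)] p(2) by auto
    then have "T (r', c) < -1"
      using pre[OF that(1)] that sst_nonzero[OF T that(1)] by (auto simp: before_def)
    then show ?thesis using less_col_row(1) by blast
  qed
qed simp

lemma sst_word_step:
  assumes fin: "finite Y" and conv: "convex Y" and T: "sst Y T"
    and step: "word_step i (reading Y T) z \<or> word_step i z (reading Y T)"
  shows "\<exists>S. sst Y S \<and> z = reading Y S"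
  using step
proof
  assume "word_step i (reading Y T) z"
  from word_step_reading[OF fin this] obtain r c where p: "(r, c) \<in> Y" "T (r, c) = arrow_src i"
    "z = reading Y (T((r, c) := arrow_tgt i))" "balanced i Y T (r, c)" by (metis surj_pair)
  have "sst Y (T((r, c) := arrow_tgt i))"
  proof (cases i rule: arrow_cases)
    case 1
    then show ?thesis using sst_word_step_neg[OF fin conv T 1(1) p(1)] p by simp
  next
    case 2
    then show ?thesis using sst_word_step_zero[OF T p(1)] p by simp
  next
    case 3
    then show ?thesis using sst_word_step_pos[OF fin conv T 3(1) p(1)] p by simp
  qed
  then show ?thesis using p(3) by blast
next
  assume "word_step i z (reading Y T)"
  from word_step_reading_rev[OF fin this] obtain r c where p: "(r, c) \<in> Y" "T (r, c) = arrow_tgt i"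
    "z = reading Y (T((r, c) := arrow_src i))" "balanced i Y T (r, c)" by (metis surj_pair)
  have "sst Y (T((r, c) := arrow_src i))"
  proof (cases i rule: arrow_cases)
    case 1
    then show ?thesis using sst_word_step_neg_rev[OF fin conv T 1(1) p(1)] p by simp
  next
    case 2
    then show ?thesis using sst_word_step_zero_rev[OF T p(1)] p by simp
  next
    case 3
    then show ?thesis using sst_word_step_pos_rev[OF fin conv T 3(1) p(1)] p by simp
  qed
  then show ?thesis using p(3) by blast
qed

section \<open>Connectedness of the crystal of a Young diagram\<close>

definition word_connected :: "nat \<Rightarrow> nat \<Rightarrow> int list \<Rightarrow> int list \<Rightarrow> bool" where
  "word_connected m n = (\<lambda>w w'. \<exists>i\<in>indices m n. word_step i w w' \<or> word_step i w' w)\<^sup>*\<^sup>*"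

lemma word_connected_refl: "word_connected m n w w"
  by (simp add: word_connected_def)

lemma word_connected_trans: "word_connected m n u v \<Longrightarrow> word_connected m n v w \<Longrightarrow> word_connected m n u w"
  unfolding word_connected_def by (rule rtranclp_trans)

lemma word_connected_sym: "word_connected m n u v \<Longrightarrow> word_connected m n v u"
  unfolding word_connected_def by (rule sympD[OF symp_rtranclp]) (auto simp: symp_def)

lemma word_connected_step:
  "i \<in> indices m n \<Longrightarrow> word_step i u v \<or> word_step i v u \<Longrightarrow> word_connected m n u v"
  unfolding word_connected_def by (rule r_into_rtranclp) blast

lemma arrow_letters:
  "i \<in> indices m n \<Longrightarrow> arrow_src i \<in> letters m n \<and> arrow_tgt i \<in> letters m n"
  by (cases i rule: arrow_cases) (auto simp: indices_def letters_def Bplus_def Bminus_def)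

lemma word_step_letters:
  assumes "i \<in> indices m n" "word_step i w w'"
  shows "set w' \<subseteq> letters m n \<longleftrightarrow> set w \<subseteq> letters m n"
  using arrow_letters[OF assms(1)] assms(2) unfolding word_step_def by auto

lemma semistandard_letters: "semistandard m n Y T \<Longrightarrow> p \<in> Y \<Longrightarrow> T p \<in> letters m n"
  unfolding semistandard_def by blast

lemma semistandard_step:
  assumes "finite Y" "convex Y" "semistandard m n Y T" "i \<in> indices m n"
    and step: "word_step i (reading Y T) z \<or> word_step i z (reading Y T)"
  shows "\<exists>S. semistandard m n Y S \<and> z = reading Y S"
proof -
  obtain S where S: "sst Y S" "z = reading Y S"
    using sst_word_step[OF assms(1,2) _ step] assms(3) unfolding semistandard_iff by blast
  have "set (reading Y T) \<subseteq> letters m n"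
    using assms(1,3) by (auto simp: set_reading semistandard_letters)
  then have "set z \<subseteq> letters m n"
    using step word_step_letters[OF assms(4)] by blast
  then show ?thesis using S assms(1) unfolding semistandard_iff by (auto simp: set_reading)
qed

lemma young_diagramD: "young_diagram Y \<Longrightarrow> (r, c) \<in> Y \<Longrightarrow> r' \<le> r \<Longrightarrow> c' \<le> c \<Longrightarrow> (r', c') \<in> Y"
  unfolding young_diagram_def by blast

lemma young_diagram_finite: "young_diagram Y \<Longrightarrow> finite Y"
  unfolding young_diagram_def by blast

text \<open>
  The highest weight tableau of \<open>gl(m|1)\<close>, as one filling of all boxes that serves every shape.
\<close>

definition genuine_highest :: "nat \<Rightarrow> nat \<times> nat \<Rightarrow> int" where
  "genuine_highest m p = (if fst p < m then int (fst p) - int m else 1)"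

lemma phi_w_0: "arrow_src i \<notin> set u \<Longrightarrow> phi_w i u = 0"
  by (induction u) auto

lemma word_step_rev_exists:
  assumes "i \<le> 0" "arrow_src i \<notin> set u"
  shows "\<exists>z. word_step i z (u @ arrow_tgt i # v)"
proof -
  have "eps_w i (u @ arrow_tgt i # v) > 0"
    using assms(1) phi_w_0[OF assms(2)] by (cases "i = 0") (auto simp: eps_w_append)
  then show ?thesis by (rule word_step_eps_exists)
qed

lemma sst_row_bound:
  assumes Y: "young_diagram Y" and T: "sst Y T" and lb: "\<And>p. p \<in> Y \<Longrightarrow> - int m \<le> T p"
  shows "(r, c) \<in> Y \<Longrightarrow> T (r, c) < 0 \<Longrightarrow> int r - int m \<le> T (r, c)"
proof (induction r)
  case 0
  then show ?case using lb[of "(0, c)"] by simp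
next
  case (Suc r)
  have Z: "(r, c) \<in> Y" using young_diagramD[OF Y Suc.prems(1)] by simp
  have "T (r, c) < T (Suc r, c)" using sst_col_less[OF T Z Suc.prems(1)] Suc.prems(2) by simp
  then show ?case using Suc.IH[OF Z] Suc.prems(2) by simp
qed

text \<open>
  With only one unbarred letter, every other tableau admits some \<open>e\<^sub>i\<close>. Take the topmost row that differs
  from the distinguished filling and its last box, with entry \<open>x\<close>, and lower \<open>x\<close> to its predecessor.
  What is read before this box belongs to higher rows, which are filled with letters below the
  predecessor of \<open>x\<close>; so nothing cancels \<open>x\<close>.
\<close>

lemma climb_to_genuine_highest:
  assumes Y: "young_diagram Y" and T: "semistandard m 1 Y T"
    and ne: "\<exists>p\<in>Y. T p \<noteq> genuine_highest m p"
  shows "\<exists>i\<in>indices m 1. \<exists>z. word_step i z (reading Y T)"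
proof -
  have sst: "sst Y T" using T by (simp add: semistandard_iff)
  have bounds: "- int m \<le> T p \<and> (T p < 0 \<or> T p = 1)" if "p \<in> Y" for p
    using semistandard_letters[OF T that] by (auto simp: letters_def Bplus_def Bminus_def)
  note fin = young_diagram_finite[OF Y]
  \<comment> \<open>the topmost row with a wrong entry\<close>
  define wrong where "wrong r \<longleftrightarrow> (\<exists>c. (r, c) \<in> Y \<and> T (r, c) \<noteq> genuine_highest m (r, c))" for r
  have "\<exists>r. wrong r" using ne unfolding wrong_def by auto
  define r where "r = (LEAST r. wrong r)"
  have wr: "wrong r" using LeastI_ex[OF \<open>\<exists>r. wrong r\<close>] by (simp add: r_def)
  have above: "T (r', c) = genuine_highest m (r', c)" if "r' < r" "(r', c) \<in> Y" for r' c
    using not_less_Least[of r' wrong] that unfolding r_def wrong_def by blast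
  obtain c0 where c0: "(r, c0) \<in> Y" "T (r, c0) \<noteq> genuine_highest m (r, c0)"
    using wr unfolding wrong_def by blast
  have bound: "T (r, c0) < 0 \<longrightarrow> int r - int m \<le> T (r, c0)"
    using sst_row_bound[OF Y sst _ c0(1)] bounds by blast
  have rm: "r < m"
    using bound c0 bounds[OF c0(1)] by (auto simp: genuine_highest_def split: if_splits)
  have gt: "int r - int m < T (r, c0)"
    using bound c0 bounds[OF c0(1)] rm by (auto simp: genuine_highest_def)
  have finr: "finite {c. (r, c) \<in> Y}"
    by (rule finite_subset[of _ "snd ` Y"]) (force, simp add: fin)
  define c where "c = Max {c. (r, c) \<in> Y}"
  have cY: "(r, c) \<in> Y" using Max_in[OF finr] c0(1) unfolding c_def by blast
  have cmax: "c' \<le> c" if "(r, c') \<in> Y" for c' using Max_ge[OF finr, of c'] that unfolding c_def by blast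
  define x where "x = T (r, c)"
  have gtx: "int r - int m < x"
    using gt cmax[OF c0(1)] sst_row_le[OF sst c0(1) cY] unfolding x_def by (cases "c0 = c") auto
  have xlet: "x < 0 \<or> x = 1" using bounds[OF cY] by (simp add: x_def)
  define i where "i = (if x < 0 then x else 0)"
  have tgt: "arrow_tgt i = x" and i0: "i \<le> 0"
    using xlet by (auto simp: i_def arrow_tgt_def)
  have src: "int r - int m \<le> arrow_src i"
    using xlet gtx rm by (auto simp: i_def arrow_src_def)
  have ind: "i \<in> indices m 1"
    using xlet gtx rm by (auto simp: i_def indices_def)
  obtain A B where AB: "reading_boxes Y = A @ (r, c) # B"
    using cY set_reading_boxes[OF fin] split_list by metis
  have "arrow_src i \<notin> set (map T A)"
  proof
    assume "arrow_src i \<in> set (map T A)"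
    then obtain r' c' where q: "(r', c') \<in> Y" "before (r', c') (r, c)" "T (r', c') = arrow_src i"
      using reading_boxes_split(2)[OF fin AB] by auto
    have "r' < r"
    proof (rule ccontr)
      assume "\<not> r' < r"
      then have "(r, c') \<in> Y" using young_diagramD[OF Y q(1)] by simp
      then show False using cmax q(2) \<open>\<not> r' < r\<close> by (fastforce simp: before_def)
    qed
    then have "T (r', c') = int r' - int m" using above q(1) rm by (simp add: genuine_highest_def)
    then show False using q(3) src \<open>r' < r\<close> by simp
  qed
  moreover have "reading Y T = map T A @ arrow_tgt i # map T B"
    by (simp add: reading_def AB tgt x_def)
  ultimately show ?thesis using word_step_rev_exists[OF i0] ind by metis
qed

lemma word_connected_genuine_highest:
  assumes Y: "young_diagram Y" and T: "semistandard m 1 Y T"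
  shows "word_connected m 1 (reading Y T) (reading Y (genuine_highest m))"
  using T
proof (induction "sum_list (map (\<lambda>x. nat (x + int m)) (reading Y T))" arbitrary: T rule: less_induct)
  case less
  note fin = young_diagram_finite[OF Y]
  show ?case
  proof (cases "\<exists>p\<in>Y. T p \<noteq> genuine_highest m p")
    case True
    then obtain i z where i: "i \<in> indices m 1" and z: "word_step i z (reading Y T)"
      using climb_to_genuine_highest[OF Y less.prems] by blast
    obtain S where S: "semistandard m 1 Y S" "z = reading Y S"
      using semistandard_step[OF fin young_diagram_convex[OF Y] less.prems i] z by blast
    \<comment> \<open>the shift by \<open>m\<close> makes all letters nonnegative, so that their sum is a termination measure\<close>
    have "nat (arrow_src i + int m) < nat (arrow_tgt i + int m)"
      using i by (cases i rule: arrow_cases) (auto simp: indices_def)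
    then have "sum_list (map (\<lambda>x. nat (x + int m)) z) < sum_list (map (\<lambda>x. nat (x + int m)) (reading Y T))"
      using z unfolding word_step_def by auto
    then have "word_connected m 1 z (reading Y (genuine_highest m))"
      using less.hyps[of S] S by simp
    then show ?thesis using word_connected_step[OF i] z word_connected_trans by blast
  next
    case False
    then have "reading Y T = reading Y (genuine_highest m)" by (intro reading_cong[OF fin]) blast
    then show ?thesis by (simp add: word_connected_refl)
  qed
qed

text \<open>
  Letters that are neither source nor target may be dropped. So a path between words in the smaller
  letters lifts to words with additional letters \<open>n + 1\<close>, which stay where they are.
\<close>

lemma eps_phi_filter:
  assumes "x \<noteq> arrow_src i" "x \<noteq> arrow_tgt i"
  shows "eps_w i (filter (\<lambda>y. y \<noteq> x) w) = eps_w i w \<and> phi_w i (filter (\<lambda>y. y \<noteq> x) w) = phi_w i w"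
proof (induction w)
  case (Cons b w)
  show ?case
  proof (cases "b = x")
    case True
    then show ?thesis using Cons assms by (cases "i = 0") simp_all
  next
    case False
    then show ?thesis using Cons by (simp cong: if_cong)
  qed
qed simp

lemma ok_filter:
  assumes "x \<noteq> arrow_src i" "x \<noteq> arrow_tgt i"
  shows "okL i (filter (\<lambda>y. y \<noteq> x) w) = okL i w" "okR i (filter (\<lambda>y. y \<noteq> x) w) = okR i w"
  by (simp_all only: okL_def okR_def eps_phi_filter[OF assms])

lemma filter_split:
  assumes "filter P w = u @ a # v"
  obtains w1 w2 where "w = w1 @ a # w2" "filter P w1 = u" "filter P w2 = v" "P a"
proof -
  have "\<exists>w1 w2. w = w1 @ a # w2 \<and> filter P w1 = u \<and> filter P w2 = v \<and> P a"
    using assms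
  proof (induction w arbitrary: u)
    case (Cons b w)
    show ?case
    proof (cases "P b \<and> u = []")
      case True
      then show ?thesis using Cons.prems by (intro exI[of _ "[]"] exI[of _ w]) auto
    next
      case False
      then have "filter P w = (if P b then tl u else u) @ a # v" "P b \<longrightarrow> u = b # tl u"
        using Cons.prems by (cases u; simp split: if_splits)+
      then show ?thesis
        using Cons.IH[of "if P b then tl u else u"] by (metis append_Cons filter.simps(2))
    qed
  qed simp
  then show ?thesis using that by blast
qed

lemma word_step_lift:
  assumes x: "x \<noteq> arrow_src i" "x \<noteq> arrow_tgt i"
    and step: "word_step i (filter (\<lambda>y. y \<noteq> x) w) z \<or> word_step i z (filter (\<lambda>y. y \<noteq> x) w)"
  shows "\<exists>w'. (word_step i w w' \<or> word_step i w' w) \<and> filter (\<lambda>y. y \<noteq> x) w' = z \<and>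
    map (\<lambda>y. y = x) w' = map (\<lambda>y. y = x) w"
  using step
proof
  assume "word_step i (filter (\<lambda>y. y \<noteq> x) w) z"
  then obtain u v where uv: "filter (\<lambda>y. y \<noteq> x) w = u @ arrow_src i # v" "z = u @ arrow_tgt i # v"
    "okL i u" "okR i v" unfolding word_step_def by blast
  from filter_split[OF uv(1)] obtain w1 w2 where w: "w = w1 @ arrow_src i # w2"
    "filter (\<lambda>y. y \<noteq> x) w1 = u" "filter (\<lambda>y. y \<noteq> x) w2 = v" by blast
  have "word_step i w (w1 @ arrow_tgt i # w2)"
    using uv(3,4) ok_filter[OF x] w unfolding word_step_def by blast
  then show ?thesis
    by (intro exI[of _ "w1 @ arrow_tgt i # w2"]) (use w uv x in auto)
next
  assume "word_step i z (filter (\<lambda>y. y \<noteq> x) w)"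
  then obtain u v where uv: "filter (\<lambda>y. y \<noteq> x) w = u @ arrow_tgt i # v" "z = u @ arrow_src i # v"
    "okL i u" "okR i v" unfolding word_step_def by blast
  from filter_split[OF uv(1)] obtain w1 w2 where w: "w = w1 @ arrow_tgt i # w2"
    "filter (\<lambda>y. y \<noteq> x) w1 = u" "filter (\<lambda>y. y \<noteq> x) w2 = v" by blast
  have "word_step i (w1 @ arrow_src i # w2) w"
    using uv(3,4) ok_filter[OF x] w unfolding word_step_def by blast
  then show ?thesis
    by (intro exI[of _ "w1 @ arrow_src i # w2"]) (use w uv x in auto)
qed

lemma word_connected_lift:
  assumes "word_connected m n (filter (\<lambda>y. y \<noteq> int (Suc n)) w) z"
  shows "\<exists>w'. word_connected m (Suc n) w w' \<and> filter (\<lambda>y. y \<noteq> int (Suc n)) w' = z \<and>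
    map (\<lambda>y. y = int (Suc n)) w' = map (\<lambda>y. y = int (Suc n)) w"
  using assms unfolding word_connected_def[of m n]
proof (induction rule: rtranclp_induct)
  case base
  then show ?case using word_connected_refl by blast
next
  case (step y z)
  then obtain w' i where w': "word_connected m (Suc n) w w'" "filter (\<lambda>y. y \<noteq> int (Suc n)) w' = y"
    "map (\<lambda>y. y = int (Suc n)) w' = map (\<lambda>y. y = int (Suc n)) w"
    and i: "i \<in> indices m n" "word_step i y z \<or> word_step i z y" by blast
  have i': "i \<in> indices m (Suc n)" and x: "int (Suc n) \<noteq> arrow_src i" "int (Suc n) \<noteq> arrow_tgt i"
    using i(1) by (auto simp: indices_def arrow_src_def arrow_tgt_def)
  obtain w'' where w'': "word_step i w' w'' \<or> word_step i w'' w'" "filter (\<lambda>y. y \<noteq> int (Suc n)) w'' = z"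
    "map (\<lambda>y. y = int (Suc n)) w'' = map (\<lambda>y. y = int (Suc n)) w'"
    using word_step_lift[OF x, of w' z] i(2) w'(2) by blast
  then show ?case
    using word_connected_trans[OF w'(1) word_connected_step[OF i' w''(1)]] w'(3) by metis
qed

text \<open>
  A word is determined by the places of one letter and the word that is left when the letter is
  dropped.
\<close>

lemma eq_if_filter_eq:
  "filter (\<lambda>y. y \<noteq> x) w = filter (\<lambda>y. y \<noteq> x) w' \<Longrightarrow> map (\<lambda>y. y = x) w = map (\<lambda>y. y = x) w' \<Longrightarrow> w = w'"
proof (induction w arbitrary: w')
  case (Cons a w)
  then show ?case by (cases w') (auto split: if_splits)
qed simp

lemma filter_reading:
  assumes "finite Y"
  shows "filter P (reading Y T) = reading {p \<in> Y. P (T p)} T"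
proof -
  have "filter (\<lambda>p. P (T p)) (reading_boxes Y) = reading_boxes {p \<in> Y. P (T p)}"
    using reading_boxes_sorted[of Y] reading_boxes_sorted[of "{p \<in> Y. P (T p)}"] assms
    by (intro sorted_wrt_before_unique) (simp_all add: sorted_wrt_filter set_reading_boxes)
  then show ?thesis by (simp add: reading_def filter_map comp_def)
qed

lemma young_diagram_sub:
  assumes Y: "young_diagram Y" and T: "semistandard m (Suc n) Y T"
  shows "young_diagram {p \<in> Y. T p \<noteq> int (Suc n)}"
  unfolding young_diagram_def
proof (intro conjI allI impI)
  show "finite {p \<in> Y. T p \<noteq> int (Suc n)}" using young_diagram_finite[OF Y] by simp
  fix r c r' c' assume p: "(r, c) \<in> {p \<in> Y. T p \<noteq> int (Suc n)}" and le: "r' \<le> r" "c' \<le> c"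
  have sst: "sst Y T" using T by (simp add: semistandard_iff)
  have Z: "(r', c') \<in> Y" "(r', c) \<in> Y" using young_diagramD[OF Y, of r c] p le by auto
  have "T (r', c') \<le> T (r', c)" using sst_row_le[OF sst Z] le by (cases "c' = c") auto
  also have "\<dots> \<le> T (r, c)" using sst_col_le[OF sst Z(2), of r] p le by (cases "r' = r") auto
  also have "\<dots> < int (Suc n)"
    using semistandard_letters[OF T, of "(r, c)"] p by (auto simp: letters_def Bplus_def Bminus_def)
  finally show "(r', c') \<in> {p \<in> Y. T p \<noteq> int (Suc n)}" using Z by simp
qed

lemma sstI:
  assumes "\<And>p. p \<in> Y \<Longrightarrow> T p \<noteq> 0"
    and "\<And>r c c'. (r, c) \<in> Y \<Longrightarrow> (r, c') \<in> Y \<Longrightarrow> c < c' \<Longrightarrow> row_rel (T (r, c)) (T (r, c'))"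
    and "\<And>r r' c. (r, c) \<in> Y \<Longrightarrow> (r', c) \<in> Y \<Longrightarrow> r < r' \<Longrightarrow> col_rel (T (r, c)) (T (r', c))"
  shows "sst Y T"
  unfolding sst_def by (intro conjI ballI allI impI; rule assms; assumption)

lemma sst_subset:
  assumes "sst Y T" "\<mu> \<subseteq> Y"
  shows "sst \<mu> T"
proof (rule sstI)
  show "T p \<noteq> 0" if "p \<in> \<mu>" for p
    using sst_nonzero[OF assms(1) subsetD[OF assms(2) that]] .
  show "row_rel (T (r, c)) (T (r, c'))" if "(r, c) \<in> \<mu>" "(r, c') \<in> \<mu>" "c < c'" for r c c'
    using sst_row[OF assms(1) subsetD[OF assms(2) that(1)] subsetD[OF assms(2) that(2)] that(3)] .
  show "col_rel (T (r, c)) (T (r', c))" if "(r, c) \<in> \<mu>" "(r', c) \<in> \<mu>" "r < r'" for r r' c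
    using sst_col[OF assms(1) subsetD[OF assms(2) that(1)] subsetD[OF assms(2) that(2)] that(3)] .
qed

lemma semistandard_sub:
  assumes "semistandard m (Suc n) Y T" "\<mu> \<subseteq> Y" "\<And>p. p \<in> \<mu> \<Longrightarrow> T p \<noteq> int (Suc n)"
  shows "semistandard m n \<mu> T"
proof -
  have "T p \<in> letters m n" if "p \<in> \<mu>" for p
  proof -
    have "T p \<in> letters m (Suc n)" using semistandard_letters[OF assms(1)] assms(2) that by blast
    then show ?thesis using assms(3)[OF that] by (auto simp: letters_def Bminus_def)
  qed
  moreover have "sst \<mu> T"
    using sst_subset[OF _ assms(2)] assms(1) by (simp add: semistandard_iff)
  ultimately show ?thesis unfolding semistandard_iff by blast
qed

text \<open>
  Two tableaux with their largest letters \<open>n + 1\<close> in the same boxes are connected if this holds for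
  tableaux in the smaller letters, since the remaining boxes form a Young diagram.
\<close>

lemma word_connected_same_top:
  assumes IH: "\<And>\<mu> T S. young_diagram \<mu> \<Longrightarrow> semistandard m n \<mu> T \<Longrightarrow> semistandard m n \<mu> S \<Longrightarrow>
      word_connected m n (reading \<mu> T) (reading \<mu> S)"
    and Y: "young_diagram Y" and T: "semistandard m (Suc n) Y T" and S: "semistandard m (Suc n) Y S"
    and top: "\<And>p. p \<in> Y \<Longrightarrow> T p = int (Suc n) \<longleftrightarrow> S p = int (Suc n)"
  shows "word_connected m (Suc n) (reading Y T) (reading Y S)"
proof -
  let ?N = "int (Suc n)"
  note fin = young_diagram_finite[OF Y]
  let ?\<mu> = "{p \<in> Y. T p \<noteq> ?N}"
  have \<mu>S: "?\<mu> = {p \<in> Y. S p \<noteq> ?N}" using top by blast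
  have "word_connected m n (reading ?\<mu> T) (reading ?\<mu> S)"
  proof (rule IH)
    show "young_diagram ?\<mu>" by (rule young_diagram_sub[OF Y T])
    show "semistandard m n ?\<mu> T" by (rule semistandard_sub[OF T]) auto
    show "semistandard m n ?\<mu> S" unfolding \<mu>S by (rule semistandard_sub[OF S]) auto
  qed
  then have "word_connected m n (filter (\<lambda>y. y \<noteq> ?N) (reading Y T)) (filter (\<lambda>y. y \<noteq> ?N) (reading Y S))"
    unfolding filter_reading[OF fin] \<mu>S .
  from word_connected_lift[OF this] obtain w' where w': "word_connected m (Suc n) (reading Y T) w'"
    "filter (\<lambda>y. y \<noteq> ?N) w' = filter (\<lambda>y. y \<noteq> ?N) (reading Y S)"
    "map (\<lambda>y. y = ?N) w' = map (\<lambda>y. y = ?N) (reading Y T)" by blast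
  have "map (\<lambda>y. y = ?N) (reading Y T) = map (\<lambda>y. y = ?N) (reading Y S)"
    using top set_reading_boxes[OF fin] by (simp add: reading_def)
  then have "w' = reading Y S" using eq_if_filter_eq w'(2,3) by metis
  then show ?thesis using w'(1) by simp
qed

definition row_end :: "(nat \<times> nat) set \<Rightarrow> nat \<times> nat \<Rightarrow> bool" where
  "row_end Y p \<longleftrightarrow> p \<in> Y \<and> (fst p, Suc (snd p)) \<notin> Y"

text \<open>
  In the subdiagram of the smaller letters, the largest of these may be written at the end of every
  row: below a row end there are only row ends.
\<close>

lemma semistandard_fill_row_ends:
  assumes n: "n \<ge> 1" and Y: "young_diagram Y" and T: "semistandard m (Suc n) Y T"
  defines "\<mu> \<equiv> {p \<in> Y. T p \<noteq> int (Suc n)}"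
  shows "semistandard m (Suc n) Y (\<lambda>p. if row_end \<mu> p then int n else T p)" (is "semistandard _ _ _ ?T")
proof -
  have sst: "sst Y T" using T by (simp add: semistandard_iff)
  have y\<mu>: "young_diagram \<mu>" unfolding \<mu>_def by (rule young_diagram_sub[OF Y T])
  have out: "T p = int (Suc n)" if "p \<in> Y" "p \<notin> \<mu>" for p using that by (simp add: \<mu>_def)
  have inn: "T p \<le> int n" if "p \<in> \<mu>" for p
    using that semistandard_letters[OF T, of p] by (auto simp: \<mu>_def letters_def Bplus_def Bminus_def)
  have letT: "?T p \<in> letters m (Suc n)" if "p \<in> Y" for p
    using semistandard_letters[OF T that] n by (auto simp: letters_def Bminus_def)
  have \<mu>Y: "p \<in> Y" if "p \<in> \<mu>" for p using that by (simp add: \<mu>_def)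
  have row: "row_rel (?T (r, c)) (?T (r, c'))" if p: "(r, c) \<in> Y" and q: "(r, c') \<in> Y" and cc: "c < c'" for r c c'
  proof (cases "row_end \<mu> (r, c)")
    case True
    then have "(r, c') \<notin> \<mu>" using young_diagramD[OF y\<mu>, of r c' r "Suc c"] cc by (auto simp: row_end_def)
    then have "?T (r, c') = int (Suc n)" using out[OF q] by (simp add: row_end_def)
    then show ?thesis using True less_col_row(2)[of "int n" "int (Suc n)"] by simp
  next
    case nend: False
    show ?thesis
    proof (cases "row_end \<mu> (r, c')")
      case True
      then have "T (r, c') \<le> int n" using inn by (simp add: row_end_def)
      then have "T (r, c) < int n"
        using sst_row_le[OF sst p q cc] sst_row_less[OF sst p q cc] n by linarith
      then show ?thesis using True nend less_col_row(2)[of "T (r, c)" "int n"] by simp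
    next
      case False
      then show ?thesis using nend sst_row[OF sst p q cc] by simp
    qed
  qed
  have col: "col_rel (?T (r, c)) (?T (r', c))" if p: "(r, c) \<in> Y" and q: "(r', c) \<in> Y" and rr: "r < r'" for r r' c
  proof (cases "row_end \<mu> (r', c)")
    case True
    then have "T (r', c) \<le> int n" using inn by (simp add: row_end_def)
    then have "?T (r, c) \<le> int n" using sst_col_le[OF sst p q rr] by simp
    then show ?thesis using True n rel_weak(4)[of "?T (r, c)" "int n"] by simp
  next
    case nend: False
    show ?thesis
    proof (cases "row_end \<mu> (r, c)")
      case True
      have "(r', c) \<notin> \<mu>"
      proof
        assume "(r', c) \<in> \<mu>"
        then have "(r', Suc c) \<in> \<mu>" using nend by (simp add: row_end_def)
        then have "(r, Suc c) \<in> \<mu>" using young_diagramD[OF y\<mu>] rr by simp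
        then show False using True by (simp add: row_end_def)
      qed
      then have "T (r', c) = int (Suc n)" using out q by blast
      then show ?thesis using True nend less_col_row(1)[of "int n" "int (Suc n)"] by simp
    next
      case False
      then show ?thesis using nend sst_col[OF sst p q rr] by simp
    qed
  qed
  have "?T p \<noteq> 0" if "p \<in> Y" for p using sst_nonzero[OF sst that] n by simp
  then have "sst Y ?T" using row col by (rule sstI)
  then show ?thesis using letT unfolding semistandard_iff by blast
qed

text \<open>
  After this change \<open>f\<^sub>n\<close> applies, provided some row end \<open>(r\<^sub>0, c\<^sub>0)\<close> of the whole diagram does not yet
  contain \<open>n + 1\<close>. Among the boxes read up to this one, every \<open>n + 1\<close> lies in a higher row and further
  to the right, and hence has an \<open>n\<close> as left neighbour that is also read; the box \<open>(r\<^sub>0, c\<^sub>0)\<close> provides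
  one \<open>n\<close> more. So not all of these letters \<open>n\<close> are cancelled.
\<close>

lemma lower_row_end:
  assumes n: "n \<ge> 1" and Y: "young_diagram Y" and T: "semistandard m (Suc n) Y T"
    and q: "row_end Y (r0, c0)" "T (r0, c0) \<noteq> int (Suc n)"
  defines "\<mu> \<equiv> {p \<in> Y. T p \<noteq> int (Suc n)}"
  shows "\<exists>z. word_step (int n) (reading Y (\<lambda>p. if row_end \<mu> p then int n else T p)) z"
proof -
  let ?T = "\<lambda>p. if row_end \<mu> p then int n else T p"
  let ?N = "int (Suc n)"
  note fin = young_diagram_finite[OF Y]
  have sst: "sst Y T" using T by (simp add: semistandard_iff)
  have qY: "(r0, c0) \<in> Y" "(r0, Suc c0) \<notin> Y" using q(1) by (auto simp: row_end_def)
  have arrows: "arrow_src (int n) = int n" "arrow_tgt (int n) = ?N"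
    using n by (auto simp: arrow_src_def arrow_tgt_def)
  obtain A B where AB: "reading_boxes Y = A @ (r0, c0) # B"
    using qY(1) set_reading_boxes[OF fin] split_list by metis
  define P where "P = {b \<in> Y. b = (r0, c0) \<or> before b (r0, c0)}"
  have P: "P = set (A @ [(r0, c0)])"
    using reading_boxes_split(2)[OF fin AB] qY(1) by (auto simp: P_def)
  have finP: "finite P" using fin by (simp add: P_def)
  have "sorted_wrt before ((A @ [(r0, c0)]) @ B)" using reading_boxes_sorted[of Y] AB by simp
  then have dist: "distinct (A @ [(r0, c0)])"
    using sorted_wrt_before_distinct sorted_wrt_append by blast
  let ?top = "{b \<in> P. ?T b = ?N}" and ?second = "{b \<in> P. ?T b = int n}"
  \<comment> \<open>the passage to the left neighbour; \<open>c > 0\<close> for all boxes to which it is applied\<close>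
  let ?g = "\<lambda>(r::nat, c::nat). (r, c - 1)"
  have top: "r < r0 \<and> c0 < c" if b: "(r, c) \<in> ?top" for r c
  proof -
    have bY: "(r, c) \<in> Y" and bT: "T (r, c) = ?N" and bq: "(r, c) = (r0, c0) \<or> before (r, c) (r0, c0)"
      using b by (auto simp: P_def split: if_splits)
    have bq': "before (r, c) (r0, c0)" using bq bT q(2) by auto
    show ?thesis
    proof (cases "c = c0")
      case True
      then have "r < r0" using bq' by (simp add: before_def)
      then have "?N \<le> T (r0, c0)" using sst_col_le[OF sst, of r c0 r0] bY qY(1) bT True by simp
      then have False
        using semistandard_letters[OF T qY(1)] q(2) by (auto simp: letters_def Bplus_def Bminus_def)
      then show ?thesis ..
    next
      case False
      then have c: "c0 < c" using bq' by (simp add: before_def)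
      have "r < r0"
      proof (rule ccontr)
        assume "\<not> r < r0"
        then have "(r0, Suc c0) \<in> Y" using young_diagramD[OF Y bY] c by simp
        then show False using qY(2) by blast
      qed
      then show ?thesis using c by blast
    qed
  qed
  have "?g ` ?top \<subseteq> ?second - {(r0, c0)}"
  proof
    fix b assume "b \<in> ?g ` ?top"
    then obtain r c where rc: "(r, c) \<in> ?top" "b = (r, c - 1)" by auto
    note rt = top[OF rc(1)]
    then obtain k where k: "c = Suc k" by (cases c) auto
    have bY: "(r, c) \<in> Y" and bT: "T (r, c) = ?N" using rc(1) by (auto simp: P_def split: if_splits)
    have kY: "(r, k) \<in> Y" using young_diagramD[OF Y bY] k by simp
    have "T (r, k) < ?N" using sst_row_less[OF sst kY bY] k bT by simp
    then have "row_end \<mu> (r, k)" using kY bT k by (simp add: row_end_def \<mu>_def)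
    moreover have "(r, k) \<in> P" "(r, k) \<noteq> (r0, c0)"
      using rt kY k by (auto simp: P_def before_def)
    ultimately show "b \<in> ?second - {(r0, c0)}" using rc(2) k by simp
  qed
  then have "card (?g ` ?top) \<le> card (?second - {(r0, c0)})"
    using finP by (intro card_mono) auto
  moreover have "inj_on ?g ?top"
  proof (rule inj_onI)
    fix a b assume ab: "a \<in> ?top" "b \<in> ?top" "?g a = ?g b"
    obtain r c r' c' where "a = (r, c)" "b = (r', c')" by force
    then show "a = b" using ab top[of r c] top[of r' c'] by auto
  qed
  moreover have "(r0, c0) \<in> ?second"
    using qY q(2) by (auto simp: P_def row_end_def \<mu>_def)
  ultimately have "card ?top < card ?second"
    using finP card_Diff1_less[of ?second "(r0, c0)"] by (simp add: card_image)
  then have "count_list (map ?T (A @ [(r0, c0)])) ?N < count_list (map ?T (A @ [(r0, c0)])) (int n)"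
    unfolding count_list_map[OF dist] P .
  then have "phi_w (int n) (map ?T (A @ [(r0, c0)])) > 0"
    using eps_phi_count[of "int n" "map ?T (A @ [(r0, c0)])"] n unfolding arrows by linarith
  moreover have "reading Y ?T = map ?T (A @ [(r0, c0)]) @ map ?T B"
    by (simp add: reading_def AB)
  ultimately have "phi_w (int n) (reading Y ?T) > 0"
    using n by (simp add: phi_w_append del: map_append)
  then show ?thesis by (rule word_step_phi_exists)
qed

lemma word_connected_row_ends:
  assumes IH: "\<And>\<mu> T S. young_diagram \<mu> \<Longrightarrow> semistandard m n \<mu> T \<Longrightarrow> semistandard m n \<mu> S \<Longrightarrow>
      word_connected m n (reading \<mu> T) (reading \<mu> S)"
    and n: "n \<ge> 1" and Y: "young_diagram Y" and T: "semistandard m (Suc n) Y T"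
  shows "\<exists>S. semistandard m (Suc n) Y S \<and> word_connected m (Suc n) (reading Y T) (reading Y S) \<and>
    (\<forall>p. row_end Y p \<longrightarrow> S p = int (Suc n))"
  using T
proof (induction "length (filter (\<lambda>y. y \<noteq> int (Suc n)) (reading Y T))" arbitrary: T rule: less_induct)
  case less
  let ?N = "int (Suc n)"
  note fin = young_diagram_finite[OF Y]
  show ?case
  proof (cases "\<forall>p. row_end Y p \<longrightarrow> T p = ?N")
    case True
    then show ?thesis using less.prems word_connected_refl by blast
  next
    case False
    then obtain r0 c0 where q: "row_end Y (r0, c0)" "T (r0, c0) \<noteq> ?N" by auto
    define T' where "T' = (\<lambda>p. if row_end {p \<in> Y. T p \<noteq> ?N} p then int n else T p)"
    have T': "semistandard m (Suc n) Y T'"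
      unfolding T'_def by (rule semistandard_fill_row_ends[OF n Y less.prems])
    have same: "T p = ?N \<longleftrightarrow> T' p = ?N" if "p \<in> Y" for p
      unfolding T'_def by (auto simp: row_end_def)
    have conn: "word_connected m (Suc n) (reading Y T) (reading Y T')"
      by (rule word_connected_same_top[OF IH Y less.prems T' same])
    obtain z where z: "word_step (int n) (reading Y T') z"
      using lower_row_end[OF n Y less.prems q] unfolding T'_def by blast
    have i: "int n \<in> indices m (Suc n)" using n by (simp add: indices_def)
    obtain S where S: "semistandard m (Suc n) Y S" "z = reading Y S"
      using semistandard_step[OF fin young_diagram_convex[OF Y] T' i] z by blast
    have arrows: "arrow_src (int n) = int n" "arrow_tgt (int n) = ?N"
      using n by (auto simp: arrow_src_def arrow_tgt_def)
    have "length (filter (\<lambda>y. y \<noteq> ?N) z) < length (filter (\<lambda>y. y \<noteq> ?N) (reading Y T'))"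
      using z unfolding word_step_def arrows by auto
    also have "\<dots> = length (filter (\<lambda>y. y \<noteq> ?N) (reading Y T))"
    proof -
      have "{p \<in> Y. T' p \<noteq> ?N} = {p \<in> Y. T p \<noteq> ?N}" using same by blast
      then show ?thesis unfolding filter_reading[OF fin] using fin by (simp add: length_reading)
    qed
    finally obtain S' where S': "semistandard m (Suc n) Y S'"
      "word_connected m (Suc n) (reading Y S) (reading Y S')" "\<forall>p. row_end Y p \<longrightarrow> S' p = ?N"
      using less.hyps[of S] S by blast
    have "word_connected m (Suc n) (reading Y T') (reading Y S)"
      using word_connected_step[OF i] z S(2) by blast
    then show ?thesis using S' conn word_connected_trans by blast
  qed
qed

text \<open>
  The crystals of the smaller alphabet allow the change of row ends without leaving the connected
  component, and \<open>f\<^sub>n\<close> then adds a letter \<open>n + 1\<close>. After finitely many rounds the letters \<open>n + 1\<close> fill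
  exactly the row ends. These boxes depend on the diagram only, so any two tableaux can be compared by
  the induction hypothesis once more.
\<close>

theorem tableaux_connected:
  assumes "n \<ge> 1" "young_diagram Y" "semistandard m n Y T" "semistandard m n Y S"
  shows "word_connected m n (reading Y T) (reading Y S)"
  using assms
proof (induction n arbitrary: Y T S rule: nat_induct_at_least)
  case base
  show ?case
    using word_connected_trans[OF word_connected_genuine_highest[OF base(1,2)]
        word_connected_sym[OF word_connected_genuine_highest[OF base(1,3)]]] .
next
  case (Suc n)
  let ?N = "int (Suc n)"
  note IH = Suc.IH
  obtain T' where T': "semistandard m (Suc n) Y T'"
    "word_connected m (Suc n) (reading Y T) (reading Y T')" "\<forall>p. row_end Y p \<longrightarrow> T' p = ?N"
    using word_connected_row_ends[OF IH Suc.hyps Suc.prems(1,2)] by blast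
  obtain S' where S': "semistandard m (Suc n) Y S'"
    "word_connected m (Suc n) (reading Y S) (reading Y S')" "\<forall>p. row_end Y p \<longrightarrow> S' p = ?N"
    using word_connected_row_ends[OF IH Suc.hyps Suc.prems(1,3)] by blast
  have ends: "U p = ?N \<longleftrightarrow> row_end Y p"
    if U: "semistandard m (Suc n) Y U" "\<forall>p. row_end Y p \<longrightarrow> U p = ?N" and p: "p \<in> Y" for U p
  proof
    assume Up: "U p = ?N"
    obtain r c where rc: "p = (r, c)" by force
    show "row_end Y p"
    proof (rule ccontr)
      assume "\<not> row_end Y p"
      then have "(r, Suc c) \<in> Y" using p by (simp add: row_end_def rc)
      moreover have "sst Y U" using U(1) by (simp add: semistandard_iff)
      ultimately have "?N < U (r, Suc c)"
        using sst_row_less[of Y U r c "Suc c"] p Up by (simp add: rc)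
      then show False
        using semistandard_letters[OF U(1) \<open>(r, Suc c) \<in> Y\<close>]
        by (auto simp: letters_def Bplus_def Bminus_def)
    qed
  qed (use U(2) in blast)
  have "word_connected m (Suc n) (reading Y T') (reading Y S')"
    using ends[OF T'(1,3)] ends[OF S'(1,3)]
    by (intro word_connected_same_top[OF IH Suc.prems(1) T'(1) S'(1)]) blast+
  then show ?case
    using T'(2) S'(2) word_connected_sym word_connected_trans by blast
qed

section \<open>Components of tensor products\<close>

lemma word_step_unique:
  assumes "i \<in> indices m n"
  shows "word_step i w z \<Longrightarrow> word_step i w z' \<Longrightarrow> z = z'"
    and "word_step i z w \<Longrightarrow> word_step i z' w \<Longrightarrow> z = z'"
proof -
  have R: "realizes m n {v. length v = length w} (\<lambda>v. v) (length w) (tensor_power m n (length w))"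
    by (rule realizes_tensor_power)
  show "z = z'" if "word_step i w z" "word_step i w z'"
  proof -
    have "ff (tensor_power m n (length w)) i w = Some z" "ff (tensor_power m n (length w)) i w = Some z'"
      using realizes_ff[OF R, of w i] assms that word_step_length[OF that(1)] word_step_length[OF that(2)]
      by simp_all
    then show ?thesis by simp
  qed
  show "z = z'" if "word_step i z w" "word_step i z' w"
  proof -
    have "ee (tensor_power m n (length w)) i w = Some z" "ee (tensor_power m n (length w)) i w = Some z'"
      using realizes_ee[OF R, of w i] assms that word_step_length[OF that(1)] word_step_length[OF that(2)]
      by simp_all
    then show ?thesis by simp
  qed
qed

text \<open>
  The image of a stable set is stable as well: the values of \<open>\<phi>\<^sub>i\<close> and \<open>\<epsilon>\<^sub>i\<close> tell that there is an arrow
  before \<open>\<psi>\<close> is applied, and an arrow is determined by its start, and by its end.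
\<close>

lemma transport_step_back:
  assumes i: "i \<in> indices m n" and U: "transport U \<psi>" "u \<in> U"
  shows "word_step i (\<psi> u) z \<Longrightarrow> \<exists>u'. word_step i u u' \<and> z = \<psi> u'"
    and "word_step i z (\<psi> u) \<Longrightarrow> \<exists>u'. word_step i u' u \<and> z = \<psi> u'"
proof -
  note tr = transportD[OF U]
  show "\<exists>u'. word_step i u u' \<and> z = \<psi> u'" if z: "word_step i (\<psi> u) z"
  proof -
    have "phi_w i u > 0" using word_step_eps_phi(1)[OF z] tr(5) by simp
    then obtain u' where u': "word_step i u u'" using word_step_phi_exists by blast
    then show ?thesis using tr(7)[OF u'] z word_step_unique(1)[OF i] by blast
  qed
  show "\<exists>u'. word_step i u' u \<and> z = \<psi> u'" if z: "word_step i z (\<psi> u)"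
  proof -
    have "eps_w i u > 0" using word_step_eps_phi(2)[OF z] tr(4) by simp
    then obtain u' where u': "word_step i u' u" using word_step_eps_exists by blast
    then show ?thesis using tr(9)[OF u'] z word_step_unique(2)[OF i] by blast
  qed
qed

lemma row_adjacent_trans: "row_adjacent c d \<Longrightarrow> row_adjacent d e \<Longrightarrow> row_adjacent c e"
  unfolding row_adjacent_def
proof (intro conjI allI impI; elim conjE)
  fix j
  assume "length d \<le> length c" "length e \<le> length d" "j < length e"
    "\<forall>j<length d. row_rel (c ! j) (d ! j)" "\<forall>j<length e. row_rel (d ! j) (e ! j)"
  then have "row_rel (c ! j) (d ! j)" "row_rel (d ! j) (e ! j)" by auto
  then show "row_rel (c ! j) (e ! j)" by (rule row_col_trans(1))
qed linarith

lemma tableau_cols_sorted: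
  "tableau_cols cs \<Longrightarrow> sorted_wrt row_adjacent cs \<and> (\<forall>c\<in>set cs. sorted_wrt col_rel c \<and> c \<noteq> [])"
proof (induction cs)
  case (Cons c cs)
  have IH: "sorted_wrt row_adjacent cs" "\<forall>c\<in>set cs. sorted_wrt col_rel c \<and> c \<noteq> []"
    and c: "sorted_wrt col_rel c" "c \<noteq> []" "cs \<noteq> [] \<longrightarrow> row_adjacent c (hd cs)"
    using Cons by simp_all
  have "row_adjacent c d" if d: "d \<in> set cs" for d
  proof -
    obtain e es where es: "cs = e # es" using d by (cases cs) auto
    have "d = e \<or> row_adjacent e d" using IH(1) d es by auto
    moreover have "row_adjacent c e" using c(3) es by simp
    ultimately show ?thesis using row_adjacent_trans by blast
  qed
  then show ?case using IH c by simp
qed simp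

definition cols_shape :: "int list list \<Rightarrow> (nat \<times> nat) set" where
  "cols_shape cs = {(r, c). c < length cs \<and> r < length (cs ! c)}"

definition cols_filling :: "int list list \<Rightarrow> nat \<times> nat \<Rightarrow> int" where
  "cols_filling cs = (\<lambda>(r, c). cs ! c ! r)"

lemma reading_cols:
  "finite (cols_shape cs)" "reading (cols_shape cs) (cols_filling cs) = concat (rev cs)"
proof -
  let ?L = "concat (map (\<lambda>c. map (\<lambda>r. (r, c)) [0..<length (cs ! c)]) (rev [0..<length cs]))"
  have set: "set ?L = cols_shape cs" by (auto simp: cols_shape_def)
  then show fin: "finite (cols_shape cs)" by (metis List.finite_set)
  have "sorted_wrt before ?L"
    by (rule sorted_wrt_before_concat) (simp_all add: sorted_wrt_rev)
  then have "reading_boxes (cols_shape cs) = ?L"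
    using reading_boxes_sorted set set_reading_boxes[OF fin] by (intro sorted_wrt_before_unique) auto
  then have "reading (cols_shape cs) (cols_filling cs) =
      concat (map (\<lambda>c. map (\<lambda>r. cs ! c ! r) [0..<length (cs ! c)]) (rev [0..<length cs]))"
    by (simp add: reading_def map_concat comp_def cols_filling_def)
  also have "\<dots> = concat (map (\<lambda>c. cs ! c) (rev [0..<length cs]))"
    by (simp add: map_nth)
  also have "\<dots> = concat (rev cs)" by (simp add: rev_map[symmetric] map_nth)
  finally show "reading (cols_shape cs) (cols_filling cs) = concat (rev cs)" .
qed

lemma tableau_cols_sst:
  assumes cs: "tableau_cols cs" and nz: "0 \<notin> set (concat (rev cs))"
  shows "young_diagram (cols_shape cs)" "sst (cols_shape cs) (cols_filling cs)"
proof -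
  have adj: "row_adjacent (cs ! c) (cs ! c')" if "c < c'" "c' < length cs" for c c'
    using tableau_cols_sorted[OF cs] that sorted_wrt_nth_less by blast
  have col: "sorted_wrt col_rel (cs ! c)" if "c < length cs" for c
    using tableau_cols_sorted[OF cs] that by simp
  show "young_diagram (cols_shape cs)"
    unfolding young_diagram_def
  proof (intro conjI allI impI)
    fix r c r' c' assume "(r, c) \<in> cols_shape cs" "r' \<le> r" "c' \<le> c"
    moreover from this have "length (cs ! c) \<le> length (cs ! c')"
      using adj[of c' c] by (cases "c' = c") (auto simp: row_adjacent_def cols_shape_def)
    ultimately show "(r', c') \<in> cols_shape cs" by (auto simp: cols_shape_def)
  qed (rule reading_cols)
  show "sst (cols_shape cs) (cols_filling cs)"
  proof (rule sstI)
    show "cols_filling cs p \<noteq> 0" if shape: "p \<in> cols_shape cs" for p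
    proof -
      obtain r c where p: "p = (r, c)" "c < length cs" "r < length (cs ! c)"
        using shape by (auto simp: cols_shape_def)
      then have "cs ! c ! r \<in> set (concat (rev cs))" by (auto intro!: bexI[of _ "cs ! c"])
      then show ?thesis using nz p by (auto simp: cols_filling_def)
    qed
    show "row_rel (cols_filling cs (r, c)) (cols_filling cs (r, c'))"
      if "(r, c) \<in> cols_shape cs" "(r, c') \<in> cols_shape cs" "c < c'" for r c c'
      using adj[of c c'] that by (auto simp: row_adjacent_def cols_shape_def cols_filling_def)
    show "col_rel (cols_filling cs (r, c)) (cols_filling cs (r', c))"
      if "(r, c) \<in> cols_shape cs" "(r', c) \<in> cols_shape cs" "r < r'" for r r' c
      using sorted_wrt_nth_less[OF col, of c r r'] that by (auto simp: cols_shape_def cols_filling_def)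
  qed
qed

text \<open>
  Row \<open>m\<close>, counted from \<open>0\<close>, lies below \<open>m\<close> further rows and hence contains only unbarred letters, which
  increase strictly along a row.
\<close>

lemma semistandard_hook:
  assumes Y: "young_diagram Y" and T: "semistandard m n Y T"
  shows "hook_young_diagram m n Y"
proof -
  have sst: "sst Y T" using T by (simp add: semistandard_iff)
  have bounds: "- int m \<le> T p \<and> T p \<noteq> 0 \<and> T p \<le> int n" if "p \<in> Y" for p
    using semistandard_letters[OF T that] by (auto simp: letters_def Bplus_def Bminus_def)
  have pos: "0 < T (m, c)" if "(m, c) \<in> Y" for c
    using sst_row_bound[OF Y sst _ that] bounds[OF that] bounds by force
  have "inj_on (\<lambda>c. T (m, c)) {c. (m, c) \<in> Y}"
  proof (rule inj_onI)
    fix c c' assume c: "c \<in> {c. (m, c) \<in> Y}" "c' \<in> {c. (m, c) \<in> Y}" and eq: "T (m, c) = T (m, c')"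
    show "c = c'"
      using sst_row_less[OF sst, of m c c'] sst_row_less[OF sst, of m c' c] c pos eq
      by (cases c c' rule: linorder_cases) auto
  qed
  moreover have "(\<lambda>c. T (m, c)) ` {c. (m, c) \<in> Y} \<subseteq> {1..int n}" using pos bounds by force
  ultimately have "card {c. (m, c) \<in> Y} \<le> card {1..int n}" by (intro card_inj_on_le) auto
  then show ?thesis using Y by (simp add: hook_young_diagram_def)
qed

text \<open>
  Column insertion of one word of the component yields an isomorphism \<open>\<psi>\<close> that is defined on the whole
  component and maps this word to a tableau. Since tableaux of the shape found are stable under the
  operators, \<open>\<psi>\<close> maps the component into them, and since they are connected, onto them.
\<close>

lemma component_isomorphic_tableau_crystal:
  assumes n: "n \<ge> 1" and R: "realizes m n D h k C" and elts: "elts C \<subseteq> D"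
    and letters: "\<And>a. a \<in> elts C \<Longrightarrow> set (h a) \<subseteq> letters m n"
    and stable: "\<And>i a a'. i \<in> indices m n \<Longrightarrow> a \<in> elts C \<Longrightarrow> a' \<in> D \<Longrightarrow>
      word_step i (h a) (h a') \<or> word_step i (h a') (h a) \<Longrightarrow> a' \<in> elts C"
    and K: "K \<in> connected_components m n C"
  shows "\<exists>Y. hook_young_diagram m n Y \<and> card Y = k \<and> crystal_isomorphic m n K (tableau_crystal m n Y)"
proof -
  let ?R = "(crystal_edges m n C \<union> (crystal_edges m n C)\<inverse>)\<^sup>*"
  obtain S where KS: "K = C\<lparr>elts := S\<rparr>" "S \<in> elts C // ?R"
    using K unfolding connected_components_def by blast
  obtain a0 where a0: "a0 \<in> elts C" "S = ?R `` {a0}" using KS(2) by (rule quotientE)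
  have a0D: "a0 \<in> D" using a0(1) elts by blast
  have nz: "0 \<notin> set (h a0)" using letters[OF a0(1)] by (auto simp: letters_def Bplus_def Bminus_def)
  obtain cs where cs: "tableau_cols cs" "word_equiv (h a0) (concat (rev cs))"
    using word_equiv_tableau_cols[OF nz] by blast
  obtain U \<psi> where U: "transport U \<psi>" "h a0 \<in> U" "\<psi> (h a0) = concat (rev cs)"
    using cs(2) unfolding word_equiv_def by blast
  define Y where "Y = cols_shape cs"
  define T where "T = cols_filling cs"
  have fin: "finite Y" and rd: "reading Y T = \<psi> (h a0)"
    using reading_cols U(3) by (simp_all add: Y_def T_def)
  have set_rd: "set (reading Y T) = set (h a0)"
    unfolding rd using transportD(2)[OF U(1,2)] by (metis set_mset_mset)
  then have "0 \<notin> set (concat (rev cs))" using nz rd U(3) by simp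
  note tab = tableau_cols_sst[OF cs(1) this, folded Y_def T_def]
  have T: "semistandard m n Y T"
    unfolding semistandard_iff using tab(2) set_rd letters[OF a0(1)] set_reading[OF fin, of T] by blast
  note conv = young_diagram_convex[OF tab(1)]
  have card: "card Y = k"
    using length_reading[OF fin, of T] rd transportD(3)[OF U(1,2)] realizes_length[OF R a0D] by simp
  have edge: "a' \<in> S" if "a \<in> S" "i \<in> indices m n" "a' \<in> D" "a \<in> elts C"
      "word_step i (h a) (h a') \<or> word_step i (h a') (h a)" for a a' i
  proof -
    have aD: "a \<in> D" using that(4) elts by blast
    have a': "a' \<in> elts C" using stable that by blast
    have "ff C i a = Some a' \<or> ff C i a' = Some a"
      using that realizes_ff[OF R] aD by blast
    then have "(a, a') \<in> crystal_edges m n C \<union> (crystal_edges m n C)\<inverse>"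
      using that(2,4) a' unfolding crystal_edges_def by blast
    then show ?thesis using that(1) unfolding a0(2) by (meson Image_singleton_iff rtrancl.rtrancl_into_rtrancl)
  qed
  have inS: "a \<in> elts C \<and> h a \<in> U \<and> (\<exists>T'. semistandard m n Y T' \<and> \<psi> (h a) = reading Y T')"
    if "a \<in> S" for a
  proof -
    have "(a0, a) \<in> ?R" using that a0(2) by blast
    then show ?thesis
    proof (induction rule: rtrancl_induct)
      case base
      then show ?case using a0(1) U(2) T rd by metis
    next
      case (step a b)
      then obtain i T' where i: "i \<in> indices m n" "a \<in> elts C" "b \<in> elts C"
        "ff C i a = Some b \<or> ff C i b = Some a"
        and a: "h a \<in> U" "semistandard m n Y T'" "\<psi> (h a) = reading Y T'"
        unfolding crystal_edges_def by blast
      have st: "word_step i (h a) (h b) \<or> word_step i (h b) (h a)"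
        using i(2-4) elts realizes_ff[OF R] by blast
      then have "h b \<in> U" "word_step i (\<psi> (h a)) (\<psi> (h b)) \<or> word_step i (\<psi> (h b)) (\<psi> (h a))"
        using transportD(6-9)[OF U(1) a(1)] by blast+
      then show ?case using semistandard_step[OF fin conv a(2) i(1)] a(3) i(3) by metis
    qed
  qed
  have a0S: "a0 \<in> S" using a0(2) by blast
  \<comment> \<open>a path that starts at the tableau \<open>T\<close> is pulled back step by step along \<open>\<psi>\<close>\<close>
  have surj: "\<exists>a\<in>S. \<psi> (h a) = z" if "word_connected m n (reading Y T) z" for z
    using that unfolding word_connected_def
  proof (induction rule: rtranclp_induct)
    case base
    then show ?case using a0S rd by metis
  next
    case (step y z)
    then obtain a i where a: "a \<in> S" "\<psi> (h a) = y" and i: "i \<in> indices m n"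
      "word_step i (\<psi> (h a)) z \<or> word_step i z (\<psi> (h a))" by blast
    have aC: "a \<in> elts C" and aU: "h a \<in> U" using inS[OF a(1)] by blast+
    obtain u' where u': "word_step i (h a) u' \<or> word_step i u' (h a)" "z = \<psi> u'"
      using i(2) transport_step_back[OF i(1) U(1) aU, of z] by blast
    have "length u' = k"
      using u'(1) word_step_length realizes_length[OF R] aC elts by (metis subsetD)
    then obtain a' where "a' \<in> D" "h a' = u'" using realizes_surj[OF R] by blast
    then show ?case using edge[OF a(1) i(1) _ aC] u' by blast
  qed
  have bij: "bij_betw (\<psi> \<circ> h) S {reading Y T' | T'. semistandard m n Y T'}"
    unfolding bij_betw_def
  proof
    show "inj_on (\<psi> \<circ> h) S"
    proof (rule inj_onI)
      fix a b assume ab: "a \<in> S" "b \<in> S" "(\<psi> \<circ> h) a = (\<psi> \<circ> h) b"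
      then have "h a = h b"
        using U(1) inS unfolding transport_def by (metis comp_apply inj_onD)
      then show "a = b" using realizes_inj[OF R] inS ab elts by blast
    qed
    show "(\<psi> \<circ> h) ` S = {reading Y T' | T'. semistandard m n Y T'}"
    proof
      show "(\<psi> \<circ> h) ` S \<subseteq> {reading Y T' | T'. semistandard m n Y T'}" using inS by auto
      show "{reading Y T' | T'. semistandard m n Y T'} \<subseteq> (\<psi> \<circ> h) ` S"
      proof
        fix z assume "z \<in> {reading Y T' | T'. semistandard m n Y T'}"
        then have "word_connected m n (reading Y T) z"
          using tableaux_connected[OF n tab(1) T] by blast
        then show "z \<in> (\<psi> \<circ> h) ` S" using surj by force
      qed
    qed
  qed
  note TP = realizes_tensor_power[of m n k]
  have "crystal_iso m n K (tableau_crystal m n Y) (\<psi> \<circ> h)"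
    unfolding crystal_iso_def
  proof (intro conjI ballI)
    show "bij_betw (\<psi> \<circ> h) (elts K) (elts (tableau_crystal m n Y))"
      using bij by (simp add: KS(1) tableau_crystal_def)
    fix b assume "b \<in> elts K"
    then have bS: "b \<in> S" by (simp add: KS(1))
    have bC: "b \<in> elts C" and bU: "h b \<in> U" using inS[OF bS] by blast+
    have bD: "b \<in> D" using bC elts by blast
    have len: "length (h b) = k" using realizes_length[OF R bD] .
    have len': "\<psi> (h b) \<in> {w. length w = k}" using len transportD(3)[OF U(1) bU] by simp
    have mset: "mset (\<psi> (h b)) = mset (h b)" using transportD(2)[OF U(1) bU] .
    show "wt (tableau_crystal m n Y) ((\<psi> \<circ> h) b) = wt K b"
      using realizes_wt[OF TP len'] realizes_wt[OF R bD] mset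
      by (simp add: tableau_crystal_def KS(1) card word_wt_def flip: count_mset)
    fix i assume i: "i \<in> indices m n"
    show "ff (tableau_crystal m n Y) i ((\<psi> \<circ> h) b) = map_option (\<psi> \<circ> h) (ff K i b)"
    proof (cases "ff C i b")
      case None
      have "ff (tensor_power m n k) i (\<psi> (h b)) = None"
      proof (rule ccontr)
        assume "ff (tensor_power m n k) i (\<psi> (h b)) \<noteq> None"
        then obtain z where "word_step i (\<psi> (h b)) z" using realizes_ff[OF TP len', of i] by blast
        then obtain u' where u': "word_step i (h b) u'"
          using transport_step_back(1)[OF i U(1) bU] by blast
        then obtain a' where "a' \<in> D" "h a' = u'"
          using realizes_surj[OF R] word_step_length[OF u'] len by metis
        then show False using None realizes_ff[OF R bD, of i a'] i u' by simp
      qed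
      then show ?thesis using None by (simp add: KS(1) tableau_crystal_def card)
    next
      case (Some b')
      then have "word_step i (h b) (h b')" using realizes_ff[OF R bD] by blast
      then have "word_step i (\<psi> (h b)) (\<psi> (h b'))" using transportD(7)[OF U(1) bU] by blast
      then have "ff (tensor_power m n k) i (\<psi> (h b)) = Some (\<psi> (h b'))"
        using realizes_ff[OF TP len', of i] i word_step_length len' by simp
      then show ?thesis using Some by (simp add: KS(1) tableau_crystal_def card)
    qed
    show "ee (tableau_crystal m n Y) i ((\<psi> \<circ> h) b) = map_option (\<psi> \<circ> h) (ee K i b)"
    proof (cases "ee C i b")
      case None
      have "ee (tensor_power m n k) i (\<psi> (h b)) = None"
      proof (rule ccontr)
        assume "ee (tensor_power m n k) i (\<psi> (h b)) \<noteq> None"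
        then obtain z where "word_step i z (\<psi> (h b))" using realizes_ee[OF TP len', of i] by blast
        then obtain u' where u': "word_step i u' (h b)"
          using transport_step_back(2)[OF i U(1) bU] by blast
        then obtain a' where "a' \<in> D" "h a' = u'"
          using realizes_surj[OF R] word_step_length[OF u'] len by metis
        then show False using None realizes_ee[OF R bD, of i a'] i u' by simp
      qed
      then show ?thesis using None by (simp add: KS(1) tableau_crystal_def card)
    next
      case (Some b')
      then have "word_step i (h b') (h b)" using realizes_ee[OF R bD] by blast
      then have st: "word_step i (\<psi> (h b')) (\<psi> (h b))" using transportD(9)[OF U(1) bU] by blast
      then have "ee (tensor_power m n k) i (\<psi> (h b)) = Some (\<psi> (h b'))"
        using realizes_ee[OF TP len', of i] i word_step_length[OF st] len' by simp
      then show ?thesis using Some by (simp add: KS(1) tableau_crystal_def card)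
    qed
  qed
  then show ?thesis
    using semistandard_hook[OF tab(1) T] card unfolding crystal_isomorphic_def by blast
qed

lemma elts_tensor_power: "elts (tensor_power m n k) = {w. length w = k \<and> set w \<subseteq> letters m n}"
proof (induction k)
  case (Suc k)
  have "elts (tensor_power m n (Suc k)) =
    (\<lambda>(b, w). b # w) ` (letters m n \<times> {w. length w = k \<and> set w \<subseteq> letters m n})"
    using Suc by (simp add: Let_def tensor_def letter_crystal_def)
  then show ?case by (auto simp: length_Suc_conv image_iff)
qed auto

lemma realizes_tableau_crystal:
  "realizes m n {w. length w = card Y} (\<lambda>w. w) (card Y) (tableau_crystal m n Y)"
  using realizes_tensor_power[of m n "card Y"]
  by (simp add: realizes_def tableau_crystal_def)

lemma elts_tableau_crystal: "elts (tableau_crystal m n Y) = {reading Y T | T. semistandard m n Y T}"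
  by (simp add: tableau_crystal_def)

theorem theorem4p15:
  fixes m n :: nat
  assumes "m \<ge> 1" and "n \<ge> 1"
  shows "(\<forall>k. \<forall>C \<in> connected_components m n (tensor_power m n k).
            \<exists>Y. hook_young_diagram m n Y \<and> card Y = k \<and>
              crystal_isomorphic m n C (tableau_crystal m n Y)) \<and>
         (\<forall>Y1 Y2. skew_young_diagram Y1 \<longrightarrow> skew_young_diagram Y2 \<longrightarrow>
            (\<forall>C \<in> connected_components m n
                    (tensor (tableau_crystal m n Y1) (tableau_crystal m n Y2)).
               \<exists>Y. hook_young_diagram m n Y \<and>
                 crystal_isomorphic m n C (tableau_crystal m n Y)))"
proof (intro conjI allI impI ballI)
  fix k C assume C: "C \<in> connected_components m n (tensor_power m n k)"
  show "\<exists>Y. hook_young_diagram m n Y \<and> card Y = k \<and> crystal_isomorphic m n C (tableau_crystal m n Y)"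
  proof (rule component_isomorphic_tableau_crystal[OF assms(2) realizes_tensor_power _ _ _ C])
    show "elts (tensor_power m n k) \<subseteq> {w. length w = k}"
      and "\<And>w. w \<in> elts (tensor_power m n k) \<Longrightarrow> set w \<subseteq> letters m n"
      by (auto simp: elts_tensor_power)
    show "w' \<in> elts (tensor_power m n k)"
      if "i \<in> indices m n" "w \<in> elts (tensor_power m n k)" "w' \<in> {w. length w = k}"
        "word_step i w w' \<or> word_step i w' w" for i w w'
      using that word_step_letters[OF that(1)] unfolding elts_tensor_power by blast
  qed
next
  fix Y1 Y2 C
  assume Y1: "skew_young_diagram Y1" and Y2: "skew_young_diagram Y2"
    and C: "C \<in> connected_components m n (tensor (tableau_crystal m n Y1) (tableau_crystal m n Y2))"
  let ?T1 = "tableau_crystal m n Y1" and ?T2 = "tableau_crystal m n Y2"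
  note fin = skew_young_diagram_convex[OF Y1, THEN conjunct1] skew_young_diagram_convex[OF Y2, THEN conjunct1]
  note conv = skew_young_diagram_convex[OF Y1, THEN conjunct2] skew_young_diagram_convex[OF Y2, THEN conjunct2]
  have elts: "elts (tensor ?T1 ?T2) = elts ?T1 \<times> elts ?T2" by (simp add: tensor_def)
  have words: "length u = card Y1" "set u \<subseteq> letters m n" if "u \<in> elts ?T1" for u
    using that fin(1) by (auto simp: elts_tableau_crystal length_reading set_reading semistandard_letters)
  have words2: "length u = card Y2" "set u \<subseteq> letters m n" if "u \<in> elts ?T2" for u
    using that fin(2) by (auto simp: elts_tableau_crystal length_reading set_reading semistandard_letters)
  have closed1: "z \<in> elts ?T1" if "u \<in> elts ?T1" "i \<in> indices m n" "word_step i u z \<or> word_step i z u" for u z i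
    using semistandard_step[OF fin(1) conv(1) _ that(2)] that(1,3) unfolding elts_tableau_crystal by blast
  have closed2: "z \<in> elts ?T2" if "u \<in> elts ?T2" "i \<in> indices m n" "word_step i u z \<or> word_step i z u" for u z i
    using semistandard_step[OF fin(2) conv(2) _ that(2)] that(1,3) unfolding elts_tableau_crystal by blast
  have "\<exists>Y. hook_young_diagram m n Y \<and> card Y = card Y1 + card Y2 \<and>
      crystal_isomorphic m n C (tableau_crystal m n Y)"
  proof (rule component_isomorphic_tableau_crystal[OF assms(2)
        realizes_tensor[OF realizes_tableau_crystal realizes_tableau_crystal] _ _ _ C])
    show "elts (tensor ?T1 ?T2) \<subseteq> {w. length w = card Y1} \<times> {w. length w = card Y2}"
      unfolding elts using words(1) words2(1) by blast
    show "set (case a of (u, v) \<Rightarrow> u @ v) \<subseteq> letters m n" if "a \<in> elts (tensor ?T1 ?T2)" for a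
      using that words(2) words2(2) unfolding elts by (cases a) simp
    fix i a a'
    assume i: "i \<in> indices m n" and a: "a \<in> elts (tensor ?T1 ?T2)"
      and a': "a' \<in> {w. length w = card Y1} \<times> {w. length w = card Y2}"
      and st: "word_step i (case a of (u, v) \<Rightarrow> u @ v) (case a' of (u, v) \<Rightarrow> u @ v) \<or>
        word_step i (case a' of (u, v) \<Rightarrow> u @ v) (case a of (u, v) \<Rightarrow> u @ v)"
    obtain u v u' v' where uv: "a = (u, v)" "a' = (u', v')" by force
    have u: "u \<in> elts ?T1" and v: "v \<in> elts ?T2" using a unfolding elts uv by blast+
    have len: "length u' = length u" using a' words(1)[OF u] by (simp add: uv)
    have "((word_step i u u' \<or> word_step i u' u) \<and> v' = v) \<or> ((word_step i v v' \<or> word_step i v' v) \<and> u' = u)"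
      using st word_step_append_same_length[OF len, where i = i and v = v and v' = v']
      unfolding uv prod.case by (auto split: if_splits)
    then show "a' \<in> elts (tensor ?T1 ?T2)"
      unfolding elts uv using closed1[OF u i] closed2[OF v i] u v by blast
  qed
  then show "\<exists>Y. hook_young_diagram m n Y \<and> crystal_isomorphic m n C (tableau_crystal m n Y)" by blast
qed

end
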